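(* Let $M$ be a fixed constant and let $(H_n)_{n\ge 1}$ be a sequence of connected graphs, each with at most $M$ edges. Let $(G_n)_{n\ge1}$ be a sequence of tree-like graphs constructed from $(H_n)_{n\ge1}$, i.e. $G_1=H_1$ and, for $n>1$, $G_n=G_{n-1}\oplus_{uv}H_n$ for some vertex $u$ of $G_{n-1}$ and some vertex $v$ of $H_n$. (1) If $\gamma_{\max}(H_n)>\gamma_{\min}(H_n)$ for infinitely many $n$, then the sequence of random variables $(\gamma_{G_n})_{n\ge 1}$ is asymptotically normal. (2) If, instead, $\gamma^{E}_{\max}(H_n)>\gamma^{E}_{\min}(H_n)$ for infinitely many $n$, then the sequence of random variables $(\gamma^{E}_{G_n})_{n\ge1}$ is asymptotically normal.
   Context: Graphs are finite and connected, with loops and multiple edges allowed. A dart is an end of an edge (each edge, including a loop, gives two darts). Orientable cellular embeddings of $G$ are counted as rotation systems, i.e. a choice of cyclic order of the darts around each vertex (there are $\prod_v (d_v-1)!$ of them). General cellular embeddings of $G$ (on orientable or non-orientable closed surfaces) are described by signed rotation systems, i.e. a rotation system together with a choice, for each edge, of being twisted or untwisted; they are counted up to reversing the local orientation at vertices (equivalently, all edges of a fixed spanning tree are untwisted), so that there are $2^{\beta(G)}$ times as many general embeddings as orientable ones, $\beta(G)=|E(G)|-|V(G)|+1$. If $f$ is the number of faces of an embedding, its Euler-genus is $2-|V|+|E|-f$; for an orientable embedding the genus is half of the Euler-genus. $\gamma_{\min}(G),\gamma_{\max}(G)$ are the minimum and maximum genus over all orientable embeddings of $G$; $\gamma^{E}_{\min}(G),\gamma^{E}_{\max}(G)$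 are the minimum and maximum Euler-genus over all general embeddings of $G$. The genus law $\gamma_G$ is the random variable equal to the genus of a uniformly random orientable embedding (rotation system) of $G$; the Euler-genus law $\gamma^{E}_G$ is the Euler-genus of a uniformly random general embedding of $G$. Bar-amalgamation: $G\oplus_{uv}H$ is the graph obtained from the disjoint union of $G$ and $H$ by adding a new edge $\{u,v\}$, where $u$ is a vertex of $G$ and $v$ a vertex of $H$. A sequence of real random variables $(X_n)$ is asymptotically normal if $(X_n-\mathbb{E}X_n)/\sqrt{\mathrm{Var}\,X_n}$ converges in distribution to $\mathcal N(0,1)$. *)

theory Defs
  imports
    "HOL-Probability.Probability"
    "HOL-Combinatorics.Orbits"
    "Graph_Theory.Bidirected_Digraph"
    "Graph_Theory.Digraph_Component"
    "Graph_Theory.Digraph_Isomorphism"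
begin

section \<open>Multigraphs and their darts\<close>

text \<open>
  A multigraph with loops is a bidirected digraph: its arcs are the darts, a dart \<open>d\<close> is
  attached to the vertex \<open>tail d\<close>, and the fixed-point-free involution \<open>opp\<close> maps a dart
  to the other end of its edge.  In particular a loop consists of two different darts
  attached to the same vertex.
\<close>

record ('v, 'd) multigraph =
  dgraph :: "('v, 'd) pre_digraph"
  opp :: "'d \<Rightarrow> 'd"

abbreviation vertices :: "('v, 'd) multigraph \<Rightarrow> 'v set" where
  "vertices G \<equiv> verts (dgraph G)"

abbreviation darts :: "('v, 'd) multigraph \<Rightarrow> 'd set" where
  "darts G \<equiv> arcs (dgraph G)"

abbreviation darts_at :: "('v, 'd) multigraph \<Rightarrow> 'v \<Rightarrow> 'd set" where
  "darts_at G v \<equiv> {d \<in> darts G. tail (dgraph G) d = v}"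

text \<open>
  The name \<open>connected\<close> is qualified because of topological connectedness; the graph-theoretic
  notion includes that there is at least one vertex.
\<close>

definition connected_multigraph :: "('v, 'd) multigraph \<Rightarrow> bool" where
  "connected_multigraph G \<longleftrightarrow>
     fin_digraph (dgraph G) \<and> bidirected_digraph (dgraph G) (opp G) \<and>
     Digraph_Component.connected (dgraph G)"

definition dart_edge :: "('v, 'd) multigraph \<Rightarrow> 'd \<Rightarrow> 'd set" where
  "dart_edge G d = {d, opp G d}"

definition edges :: "('v, 'd) multigraph \<Rightarrow> 'd set set" where
  "edges G = dart_edge G ` darts G"

text \<open>
  A spanning tree is given by its edge set \<open>T\<close>; then \<open>\<Union>T\<close> is its set of darts.
\<close>

definition is_spanning_tree :: "('v, 'd) multigraph \<Rightarrow> 'd set set \<Rightarrow> bool" where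
  "is_spanning_tree G T \<longleftrightarrow>
     T \<subseteq> edges G \<and> Digraph_Component.connected ((dgraph G)\<lparr>arcs := \<Union>T\<rparr>) \<and>
     card T + 1 = card (vertices G)"

definition multigraph_iso :: "('v, 'd) multigraph \<Rightarrow> ('w, 'e) multigraph \<Rightarrow> bool" where
  "multigraph_iso G H \<longleftrightarrow>
     (\<exists>h. pre_digraph.digraph_isomorphism (dgraph G) h \<and> dgraph H = app_iso h (dgraph G) \<and>
          (\<forall>d\<in>darts G. opp H (iso_arcs h d) = iso_arcs h (opp G d)))"

text \<open>
  The new edge \<open>{u, v}\<close> consists of the dart \<open>Inr False\<close> at \<open>u\<close> and the dart
  \<open>Inr True\<close> at \<open>v\<close>.
\<close>

definition bar_amalgamation ::
  "('v, 'd) multigraph \<Rightarrow> 'v \<Rightarrow> ('w, 'e) multigraph \<Rightarrow> 'w \<Rightarrow> ('v + 'w, ('d + 'e) + bool) multigraph"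
  where
  "bar_amalgamation G u H v =
     \<lparr>dgraph =
        \<lparr>verts = vertices G <+> vertices H,
         arcs = (darts G <+> darts H) <+> UNIV,
         tail = case_sum (map_sum (tail (dgraph G)) (tail (dgraph H)))
                  (\<lambda>b. if b then Inr v else Inl u),
         head = case_sum (map_sum (head (dgraph G)) (head (dgraph H)))
                  (\<lambda>b. if b then Inl u else Inr v)\<rparr>,
      opp = map_sum (map_sum (opp G) (opp H)) Not\<rparr>"

text \<open>The sequences are indexed by \<open>n \<ge> 1\<close>; the entries at index \<open>0\<close> are irrelevant.\<close>

definition tree_like_from ::
  "(nat \<Rightarrow> ('w, 'e) multigraph) \<Rightarrow> (nat \<Rightarrow> ('v, 'd) multigraph) \<Rightarrow> bool" where
  "tree_like_from H G \<longleftrightarrow>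
     multigraph_iso (H 1) (G 1) \<and>
     (\<forall>n>1. \<exists>u\<in>vertices (G (n - 1)). \<exists>v\<in>vertices (H n).
        multigraph_iso (bar_amalgamation (G (n - 1)) u (H n) v) (G n))"


section \<open>Embeddings as (signed) rotation systems\<close>

definition rotation_systems :: "('v, 'd) multigraph \<Rightarrow> ('d \<Rightarrow> 'd) set" where
  "rotation_systems G =
     {\<rho>. \<rho> permutes darts G \<and>
         (\<forall>v\<in>vertices G. darts_at G v \<noteq> {} \<longrightarrow> cyclic_on \<rho> (darts_at G v))}"

text \<open>The second component of a signed rotation system is the set of twisted edges.\<close>

definition signed_rotation_systems :: "('v, 'd) multigraph \<Rightarrow> (('d \<Rightarrow> 'd) \<times> 'd set set) set" where
  "signed_rotation_systems G = rotation_systems G \<times> Pow (edges G)"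

text \<open>
  Every signed rotation system describes a general embedding.  Reversing the local
  orientation at a vertex \<open>v\<close> inverts the rotation at \<open>v\<close> and toggles the twist of each
  non-loop edge at \<open>v\<close>; modulo such reversals at the vertices other than a fixed root, every
  signed rotation system has exactly one representative with no twisted edge in the spanning
  tree \<open>T\<close>.  These representatives are the general embeddings that are counted.
\<close>

definition general_embeddings ::
  "('v, 'd) multigraph \<Rightarrow> 'd set set \<Rightarrow> (('d \<Rightarrow> 'd) \<times> 'd set set) set" where
  "general_embeddings G T = {(\<rho>, t) \<in> signed_rotation_systems G. t \<inter> T = {}}"

text \<open>
  Fatten the graph to a ribbon graph: each dart \<open>d\<close> is a band with two sides, where
  \<open>(d, True)\<close> is the side facing the next dart \<open>\<rho> d\<close> at the vertex and \<open>(d, False)\<close> the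
  side facing the previous one.  The relation below glues sides along the corners at the
  vertices and along the edges: seen from the two ends of an untwisted edge, the same side
  of the band lies once on the \<open>True\<close> and once on the \<open>False\<close> side; a twist undoes this.
  The faces are the resulting boundary components.
\<close>

definition side_step ::
  "('v, 'd) multigraph \<Rightarrow> ('d \<Rightarrow> 'd) \<Rightarrow> 'd set set \<Rightarrow> (('d \<times> bool) \<times> ('d \<times> bool)) set" where
  "side_step G \<rho> t =
     {((d, True), (\<rho> d, False)) | d. d \<in> darts G} \<union>
     {((d, s), (opp G d, if dart_edge G d \<in> t then s else \<not> s)) | d s. d \<in> darts G}"

text \<open>
  A connected graph without darts is a single vertex, embedded in the sphere with one face
  that has no dart on its boundary; hence the case distinction.
\<close>

definition num_faces :: "('v, 'd) multigraph \<Rightarrow> ('d \<Rightarrow> 'd) \<Rightarrow> 'd set set \<Rightarrow> nat" where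
  "num_faces G \<rho> t =
     (if darts G = {} then 1
      else card ((darts G \<times> UNIV) // (side_step G \<rho> t \<union> (side_step G \<rho> t)\<inverse>)\<^sup>*))"

definition euler_genus :: "('v, 'd) multigraph \<Rightarrow> ('d \<Rightarrow> 'd) \<times> 'd set set \<Rightarrow> real" where
  "euler_genus G = (\<lambda>(\<rho>, t).
     2 - real (card (vertices G)) + real (card (edges G)) - real (num_faces G \<rho> t))"

definition genus :: "('v, 'd) multigraph \<Rightarrow> ('d \<Rightarrow> 'd) \<Rightarrow> real" where
  "genus G \<rho> = euler_genus G (\<rho>, {}) / 2"

definition genus_min :: "('v, 'd) multigraph \<Rightarrow> real" where
  "genus_min G = Min (genus G ` rotation_systems G)"

definition genus_max :: "('v, 'd) multigraph \<Rightarrow> real" where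
  "genus_max G = Max (genus G ` rotation_systems G)"

definition euler_genus_min :: "('v, 'd) multigraph \<Rightarrow> real" where
  "euler_genus_min G = Min (euler_genus G ` signed_rotation_systems G)"

definition euler_genus_max :: "('v, 'd) multigraph \<Rightarrow> real" where
  "euler_genus_max G = Max (euler_genus G ` signed_rotation_systems G)"


section \<open>Genus laws and asymptotic normality\<close>

definition genus_law :: "('v, 'd) multigraph \<Rightarrow> real pmf" where
  "genus_law G = map_pmf (genus G) (pmf_of_set (rotation_systems G))"

definition euler_genus_law :: "('v, 'd) multigraph \<Rightarrow> 'd set set \<Rightarrow> real pmf" where
  "euler_genus_law G T = map_pmf (euler_genus G) (pmf_of_set (general_embeddings G T))"

text \<open>
  Asymptotic normality depends only on the laws of the random variables.  Standardization
  divides by zero where the variance vanishes (giving the constant \<open>0\<close>).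
\<close>

definition standardized :: "real pmf \<Rightarrow> real measure" where
  "standardized p =
     distr (measure_pmf p) borel
       (\<lambda>x. (x - measure_pmf.expectation p (\<lambda>y. y)) / sqrt (measure_pmf.variance p (\<lambda>y. y)))"

definition asymptotically_normal :: "(nat \<Rightarrow> real pmf) \<Rightarrow> bool" where
  "asymptotically_normal X \<longleftrightarrow> weak_conv_m (\<lambda>n. standardized (X n)) std_normal_distribution"

end

theory Submission
  imports Defs
begin

text \<open>
  Insert the bar of \<open>G \<oplus> H\<close> into embeddings of \<open>G\<close> and of \<open>H\<close>.  Whatever corners are
  chosen, the two faces meeting the bar merge into one, so the Euler-genus is additive; and
  deleting the bar maps uniform embeddings to pairs of independent uniform embeddings.  Hence
  the genus laws convolve, and \<open>\<gamma>\<^bsub>G\<^sub>n\<^esub>\<close> is a sum of independent variables distributed like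
  \<open>\<gamma>\<^bsub>H\<^sub>k\<^esub>\<close>.  A graph with at most \<open>M\<close> edges has boundedly many embeddings, so the summands
  are uniformly bounded and infinitely many of them have variance above a positive constant.
  A central limit theorem for bounded independent variables with divergent total variance,
  proved with characteristic functions, applies.  For general embeddings one first replaces
  the embeddings without twists on a spanning tree by all signed rotation systems: reversals
  of local orientations preserve the faces, and each signed rotation system arises from
  exactly one reversal pattern vanishing at a root.
\<close>

section \<open>Counting components\<close>

text \<open>Faces are components of a graph on the sides of darts, so no boundary walk has to be
  traced and twists need no separate treatment. The bar is inserted in two stages: a half-edge at
  each end, then the band joining them. A half-edge merely subdivides one corner, because its two
  sides always lie in one component; it preserves the face count. The band then touches a single
  component on either side, however it is twisted, so exactly two components fuse. Independence
  rests on a count: the corners open to a half-edge depend on the vertex and not on the rotation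
  there, so all fibres of the deletion map have the same size. All signed rotation systems are
  preferred because arbitrary edge sets split as a product over the two graphs and the bar, while
  the given trees of the \<open>G n\<close> are unrelated for different \<open>n\<close>. In the
  limit theorem the error of the Gaussian approximation of each factor is proportional to its
  variance; the errors add up to a multiple of the total variance \<open>V\<close>, and at
  \<open>u = t / sqrt V\<close> this is of order \<open>1 / sqrt V\<close>. Degenerate
  \<open>H n\<close> thus contribute neither variance nor error.\<close>

definition conn :: "('a \<times> 'a) set \<Rightarrow> ('a \<times> 'a) set" where
  "conn R = (R \<union> R\<inverse>)\<^sup>*"

lemma equiv_conn: "equiv UNIV (conn R)"
  unfolding conn_def by (intro equivI refl_rtrancl sym_rtrancl trans_rtrancl sym_Un_converse) auto

lemma conn_sym: "(x, y) \<in> conn R \<Longrightarrow> (y, x) \<in> conn R"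
  using equiv_conn[of R] by (meson equiv_def symD)

lemma conn_trans: "(x, y) \<in> conn R \<Longrightarrow> (y, z) \<in> conn R \<Longrightarrow> (x, z) \<in> conn R"
  unfolding conn_def by (rule rtrancl_trans)

lemma conn_refl [simp]: "(x, x) \<in> conn R"
  by (simp add: conn_def)

lemma conn_step: "(x, y) \<in> R \<Longrightarrow> (x, y) \<in> conn R"
  by (auto simp: conn_def)

lemma conn_map:
  assumes "(x, y) \<in> conn R" and "\<And>x y. (x, y) \<in> R \<Longrightarrow> (f x, f y) \<in> conn R'"
  shows "(f x, f y) \<in> conn R'"
  using assms(1) unfolding conn_def[of R]
proof (induction rule: rtrancl_induct)
  case (step y z)
  then have "(f y, f z) \<in> conn R'"
    using assms(2) conn_sym by fast
  with step.IH show ?case by (rule conn_trans)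
qed simp

lemma conn_invariant:
  assumes "(x, y) \<in> conn R" and "\<And>x y. (x, y) \<in> R \<Longrightarrow> f x = f y"
  shows "f x = f y"
  using assms(1) unfolding conn_def by (induction rule: rtrancl_induct) (use assms(2) in force)+

lemma conn_mono: "(x, y) \<in> conn R \<Longrightarrow> R \<subseteq> R' \<Longrightarrow> (x, y) \<in> conn R'"
  using conn_map[of x y R "\<lambda>x. x" R'] conn_step[of _ _ R'] by auto

lemma conn_closed:
  assumes "(x, y) \<in> conn R" "R \<subseteq> S \<times> S" "x \<in> S"
  shows "y \<in> S"
  using assms(1,3) unfolding conn_def by (induction rule: rtrancl_induct) (use assms(2) in auto)

lemma conn_class_eq_iff: "conn R `` {x} = conn R `` {y} \<longleftrightarrow> (x, y) \<in> conn R"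
  by (rule eq_equiv_class_iff[OF equiv_conn UNIV_I UNIV_I])

lemma card_image_eq_kernel:
  assumes "\<And>x y. x \<in> S \<Longrightarrow> y \<in> S \<Longrightarrow> f x = f y \<longleftrightarrow> g x = g y"
  shows "card (f ` S) = card (g ` S)"
proof -
  have "bij_betw (\<lambda>z. g (inv_into S f z)) (f ` S) (g ` S)"
    unfolding bij_betw_def
  proof
    have "g (inv_into S f (f x)) = g x" if "x \<in> S" for x
      using assms[of "inv_into S f (f x)" x] that by (simp add: inv_into_into f_inv_into_f)
    then show "(\<lambda>z. g (inv_into S f z)) ` f ` S = g ` S"
      by (simp add: image_image)
    show "inj_on (\<lambda>z. g (inv_into S f z)) (f ` S)"
      by (rule inj_onI) (metis assms f_inv_into_f inv_into_into)
  qed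
  then show ?thesis by (rule bij_betw_same_card)
qed

lemma quotient_eq_image: "S // r = (\<lambda>x. r `` {x}) ` S"
  by (auto simp: quotient_def)

lemma card_quotient_eq_card_image:
  assumes "\<And>x y. x \<in> S \<Longrightarrow> y \<in> S \<Longrightarrow> (x, y) \<in> conn R \<longleftrightarrow> f x = f y"
  shows "card (S // conn R) = card (f ` S)"
  unfolding quotient_eq_image
  using card_image_eq_kernel[of S "\<lambda>x. conn R `` {x}" f] assms conn_class_eq_iff[of R] by simp

text \<open>The map \<open>f\<close> need not be injective or onto; it only has to meet every class
  of \<open>R'\<close>. This covers the inclusion of \<open>D\<close> into
  \<open>insert a D\<close>, a relabelling of darts, and the exchange of sides at reversed
  vertices.\<close>

lemma card_quotient_transfer:
  assumes "\<And>x y. x \<in> S \<Longrightarrow> y \<in> S \<Longrightarrow> (x, y) \<in> conn R \<longleftrightarrow> (f x, f y) \<in> conn R'"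
    and "f ` S \<subseteq> S'" and "\<And>y. y \<in> S' \<Longrightarrow> \<exists>x\<in>S. (f x, y) \<in> conn R'"
  shows "card (S // conn R) = card (S' // conn R')"
proof -
  have "S' // conn R' = (\<lambda>x. conn R' `` {f x}) ` S"
    unfolding quotient_eq_image
  proof
    show "(\<lambda>x. conn R' `` {f x}) ` S \<subseteq> (\<lambda>x. conn R' `` {x}) ` S'"
      using assms(2) by auto
    show "(\<lambda>x. conn R' `` {x}) ` S' \<subseteq> (\<lambda>x. conn R' `` {f x}) ` S"
    proof (rule image_subsetI)
      fix y assume "y \<in> S'"
      from assms(3)[OF this] obtain x where "x \<in> S" "(f x, y) \<in> conn R'" by blast
      then show "conn R' `` {y} \<in> (\<lambda>x. conn R' `` {f x}) ` S"
        using conn_class_eq_iff[of R' "f x" y] by blast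
    qed
  qed
  then show ?thesis
    using card_quotient_eq_card_image[of S R "\<lambda>x. conn R' `` {f x}"] assms(1)
      conn_class_eq_iff[of R'] by simp
qed

text \<open>All links in \<open>J\<close> run between the class of \<open>p1\<close> and the class
  of \<open>p2\<close>, since \<open>p1'\<close> and \<open>p2'\<close> lie in these same classes.
  However many links there are, just one pair of classes fuses.\<close>

lemma card_quotient_join:
  assumes fin: "finite S1" "finite S2" and disj: "S1 \<inter> S2 = {}"
    and R1: "R1 \<subseteq> S1 \<times> S1" and R2: "R2 \<subseteq> S2 \<times> S2"
    and p: "p1 \<in> S1" "p1' \<in> S1" "(p1, p1') \<in> conn R1"
    and q: "p2 \<in> S2" "p2' \<in> S2" "(p2, p2') \<in> conn R2"
    and J: "J \<subseteq> {p1, p1'} \<times> {p2, p2'} \<union> {p2, p2'} \<times> {p1, p1'}" "J \<noteq> {}"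
  shows "card ((S1 \<union> S2) // conn (R1 \<union> R2 \<union> J)) + 1 = card (S1 // conn R1) + card (S2 // conn R2)"
proof -
  let ?R = "R1 \<union> R2 \<union> J"
  let ?C1 = "conn R1 `` {p1}" and ?C2 = "conn R2 `` {p2}"
  \<comment> \<open>The label \<open>k\<close> is a complete invariant of the joined relation:
    \<open>None\<close> marks the fused class, and every other class keeps itself as label. Labels
    from the two sides cannot collide because classes stay inside \<open>S1\<close> or inside
    \<open>S2\<close>.\<close>
  define k where "k z = (let c = (if z \<in> S1 then conn R1 `` {z} else conn R2 `` {z})
     in if c = ?C1 \<or> c = ?C2 then None else Some c)" for z
  have cl1: "conn R1 `` {z} \<subseteq> S1" if "z \<in> S1" for z
    using conn_closed[OF _ R1] that by blast
  have cl2: "conn R2 `` {z} \<subseteq> S2" if "z \<in> S2" for z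
    using conn_closed[OF _ R2] that by blast
  have self: "z \<in> conn R `` {z}" for z :: 'a and R by simp
  have ne12: "conn R1 `` {z} \<noteq> conn R2 `` {w}" if "z \<in> S1" "w \<in> S2" for z w
    using cl1[OF that(1)] cl2[OF that(2)] self[of z R1] disj by blast
  have k1: "k z = (if (z, p1) \<in> conn R1 then None else Some (conn R1 `` {z}))" if "z \<in> S1" for z
    using that ne12[OF that q(1)] conn_class_eq_iff[of R1 z p1] by (simp add: k_def Let_def)
  have k2: "k z = (if (z, p2) \<in> conn R2 then None else Some (conn R2 `` {z}))" if "z \<in> S2" for z
    using that disj ne12[OF p(1) that] conn_class_eq_iff[of R2 z p2] by (auto simp: k_def Let_def)
  have kp: "k z = None" if "z \<in> {p1, p1', p2, p2'}" for z
    using that p q k1 k2 conn_sym[OF p(3)] conn_sym[OF q(3)] by auto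
  have kR: "k x = k y" if "(x, y) \<in> ?R" for x y
    using that
  proof (elim UnE)
    assume "(x, y) \<in> R1"
    then have "x \<in> S1" "y \<in> S1" "(x, y) \<in> conn R1" using R1 by (auto intro: conn_step)
    then show ?thesis
      using conn_class_eq_iff[of R1 x y] conn_sym[of x y R1] conn_trans[of x y R1 p1] conn_trans[of y x R1 p1]
      by (auto simp: k1)
  next
    assume "(x, y) \<in> R2"
    then have "x \<in> S2" "y \<in> S2" "(x, y) \<in> conn R2" using R2 by (auto intro: conn_step)
    then show ?thesis
      using conn_class_eq_iff[of R2 x y] conn_sym[of x y R2] conn_trans[of x y R2 p2] conn_trans[of y x R2 p2]
      by (auto simp: k2)
  next
    assume "(x, y) \<in> J"
    then have "x \<in> {p1, p1', p2, p2'}" "y \<in> {p1, p1', p2, p2'}" using J(1) by auto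
    then show ?thesis using kp by metis
  qed
  have up1: "(x, y) \<in> conn ?R" if "(x, y) \<in> conn R1" for x y
    using that by (rule conn_mono) auto
  have up2: "(x, y) \<in> conn ?R" if "(x, y) \<in> conn R2" for x y
    using that by (rule conn_mono) auto
  have p12: "(p1, p2) \<in> conn ?R"
  proof -
    obtain u v where uv: "(u, v) \<in> J" using J(2) by auto
    have p11: "(p1, w) \<in> conn ?R" if "w \<in> {p1, p1'}" for w using that up1[OF p(3)] by auto
    have p22: "(p2, w) \<in> conn ?R" if "w \<in> {p2, p2'}" for w using that up2[OF q(3)] by auto
    have st: "(u, v) \<in> conn ?R" using uv by (intro conn_step) auto
    from uv J(1) consider "u \<in> {p1, p1'}" "v \<in> {p2, p2'}" | "v \<in> {p1, p1'}" "u \<in> {p2, p2'}" by auto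
    then show ?thesis
    proof cases
      case 1
      then show ?thesis using p11[of u] p22[of v] st by (meson conn_sym conn_trans)
    next
      case 2
      then show ?thesis using p11[of v] p22[of u] st by (meson conn_sym conn_trans)
    qed
  qed
  have merged: "(z, p1) \<in> conn ?R" if "z \<in> S1 \<union> S2" "k z = None" for z
  proof (cases "z \<in> S1")
    case True
    then have "(z, p1) \<in> conn R1" using that k1[of z] by (auto split: if_splits)
    then show ?thesis by (rule up1)
  next
    case False
    then have "(z, p2) \<in> conn R2" using that k2[of z] by (auto split: if_splits)
    from up2[OF this] conn_sym[OF p12] show ?thesis by (rule conn_trans)
  qed
  have k_class: "k z \<noteq> None \<longleftrightarrow> k z = Some (conn (if z \<in> S1 then R1 else R2) `` {z})" if "z \<in> S1 \<union> S2" for z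
    using that k1[of z] k2[of z] disj by auto
  have kernel: "(x, y) \<in> conn ?R \<longleftrightarrow> k x = k y" if S: "x \<in> S1 \<union> S2" "y \<in> S1 \<union> S2" for x y
  proof
    show "k x = k y" if "(x, y) \<in> conn ?R" using that kR by (rule conn_invariant)
    assume eq: "k x = k y"
    show "(x, y) \<in> conn ?R"
    proof (cases "k x")
      case None
      then show ?thesis using merged[OF S(1)] merged[OF S(2)] None eq by (metis conn_sym conn_trans)
    next
      case (Some c)
      then have "conn (if x \<in> S1 then R1 else R2) `` {x} = conn (if y \<in> S1 then R1 else R2) `` {y}"
        using k_class[OF S(1)] k_class[OF S(2)] eq by simp
      moreover from this have "x \<in> S1 \<longleftrightarrow> y \<in> S1"
        using S ne12[of x y] ne12[of y x] by (auto split: if_splits)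
      ultimately have "(x, y) \<in> conn R1 \<or> (x, y) \<in> conn R2"
        using conn_class_eq_iff[of R1 x y] conn_class_eq_iff[of R2 x y] by (auto split: if_splits)
      then show ?thesis
        using up1 up2 by blast
    qed
  qed
  note quot1 = quotient_eq_image[of S1 "conn R1"] and quot2 = quotient_eq_image[of S2 "conn R2"]
  have "k ` (S1 \<union> S2) = insert None (Some ` ((S1 // conn R1 - {?C1}) \<union> (S2 // conn R2 - {?C2})))"
  proof (intro equalityI subsetI)
    fix c assume "c \<in> k ` (S1 \<union> S2)"
    then obtain z where z: "z \<in> S1 \<union> S2" "c = k z" by blast
    then consider "c = None" | "z \<in> S1" "c = Some (conn R1 `` {z})" "conn R1 `` {z} \<noteq> ?C1"
      | "z \<in> S2" "c = Some (conn R2 `` {z})" "conn R2 `` {z} \<noteq> ?C2"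
      using k1[of z] k2[of z] conn_class_eq_iff[of R1 z p1] conn_class_eq_iff[of R2 z p2]
      by (metis UnE)
    then show "c \<in> insert None (Some ` ((S1 // conn R1 - {?C1}) \<union> (S2 // conn R2 - {?C2})))"
      unfolding quot1 quot2 by cases blast+
  next
    fix c assume "c \<in> insert None (Some ` ((S1 // conn R1 - {?C1}) \<union> (S2 // conn R2 - {?C2})))"
    then consider "c = None" | z where "z \<in> S1" "c = Some (conn R1 `` {z})" "conn R1 `` {z} \<noteq> ?C1"
      | z where "z \<in> S2" "c = Some (conn R2 `` {z})" "conn R2 `` {z} \<noteq> ?C2"
      by (auto simp: quot1 quot2)
    then show "c \<in> k ` (S1 \<union> S2)"
    proof cases
      case 1
      then show ?thesis using kp[of p1] p(1) by (intro image_eqI[of _ _ p1]) auto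
    next
      case (2 z)
      then show ?thesis
        using k1[of z] conn_class_eq_iff[of R1 z p1] by (intro image_eqI[of _ _ z]) auto
    next
      case (3 z)
      then show ?thesis
        using k2[of z] conn_class_eq_iff[of R2 z p2] by (intro image_eqI[of _ _ z]) auto
    qed
  qed
  moreover have "(S1 // conn R1 - {?C1}) \<inter> (S2 // conn R2 - {?C2}) = {}"
    using ne12 by (auto simp: quot1 quot2)
  moreover have "?C1 \<in> S1 // conn R1" "?C2 \<in> S2 // conn R2" using p q by (auto simp: quot1 quot2)
  moreover have finq: "finite (S1 // conn R1)" "finite (S2 // conn R2)" using fin by (auto simp: quot1 quot2)
  ultimately have "card (k ` (S1 \<union> S2)) = Suc ((card (S1 // conn R1) - 1) + (card (S2 // conn R2) - 1))"
    by (simp add: card_image card_Un_disjoint)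
  moreover have "card (S1 // conn R1) > 0" "card (S2 // conn R2) > 0"
    using finq \<open>?C1 \<in> S1 // conn R1\<close> \<open>?C2 \<in> S2 // conn R2\<close> by (auto simp: card_gt_0_iff)
  ultimately show ?thesis
    using card_quotient_eq_card_image[of "S1 \<union> S2" ?R k, OF kernel] by simp
qed

section \<open>Fixed-point-free involutions\<close>

text \<open>Nothing is demanded outside \<open>D\<close>, so a single \<open>\<theta>\<close> on the
  joined dart set can serve both halves and the bar.\<close>

definition fpf_involution_on :: "'d set \<Rightarrow> ('d \<Rightarrow> 'd) \<Rightarrow> bool" where
  "fpf_involution_on D f \<longleftrightarrow> (\<forall>d\<in>D. f d \<in> D \<and> f (f d) = d \<and> f d \<noteq> d)"

definition dart_edges :: "'d set \<Rightarrow> ('d \<Rightarrow> 'd) \<Rightarrow> 'd set set" where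
  "dart_edges D \<theta> = (\<lambda>d. {d, \<theta> d}) ` D"

lemma Union_edges_subset:
  assumes "fpf_involution_on D \<theta>" "t \<subseteq> dart_edges D \<theta>"
  shows "\<Union>t \<subseteq> D"
proof (rule Union_least)
  fix X assume "X \<in> t"
  then obtain d where "d \<in> D" "X = {d, \<theta> d}" using assms(2) by (auto simp: dart_edges_def)
  then show "X \<subseteq> D" using assms(1) by (simp add: fpf_involution_on_def)
qed

lemma card_dart_edges:
  assumes "finite D" "fpf_involution_on D \<theta>"
  shows "2 * card (dart_edges D \<theta>) = card D"
proof -
  have \<theta>: "\<theta> d \<in> D" "\<theta> (\<theta> d) = d" "\<theta> d \<noteq> d" if "d \<in> D" for d
    using that assms(2) by (auto simp: fpf_involution_on_def)
  have "2 * card (dart_edges D \<theta>) = card (\<Union>(dart_edges D \<theta>))"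
  proof (rule card_partition)
    show "card X = 2" if "X \<in> dart_edges D \<theta>" for X
    proof -
      obtain d where "d \<in> D" "X = {d, \<theta> d}" using \<open>X \<in> _\<close> by (auto simp: dart_edges_def)
      then show ?thesis using \<theta>(3)[of d] by (simp add: card_insert_if eq_commute[of d])
    qed
    show "X \<inter> Y = {}" if XY: "X \<in> dart_edges D \<theta>" "Y \<in> dart_edges D \<theta>" "X \<noteq> Y" for X Y
    proof -
      obtain x y where "x \<in> D" "X = {x, \<theta> x}" "y \<in> D" "Y = {y, \<theta> y}" using XY(1,2) by (auto simp: dart_edges_def)
      moreover from this have "\<theta> x = \<theta> y \<longleftrightarrow> x = y" using \<theta>(2) by metis
      ultimately show ?thesis using XY(3) \<theta>(2) by auto
    qed
    have "\<Union>(dart_edges D \<theta>) \<subseteq> D"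
      by (rule Union_edges_subset[OF assms(2)]) simp
    then show "finite (\<Union>(dart_edges D \<theta>))" using assms(1) by (rule finite_subset)
  qed (use assms(1) in \<open>simp add: dart_edges_def\<close>)
  moreover have "\<Union>(dart_edges D \<theta>) = D"
    using Union_edges_subset[OF assms(2), of "dart_edges D \<theta>"] by (auto simp: dart_edges_def)
  ultimately show ?thesis by simp
qed

text \<open>The orbits \<open>{x, c x}\<close> take the role of edges in
  \<open>card_dart_edges\<close>.\<close>

lemma even_card_involution:
  assumes "finite K" "\<And>x. x \<in> K \<Longrightarrow> c x \<in> K" "\<And>x. x \<in> K \<Longrightarrow> c (c x) = x" "\<And>x. x \<in> K \<Longrightarrow> c x \<noteq> x"
  shows "even (card K)"
  using card_dart_edges[of K c] assms unfolding fpf_involution_on_def by (metis dvd_triv_left)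

section \<open>Faces and bars\<close>

text \<open>The relation \<open>side_step\<close> is split into corners and bands because a
  half-edge has the former only: for a half-edge \<open>a\<close>, corners are taken over
  \<open>insert a D\<close> but bands over \<open>D\<close>.\<close>

definition corners :: "'d set \<Rightarrow> ('d \<Rightarrow> 'd) \<Rightarrow> (('d \<times> bool) \<times> ('d \<times> bool)) set" where
  "corners D \<rho> = {((d, True), (\<rho> d, False)) | d. d \<in> D}"

definition bands :: "'d set \<Rightarrow> ('d \<Rightarrow> 'd) \<Rightarrow> 'd set set \<Rightarrow> (('d \<times> bool) \<times> ('d \<times> bool)) set" where
  "bands D \<theta> t = {((d, s), (\<theta> d, if {d, \<theta> d} \<in> t then s else \<not> s)) | d s. d \<in> D}"

definition face_count :: "'d set \<Rightarrow> ('d \<Rightarrow> 'd) \<Rightarrow> ('d \<Rightarrow> 'd) \<Rightarrow> 'd set set \<Rightarrow> nat" where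
  "face_count D \<theta> \<rho> t =
     (if D = {} then 1 else card ((D \<times> UNIV) // conn (corners D \<rho> \<union> bands D \<theta> t)))"

lemma num_faces_eq_face_count: "num_faces G \<rho> t = face_count (darts G) (opp G) \<rho> t"
  by (simp add: num_faces_def face_count_def side_step_def corners_def bands_def dart_edge_def conn_def)

lemma corners_subset: "\<rho> permutes D \<Longrightarrow> corners D \<rho> \<subseteq> (D \<times> UNIV) \<times> (D \<times> UNIV)"
  by (auto simp: corners_def permutes_in_image)

lemma bands_subset: "fpf_involution_on D \<theta> \<Longrightarrow> bands D \<theta> t \<subseteq> (D \<times> UNIV) \<times> (D \<times> UNIV)"
  by (auto simp: bands_def fpf_involution_on_def)

lemma mem_corners_iff: "((d, s), w) \<in> corners D \<rho> \<longleftrightarrow> d \<in> D \<and> s \<and> w = (\<rho> d, False)"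
  by (auto simp: corners_def)

lemma mem_bands_iff:
  "((d, s), w) \<in> bands D \<theta> t \<longleftrightarrow> d \<in> D \<and> w = (\<theta> d, if {d, \<theta> d} \<in> t then s else \<not> s)"
  unfolding bands_def mem_Collect_eq by (auto split del: if_split)

lemma bands_cong:
  assumes "\<And>d. d \<in> D \<Longrightarrow> {d, \<theta> d} \<in> t \<longleftrightarrow> {d, \<theta> d} \<in> t'"
  shows "bands D \<theta> t = bands D \<theta> t'"
  unfolding set_eq_iff split_paired_All mem_bands_iff using assms by auto

lemma bands_Un: "bands (A \<union> B) \<theta> t = bands A \<theta> t \<union> bands B \<theta> t"
  unfolding set_eq_iff split_paired_All Un_iff mem_bands_iff by blast

lemma corners_Un:
  assumes "\<sigma> permutes A" "\<tau> permutes B" "A \<inter> B = {}"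
  shows "corners (A \<union> B) (\<sigma> \<circ> \<tau>) = corners A \<sigma> \<union> corners B \<tau>"
proof -
  have "(\<sigma> \<circ> \<tau>) d = \<sigma> d" if "d \<in> A" for d
    using that assms permutes_not_in[of \<tau> B d] by (simp add: disjoint_iff)
  moreover have "(\<sigma> \<circ> \<tau>) d = \<tau> d" if "d \<in> B" for d
    using that assms permutes_not_in[of \<sigma> A "\<tau> d"] permutes_in_image[of \<tau> B d] by auto
  ultimately have "corners A (\<sigma> \<circ> \<tau>) = corners A \<sigma>" "corners B (\<sigma> \<circ> \<tau>) = corners B \<tau>"
    unfolding corners_def Setcompr_eq_image by (simp_all cong: image_cong)
  moreover have "corners (A \<union> B) (\<sigma> \<circ> \<tau>) = corners A (\<sigma> \<circ> \<tau>) \<union> corners B (\<sigma> \<circ> \<tau>)"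
    unfolding corners_def Setcompr_eq_image by (rule image_Un)
  ultimately show ?thesis by simp
qed

text \<open>A half-edge at the dart \<open>a\<close> leaves \<open>a\<close> with two sides but no band.  Corners pair up all
  sides, bands all sides but those of \<open>a\<close>; by parity the two sides of \<open>a\<close> lie in one component.\<close>

lemma half_edge_sides_connected:
  assumes fin: "finite D" and a: "a \<notin> D" and \<rho>: "\<rho> permutes insert a D"
    and \<theta>: "fpf_involution_on D \<theta>"
  shows "((a, True), (a, False)) \<in> conn (corners (insert a D) \<rho> \<union> bands D \<theta> t)"
proof (rule ccontr)
  let ?R = "corners (insert a D) \<rho> \<union> bands D \<theta> t"
  let ?S = "insert a D \<times> (UNIV :: bool set)"
  assume not: "((a, True), (a, False)) \<notin> conn ?R"
  define K where "K = {z \<in> ?S. ((a, True), z) \<in> conn ?R}"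
  have finK: "finite K" unfolding K_def using fin by auto
  have stepK: "z \<in> K \<longleftrightarrow> w \<in> K" if "(z, w) \<in> ?R" for z w
  proof -
    have "?R \<subseteq> ?S \<times> ?S" using corners_subset[OF \<rho>] bands_subset[OF \<theta>, of t] by blast
    then have "z \<in> ?S" "w \<in> ?S" using that by auto
    moreover have "(z, w) \<in> conn ?R" using that by (rule conn_step)
    ultimately show ?thesis unfolding K_def using conn_trans conn_sym by fast
  qed
  \<comment> \<open>Every side lies on exactly one corner, and \<open>c\<close> crosses it; the side
    flag changes, so there is no fixed point.\<close>
  define c where "c = (\<lambda>(d, s). if s then (\<rho> d, False) else (inv \<rho> d, True))"
  have "even (card K)"
  proof (rule even_card_involution[where c=c])
    fix z assume z: "z \<in> K"
    obtain d s where ds: "z = (d, s)" by (cases z)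
    then have d: "d \<in> insert a D" using z by (auto simp: K_def)
    show "c (c z) = z" "c z \<noteq> z"
      using permutes_inverses[OF \<rho>] by (auto simp: ds c_def)
    show "c z \<in> K"
    proof (cases s)
      case True
      then have "(z, c z) \<in> ?R" using d by (auto simp: ds c_def corners_def)
      then show ?thesis using stepK z by blast
    next
      case False
      have "inv \<rho> d \<in> insert a D" using d permutes_in_image[OF permutes_inv[OF \<rho>]] by blast
      then have "(c z, z) \<in> ?R"
        using False permutes_inverses(1)[OF \<rho>] by (auto simp: ds c_def corners_def)
      then show ?thesis using stepK z by blast
    qed
  qed (rule finK)
  \<comment> \<open>The component \<open>K\<close> omits \<open>(a, False)\<close> by assumption, so
    \<open>(a, True)\<close> is its only side without a band. Crossing bands is an involution on the
    rest, and \<open>K\<close> would stay even after losing one element.\<close>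
  moreover have "even (card (K - {(a, True)}))"
  proof (rule even_card_involution)
    let ?e = "\<lambda>(d, s). (\<theta> d, if {d, \<theta> d} \<in> t then s else \<not> s)"
    fix z assume z: "z \<in> K - {(a, True)}"
    obtain d s where ds: "z = (d, s)" by (cases z)
    then have "d \<noteq> a" using z not by (cases s) (auto simp: K_def)
    then have d: "d \<in> D" using z ds by (auto simp: K_def)
    then have o: "\<theta> d \<in> D" "\<theta> (\<theta> d) = d" "\<theta> d \<noteq> d"
      using \<theta> by (auto simp: fpf_involution_on_def)
    show "?e z \<noteq> z" using o by (simp add: ds)
    show "?e (?e z) = z" using o by (simp add: ds insert_commute)
    have "(z, ?e z) \<in> ?R" using d by (auto simp: ds bands_def)
    then show "?e z \<in> K - {(a, True)}" using stepK z o a by (auto simp: ds)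
  qed (use finK in simp)
  moreover have "(a, True) \<in> K" by (simp add: K_def)
  ultimately show False
    using card.remove[OF finK, of "(a, True)"] even_Suc by metis
qed

text \<open>The half-edge placed after \<open>x\<close> replaces the corner from
  \<open>(x, True)\<close> to \<open>(\<rho> x, False)\<close> by one corner from
  \<open>(x, True)\<close> to \<open>(a, False)\<close> and one from \<open>(a, True)\<close> to
  \<open>(\<rho> x, False)\<close>. Since the two sides of \<open>a\<close> are connected anyway,
  this only subdivides a connection.\<close>

lemma face_count_half_edge:
  assumes fin: "finite D" and a: "a \<notin> D" and \<rho>: "\<rho> permutes D"
    and \<theta>: "fpf_involution_on D \<theta>"
    and x: "if D = {} then x = a else x \<in> D"
  shows "card ((insert a D \<times> UNIV) // conn (corners (insert a D) (\<rho> \<circ> Transposition.transpose x a) \<union> bands D \<theta> t))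
           = face_count D \<theta> \<rho> t"
proof -
  let ?\<rho> = "\<rho> \<circ> Transposition.transpose x a"
  let ?R = "corners D \<rho> \<union> bands D \<theta> t"
  let ?R' = "corners (insert a D) ?\<rho> \<union> bands D \<theta> t"
  have \<rho>': "?\<rho> permutes insert a D"
    using x by (intro permutes_compose permutes_swap_id permutes_subset[OF \<rho>]) (auto split: if_splits)
  have aa: "((a, True), (a, False)) \<in> conn ?R'"
    by (rule half_edge_sides_connected[OF fin a \<rho>' \<theta>])
  show ?thesis
  proof (cases "D = {}")
    case True
    \<comment> \<open>At a vertex without darts the transposition is trivial and the half-edge
      bounds one component, in agreement with the default value 1 in
      \<open>face_count\<close>.\<close>
    have eq: "insert a D \<times> (UNIV :: bool set) = {(a, True), (a, False)}" using True by auto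
    have "card ((insert a D \<times> UNIV) // conn ?R') = card ((\<lambda>_. True) ` (insert a D \<times> (UNIV :: bool set)))"
      by (rule card_quotient_eq_card_image) (use aa conn_sym[OF aa] in \<open>auto simp: eq\<close>)
    then show ?thesis using True by (simp add: face_count_def image_constant_conv)
  next
    case False
    then have xD: "x \<in> D" and xa: "x \<noteq> a" using x a by auto
    have \<rho>a: "\<rho> a = a" using \<rho> a by (simp add: permutes_not_in)
    have r: "?\<rho> x = a" "?\<rho> a = \<rho> x" "\<And>d. d \<noteq> x \<Longrightarrow> d \<noteq> a \<Longrightarrow> ?\<rho> d = \<rho> d"
      using \<rho>a xa by (auto simp: Transposition.transpose_def)
    have xaF: "((x, True), (a, False)) \<in> conn ?R'"
      using xD r(1) by (intro conn_step) (simp add: mem_corners_iff del: comp_apply)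
    have aT: "((a, True), (\<rho> x, False)) \<in> conn ?R'"
      using r(2) by (intro conn_step) (simp add: mem_corners_iff del: comp_apply)
    have x\<rho>x: "((x, True), (\<rho> x, False)) \<in> conn ?R'"
      using xaF conn_sym[OF aa] aT by (meson conn_trans)
    \<comment> \<open>A retraction that contracts the two new corners: \<open>(a, False)\<close>
      goes back to \<open>(x, True)\<close> and \<open>(a, True)\<close> on to
      \<open>(\<rho> x, False)\<close>. Each step of \<open>?R'\<close> becomes trivial or a step of
      \<open>?R\<close>.\<close>
    define f where "f z = (if z = (a, True) then (\<rho> x, False) else if z = (a, False) then (x, True) else z)" for z
    have "card ((D \<times> UNIV) // conn ?R) = card ((insert a D \<times> UNIV) // conn ?R')"
    proof (rule card_quotient_transfer[where f="\<lambda>z. z"])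
      fix u v :: "'a \<times> bool" assume u: "u \<in> D \<times> UNIV" and v: "v \<in> D \<times> UNIV"
      have fu: "f u = u" "f v = v" using u v a by (auto simp: f_def)
      show "(u, v) \<in> conn ?R \<longleftrightarrow> (u, v) \<in> conn ?R'"
      proof
        assume "(u, v) \<in> conn ?R"
        then show "(u, v) \<in> conn ?R'"
        proof (rule conn_map[where f="\<lambda>z. z"])
          fix z w assume "(z, w) \<in> ?R"
          then consider "(z, w) \<in> bands D \<theta> t" | d where "d \<in> D" "z = (d, True)" "w = (\<rho> d, False)"
            by (auto simp: corners_def)
          then show "(z, w) \<in> conn ?R'"
          proof cases
            case (2 d)
            show ?thesis
            proof (cases "d = x")
              case False
              moreover have "d \<noteq> a" using 2 a by auto
              ultimately have "(z, w) \<in> corners (insert a D) ?\<rho>"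
                using 2 r(3) by (simp add: mem_corners_iff del: comp_apply)
              then show ?thesis by (intro conn_step) simp
            qed (use x\<rho>x 2 in simp)
          qed (auto intro: conn_step)
        qed
      next
        assume "(u, v) \<in> conn ?R'"
        then have "(f u, f v) \<in> conn ?R"
        proof (rule conn_map)
          fix z w assume "(z, w) \<in> ?R'"
          then consider "(z, w) \<in> bands D \<theta> t" | d where "d \<in> insert a D" "z = (d, True)" "w = (?\<rho> d, False)"
            unfolding corners_def by blast
          then show "(f z, f w) \<in> conn ?R"
          proof cases
            case 1
            then have "f z = z" "f w = w" using bands_subset[OF \<theta>, of t] a by (auto simp: f_def)
            then show ?thesis using 1 by (auto intro: conn_step)
          next
            case (2 d)
            consider "d = x" | "d = a" | "d \<noteq> x" "d \<noteq> a" by blast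
            then show ?thesis
            proof cases
              case 1
              then show ?thesis using 2 r(1) xa by (simp add: f_def)
            next
              case xa': 2
              have "\<rho> x \<noteq> a" using xD a permutes_in_image[OF \<rho>] by metis
              then show ?thesis using 2 xa' r(2) by (simp add: f_def)
            next
              case 3
              then have "d \<in> D" "\<rho> d \<noteq> a" using 2 a permutes_in_image[OF \<rho>] by auto
              then have "f z = z" "f w = w" "(z, w) \<in> corners D \<rho>"
                using 2 3 r(3)[of d] by (auto simp: f_def mem_corners_iff)
              then show ?thesis by (auto intro: conn_step)
            qed
          qed
        qed
        then show "(u, v) \<in> conn ?R" by (simp add: fu)
      qed
    next
      fix y :: "'a \<times> bool" assume y: "y \<in> insert a D \<times> UNIV"
      have "\<rho> x \<in> D" using xD permutes_in_image[OF \<rho>] by blast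
      then have "\<exists>z\<in>D \<times> UNIV. (z, (a, True)) \<in> conn ?R'" "\<exists>z\<in>D \<times> UNIV. (z, (a, False)) \<in> conn ?R'"
        using conn_sym[OF aT] xaF xD by blast+
      moreover have "y \<in> D \<times> UNIV \<or> y = (a, True) \<or> y = (a, False)"
        using y by (cases y) auto
      ultimately show "\<exists>z\<in>D \<times> UNIV. (z, y) \<in> conn ?R'"
        by (elim disjE) (rule bexI[of _ y], rule conn_refl, assumption, simp_all only:)
    qed auto
    then show ?thesis using False by (simp add: face_count_def)
  qed
qed

text \<open>The half-edges at \<open>a\<close> and \<open>b\<close> leave both face counts
  unchanged. The band of the bar joins sides of \<open>a\<close> to sides of \<open>b\<close>, and
  either pair of sides lies in one component, so \<open>card_quotient_join\<close> applies. The set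
  \<open>t3\<close> decides whether the bar is twisted, which only permutes the links.\<close>

lemma face_count_join:
  assumes fin: "finite D1" "finite D2" and disj: "insert a D1 \<inter> insert b D2 = {}"
    and ab: "a \<notin> D1" "b \<notin> D2"
    and \<rho>: "\<rho>1 permutes D1" "\<rho>2 permutes D2"
    and \<theta>: "fpf_involution_on D1 \<theta>" "fpf_involution_on D2 \<theta>" "\<theta> a = b" "\<theta> b = a"
    and x: "if D1 = {} then x = a else x \<in> D1" and y: "if D2 = {} then y = b else y \<in> D2"
    and t: "t1 \<subseteq> dart_edges D1 \<theta>" "t2 \<subseteq> dart_edges D2 \<theta>" "t3 \<subseteq> {{a, b}}"
  shows "face_count (insert a D1 \<union> insert b D2) \<theta>
           ((\<rho>1 \<circ> Transposition.transpose x a) \<circ> (\<rho>2 \<circ> Transposition.transpose y b)) (t1 \<union> t2 \<union> t3) + 1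
         = face_count D1 \<theta> \<rho>1 t1 + face_count D2 \<theta> \<rho>2 t2"
proof -
  let ?s = "\<rho>1 \<circ> Transposition.transpose x a" and ?t = "\<rho>2 \<circ> Transposition.transpose y b" and ?T = "t1 \<union> t2 \<union> t3"
  let ?A = "insert a D1" and ?B = "insert b D2"
  let ?R1 = "corners ?A ?s \<union> bands D1 \<theta> t1" and ?R2 = "corners ?B ?t \<union> bands D2 \<theta> t2"
  have s: "?s permutes ?A"
    using x by (intro permutes_compose permutes_swap_id permutes_subset[OF \<rho>(1)]) (auto split: if_splits)
  have t': "?t permutes ?B"
    using y by (intro permutes_compose permutes_swap_id permutes_subset[OF \<rho>(2)]) (auto split: if_splits)
  have U: "\<Union>t1 \<subseteq> D1" "\<Union>t2 \<subseteq> D2" "\<Union>t3 \<subseteq> {a, b}"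
    using Union_edges_subset[OF \<theta>(1) t(1)] Union_edges_subset[OF \<theta>(2) t(2)] t(3) by auto
  have T1: "{d, \<theta> d} \<in> ?T \<longleftrightarrow> {d, \<theta> d} \<in> t1" if "d \<in> D1" for d
  proof -
    have "{d, \<theta> d} \<notin> t2" "{d, \<theta> d} \<notin> t3" using that U(2,3) disj ab(1) by auto
    then show ?thesis by simp
  qed
  have T2: "{d, \<theta> d} \<in> ?T \<longleftrightarrow> {d, \<theta> d} \<in> t2" if "d \<in> D2" for d
  proof -
    have "{d, \<theta> d} \<notin> t1" "{d, \<theta> d} \<notin> t3" using that U(1,3) disj ab(2) by auto
    then show ?thesis by simp
  qed
  have "?A \<union> ?B = D1 \<union> D2 \<union> {a, b}" by auto
  then have "bands (?A \<union> ?B) \<theta> ?T = bands D1 \<theta> ?T \<union> bands D2 \<theta> ?T \<union> bands {a, b} \<theta> ?T"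
    by (simp only: bands_Un)
  moreover have "bands D1 \<theta> ?T = bands D1 \<theta> t1"
    by (rule bands_cong) (rule T1)
  moreover have "bands D2 \<theta> ?T = bands D2 \<theta> t2"
    by (rule bands_cong) (rule T2)
  ultimately have R: "corners (?A \<union> ?B) (?s \<circ> ?t) \<union> bands (?A \<union> ?B) \<theta> ?T = ?R1 \<union> ?R2 \<union> bands {a, b} \<theta> ?T"
    using corners_Un[OF s t' disj] by blast
  have "card ((?A \<times> UNIV \<union> ?B \<times> UNIV) // conn (?R1 \<union> ?R2 \<union> bands {a, b} \<theta> ?T)) + 1
     = card ((?A \<times> UNIV) // conn ?R1) + card ((?B \<times> UNIV) // conn ?R2)"
  proof (rule card_quotient_join)
    show "finite (?A \<times> (UNIV :: bool set))" "finite (?B \<times> (UNIV :: bool set))" using fin by auto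
    show "?A \<times> UNIV \<inter> ?B \<times> (UNIV :: bool set) = {}" using disj by auto
    show "?R1 \<subseteq> (?A \<times> UNIV) \<times> (?A \<times> UNIV)"
      using corners_subset[OF s] bands_subset[OF \<theta>(1), of t1] by blast
    show "?R2 \<subseteq> (?B \<times> UNIV) \<times> (?B \<times> UNIV)"
      using corners_subset[OF t'] bands_subset[OF \<theta>(2), of t2] by blast
    show "((a, True), (a, False)) \<in> conn ?R1"
      by (rule half_edge_sides_connected[OF fin(1) ab(1) s \<theta>(1)])
    show "((b, True), (b, False)) \<in> conn ?R2"
      by (rule half_edge_sides_connected[OF fin(2) ab(2) t' \<theta>(2)])
    show "bands {a, b} \<theta> ?T \<subseteq> {(a, True), (a, False)} \<times> {(b, True), (b, False)}
        \<union> {(b, True), (b, False)} \<times> {(a, True), (a, False)}"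
    proof (rule subsetI)
      have pair: "{(x, True), (x, False)} = {x} \<times> UNIV" for x :: 'a by (auto simp: UNIV_bool)
      fix p assume p: "p \<in> bands {a, b} \<theta> ?T"
      obtain d s w where ds: "p = ((d, s), w)" by (metis surj_pair)
      then have "d \<in> {a, b}" "fst w = \<theta> d" using p by (simp_all add: mem_bands_iff)
      then show "p \<in> {(a, True), (a, False)} \<times> {(b, True), (b, False)}
          \<union> {(b, True), (b, False)} \<times> {(a, True), (a, False)}"
        using \<theta>(3,4) unfolding pair ds by (cases w) auto
    qed
    show "bands {a, b} \<theta> ?T \<noteq> {}"
      using mem_bands_iff[of a True _ "{a, b}" \<theta> ?T] by blast
  qed auto
  moreover have "?A \<times> UNIV \<union> ?B \<times> (UNIV :: bool set) = (?A \<union> ?B) \<times> UNIV" by auto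
  ultimately have "card (((?A \<union> ?B) \<times> UNIV) // conn (?R1 \<union> ?R2 \<union> bands {a, b} \<theta> ?T)) + 1
     = face_count D1 \<theta> \<rho>1 t1 + face_count D2 \<theta> \<rho>2 t2"
    using face_count_half_edge[OF fin(1) ab(1) \<rho>(1) \<theta>(1) x] face_count_half_edge[OF fin(2) ab(2) \<rho>(2) \<theta>(2) y]
    by simp
  then show ?thesis unfolding face_count_def R by simp
qed

section \<open>Rotations\<close>

text \<open>Cyclicity is required at the vertices of darts only, so the notion makes sense for any
  subset of the darts and vertices without darts drop out by themselves.\<close>

definition rotations :: "'d set \<Rightarrow> ('d \<Rightarrow> 'v) \<Rightarrow> ('d \<Rightarrow> 'd) set" where
  "rotations D vx = {\<rho>. \<rho> permutes D \<and> (\<forall>d\<in>D. cyclic_on \<rho> {e \<in> D. vx e = vx d})}"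

lemma rotation_systems_eq_rotations:
  assumes "\<And>d. d \<in> darts G \<Longrightarrow> tail (dgraph G) d \<in> vertices G"
  shows "rotation_systems G = rotations (darts G) (tail (dgraph G))"
  unfolding rotation_systems_def rotations_def using assms by fastforce

lemma rotations_permutes: "\<rho> \<in> rotations D vx \<Longrightarrow> \<rho> permutes D"
  by (simp add: rotations_def)

lemma finite_rotations: "finite D \<Longrightarrow> finite (rotations D vx)"
  by (rule finite_subset[OF _ finite_permutations[of D]]) (auto simp: rotations_def)

section \<open>Inserting a dart into a cyclic order and removing it again\<close>

text \<open>In this form, changing a cycle at one place is checked by comparing closed subsets of
  the old and the new cycle, without following iterates.\<close>

lemma cyclic_on_iff_minimal:
  "cyclic_on f S \<longleftrightarrow> S \<noteq> {} \<and> f ` S \<subseteq> S \<and> (\<forall>X\<subseteq>S. X \<noteq> {} \<longrightarrow> f ` X \<subseteq> X \<longrightarrow> X = S)"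
proof
  assume c: "cyclic_on f S"
  have orb: "orbit f s \<subseteq> X" if "s \<in> X" "f ` X \<subseteq> X" for s X
  proof
    fix y assume "y \<in> orbit f s"
    then show "y \<in> X" by induction (use that in auto)
  qed
  show "S \<noteq> {} \<and> f ` S \<subseteq> S \<and> (\<forall>X\<subseteq>S. X \<noteq> {} \<longrightarrow> f ` X \<subseteq> X \<longrightarrow> X = S)"
  proof (intro conjI allI impI)
    show "S \<noteq> {}" "f ` S \<subseteq> S" using c by (auto simp: cyclic_on_alldef intro: cyclic_on_inI[OF c])
    fix X assume X: "X \<subseteq> S" "X \<noteq> {}" "f ` X \<subseteq> X"
    then obtain s where "s \<in> X" by auto
    then have "S = orbit f s" using c X by (auto simp: cyclic_on_alldef)
    then show "X = S" using orb[OF \<open>s \<in> X\<close> X(3)] X(1) by auto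
  qed
next
  assume *: "S \<noteq> {} \<and> f ` S \<subseteq> S \<and> (\<forall>X\<subseteq>S. X \<noteq> {} \<longrightarrow> f ` X \<subseteq> X \<longrightarrow> X = S)"
  have "orbit f s = S" if "s \<in> S" for s
  proof -
    have "orbit f s \<subseteq> S"
    proof
      fix y assume "y \<in> orbit f s"
      then show "y \<in> S" by induction (use that * in auto)
    qed
    moreover have "f ` orbit f s \<subseteq> orbit f s" by (auto intro: orbit.step)
    moreover have "orbit f s \<noteq> {}" using orbit.base[of f s] by auto
    ultimately show ?thesis using * by blast
  qed
  then show "cyclic_on f S" using * by (auto simp: cyclic_on_alldef)
qed

text \<open>The composed map runs \<open>x\<close>, \<open>a\<close>, \<open>\<rho> x\<close> and
  agrees with \<open>\<rho>\<close> elsewhere. A closed set of the new map meets \<open>A\<close> in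
  a nonempty set closed under \<open>\<rho>\<close>, hence contains \<open>A\<close>, hence
  \<open>x\<close> and its successor \<open>a\<close>.\<close>

lemma cyclic_on_insert:
  assumes c: "cyclic_on \<rho> A" and x: "x \<in> A" and a: "a \<notin> A" "\<rho> a = a"
  shows "cyclic_on (\<rho> \<circ> Transposition.transpose x a) (insert a A)"
proof -
  let ?f = "\<rho> \<circ> Transposition.transpose x a"
  have f: "?f x = a" "?f a = \<rho> x" "\<And>d. d \<noteq> x \<Longrightarrow> d \<noteq> a \<Longrightarrow> ?f d = \<rho> d"
    using a x by (auto simp: Transposition.transpose_def)
  have min: "A \<noteq> {}" "\<rho> ` A \<subseteq> A" "\<And>X. X \<subseteq> A \<Longrightarrow> X \<noteq> {} \<Longrightarrow> \<rho> ` X \<subseteq> X \<Longrightarrow> X = A"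
    using c unfolding cyclic_on_iff_minimal by auto
  show ?thesis
    unfolding cyclic_on_iff_minimal
  proof (intro conjI allI impI)
    show "?f ` insert a A \<subseteq> insert a A"
    proof (rule image_subsetI)
      fix d assume "d \<in> insert a A"
      then show "?f d \<in> insert a A"
        using f(1,2) f(3)[of d] min(2) x by (cases "d = x"; cases "d = a") (auto simp del: comp_apply)
    qed
    fix X assume X: "X \<subseteq> insert a A" "X \<noteq> {}" "?f ` X \<subseteq> X"
    have step: "?f d \<in> X" if "d \<in> X" for d using X(3) that by blast
    have "X \<inter> A = A"
    proof (rule min(3))
      show "X \<inter> A \<noteq> {}"
      proof (cases "a \<in> X")
        case True
        then have "\<rho> x \<in> X \<inter> A" using step[OF True] f(2) min(2) x by auto
        then show ?thesis by auto
      qed (use X in auto)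
      show "\<rho> ` (X \<inter> A) \<subseteq> X \<inter> A"
      proof (rule image_subsetI)
        fix d assume d: "d \<in> X \<inter> A"
        have "\<rho> d \<in> X"
        proof (cases "d = x")
          case True
          then have "a \<in> X" using step[of d] d f(1) by auto
          then show ?thesis using step[of a] f(2) True by auto
        next
          case False
          then show ?thesis using step[of d] f(3)[of d] d a by (metis Int_iff)
        qed
        then show "\<rho> d \<in> X \<inter> A" using d min(2) by auto
      qed
    qed simp
    then have "x \<in> X" using x by auto
    then have "a \<in> X" using step[of x] f(1) by simp
    then show "X = insert a A" using X(1) \<open>X \<inter> A = A\<close> by auto
  qed simp
qed

text \<open>Composing with the transposition short-circuits the path \<open>x\<close>,
  \<open>a\<close>, \<open>f a\<close> into a direct step from \<open>x\<close> to
  \<open>f a\<close>.\<close>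

lemma cyclic_on_remove:
  assumes c: "cyclic_on f (insert a A)" and inj: "inj f" and A: "A \<noteq> {}" "a \<notin> A" and x: "f x = a"
  shows "x \<in> A" "cyclic_on (f \<circ> Transposition.transpose x a) A"
proof -
  let ?g = "f \<circ> Transposition.transpose x a"
  have min: "f ` insert a A \<subseteq> insert a A"
    "\<And>X. X \<subseteq> insert a A \<Longrightarrow> X \<noteq> {} \<Longrightarrow> f ` X \<subseteq> X \<Longrightarrow> X = insert a A"
    using c unfolding cyclic_on_iff_minimal by auto
  have fa: "f a \<noteq> a" using min(2)[of "{a}"] A by auto
  have "a \<in> f ` insert a A"
    using min(2)[of "f ` insert a A"] min(1) by blast
  then show xA: "x \<in> A" using x fa inj by (auto dest: injD)
  have g: "?g x = f a" "\<And>d. d \<noteq> x \<Longrightarrow> d \<noteq> a \<Longrightarrow> ?g d = f d"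
    by (auto simp: Transposition.transpose_def)
  show "cyclic_on ?g A"
    unfolding cyclic_on_iff_minimal
  proof (intro conjI allI impI)
    show "?g ` A \<subseteq> A"
    proof (rule image_subsetI)
      fix d assume d: "d \<in> A"
      show "?g d \<in> A"
      proof (cases "d = x")
        case True
        then show ?thesis using g(1) min(1) fa by auto
      next
        case False
        then have "f d \<noteq> a" using x inj by (auto dest: injD)
        then show ?thesis using False g(2)[of d] d A(2) min(1) by (metis image_subset_iff insertE insertI2)
      qed
    qed
    fix X assume X: "X \<subseteq> A" "X \<noteq> {}" "?g ` X \<subseteq> X"
    have step: "?g d \<in> X" if "d \<in> X" for d using X(3) that by blast
    \<comment> \<open>A set closed under the shortened cycle becomes closed under \<open>f\<close>
      once \<open>a\<close> is added exactly when its predecessor \<open>x\<close> is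
      present.\<close>
    define Y where "Y = X \<union> (if x \<in> X then {a} else {})"
    have "Y = insert a A"
    proof (rule min(2))
      show "Y \<subseteq> insert a A" "Y \<noteq> {}" using X by (auto simp: Y_def)
      show "f ` Y \<subseteq> Y"
      proof (rule image_subsetI)
        fix d assume d: "d \<in> Y"
        consider "d = x" "x \<in> X" | "d = a" "x \<in> X" | "d \<in> X" "d \<noteq> x" "d \<noteq> a"
          using d X(1) A(2) by (auto simp: Y_def split: if_splits)
        then show "f d \<in> Y"
        proof cases
          case 1
          then show ?thesis using x by (simp add: Y_def)
        next
          case 2
          then show ?thesis using step[of x] g(1) by (simp add: Y_def)
        next
          case 3
          then show ?thesis using step[of d] g(2)[of d] by (simp add: Y_def)
        qed
      qed
    qed
    then show "X = A" using X(1) A(2) by (auto simp: Y_def split: if_splits)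
  qed (rule A(1))
qed

text \<open>At a vertex without darts, \<open>a\<close> is inserted after itself: the transposition below is then the identity.\<close>

definition insert_positions :: "'d set \<Rightarrow> ('d \<Rightarrow> 'v) \<Rightarrow> 'd \<Rightarrow> 'd set" where
  "insert_positions D vx a = (if {d \<in> D. vx d = vx a} = {} then {a} else {d \<in> D. vx d = vx a})"

text \<open>The inverse reads off the predecessor \<open>inv f a\<close> and short-circuits
  \<open>a\<close>. Decisive is that the second factor does not depend on \<open>\<rho>\<close>:
  each rotation of \<open>D\<close> has equally many extensions, so uniform laws correspond.\<close>

lemma bij_betw_rotations_insert:
  assumes a: "a \<notin> D"
  shows "bij_betw (\<lambda>(\<rho>, x). \<rho> \<circ> Transposition.transpose x a)
           (rotations D vx \<times> insert_positions D vx a) (rotations (insert a D) vx)"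
proof (rule bij_betw_byWitness[where f'="\<lambda>f. (f \<circ> Transposition.transpose (inv f a) a, inv f a)"])
  let ?A = "{d \<in> D. vx d = vx a}"
  have cls: "{e \<in> insert a D. vx e = vx d} = (if vx d = vx a then insert a ?A else {e \<in> D. vx e = vx d})" for d
    by auto
  show "\<forall>p\<in>rotations D vx \<times> insert_positions D vx a.
      (\<lambda>f. (f \<circ> Transposition.transpose (inv f a) a, inv f a)) ((\<lambda>(\<rho>, x). \<rho> \<circ> Transposition.transpose x a) p) = p"
  proof (rule ballI)
    fix q assume "q \<in> rotations D vx \<times> insert_positions D vx a"
    then obtain \<rho> x where q: "q = (\<rho>, x)" and \<rho>: "\<rho> \<in> rotations D vx" and x: "x \<in> insert_positions D vx a"
      by auto
    have p: "\<rho> permutes D" using \<rho> by (rule rotations_permutes)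
    have "inv (\<rho> \<circ> Transposition.transpose x a) a = x"
    proof (rule inv_f_eq)
      show "inj (\<rho> \<circ> Transposition.transpose x a)"
        by (rule inj_compose[OF permutes_inj[OF p] inj_transpose])
      show "(\<rho> \<circ> Transposition.transpose x a) x = a" using p a by (simp add: permutes_not_in)
    qed
    then show "(\<lambda>f. (f \<circ> Transposition.transpose (inv f a) a, inv f a)) ((\<lambda>(\<rho>, x). \<rho> \<circ> Transposition.transpose x a) q) = q"
      by (simp add: q comp_assoc)
  qed
  show "\<forall>f\<in>rotations (insert a D) vx.
      (\<lambda>(\<rho>, x). \<rho> \<circ> Transposition.transpose x a) (f \<circ> Transposition.transpose (inv f a) a, inv f a) = f"
    by (simp add: comp_assoc)
  show "(\<lambda>(\<rho>, x). \<rho> \<circ> Transposition.transpose x a) ` (rotations D vx \<times> insert_positions D vx a)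
      \<subseteq> rotations (insert a D) vx"
  proof (rule image_subsetI)
    fix q assume "q \<in> rotations D vx \<times> insert_positions D vx a"
    then obtain \<rho> x where q: "q = (\<rho>, x)" and \<rho>: "\<rho> \<in> rotations D vx" and x: "x \<in> insert_positions D vx a"
      by auto
    have p: "\<rho> permutes D" using \<rho> by (rule rotations_permutes)
    let ?f = "\<rho> \<circ> Transposition.transpose x a"
    have xin: "x \<in> insert a D" using x by (auto simp: insert_positions_def split: if_splits)
    have "?f permutes insert a D"
      using xin by (intro permutes_compose permutes_swap_id permutes_subset[OF p]) auto
    moreover have "cyclic_on ?f {e \<in> insert a D. vx e = vx d}" if d: "d \<in> insert a D" for d
    proof (cases "vx d = vx a")
      case True
      have "cyclic_on ?f (insert a ?A)"
      proof (cases "?A = {}")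
        case True
        then have "?f = \<rho>" "\<rho> a = a"
          using x p a unfolding insert_positions_def if_P[OF True] by (simp_all add: permutes_not_in)
        then show ?thesis unfolding True by (auto simp: cyclic_on_iff_minimal)
      next
        case False
        then obtain e where e: "e \<in> ?A" by auto
        then have "{d \<in> D. vx d = vx e} = ?A" by auto
        then have "cyclic_on \<rho> ?A" using \<rho> e by (auto simp: rotations_def)
        moreover have "x \<in> ?A" using x unfolding insert_positions_def if_not_P[OF False] .
        ultimately show ?thesis using a p by (intro cyclic_on_insert) (auto simp: permutes_not_in)
      qed
      then show ?thesis by (simp only: cls True refl if_True)
    next
      case False
      then have "cyclic_on \<rho> {e \<in> D. vx e = vx d}" using \<rho> d by (auto simp: rotations_def)
      moreover have "?f e = \<rho> e" if "e \<in> {e \<in> D. vx e = vx d}" for e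
      proof -
        have "e \<noteq> a" using that a by auto
        moreover have "e \<noteq> x" using x that False a by (auto simp: insert_positions_def split: if_splits)
        ultimately show ?thesis by simp
      qed
      ultimately have "cyclic_on ?f {e \<in> D. vx e = vx d}" using cyclic_cong by blast
      then show ?thesis by (simp only: cls False if_False)
    qed
    ultimately show "(\<lambda>(\<rho>, x). \<rho> \<circ> Transposition.transpose x a) q \<in> rotations (insert a D) vx"
      by (simp add: rotations_def q)
  qed
  show "(\<lambda>f. (f \<circ> Transposition.transpose (inv f a) a, inv f a)) ` rotations (insert a D) vx
      \<subseteq> rotations D vx \<times> insert_positions D vx a"
  proof (rule image_subsetI)
    fix f assume f: "f \<in> rotations (insert a D) vx"
    have p: "f permutes insert a D" using f by (rule rotations_permutes)
    define x where "x = inv f a"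
    have fx: "f x = a" using permutes_inverses(1)[OF p] by (simp add: x_def)
    have xin: "x \<in> insert a D"
      using fx permutes_in_image[OF p, of x] by simp
    let ?\<rho> = "f \<circ> Transposition.transpose x a"
    have "?\<rho> permutes insert a D"
      using xin by (intro permutes_compose permutes_swap_id p) auto
    then have \<rho>: "?\<rho> permutes D"
      by (rule permutes_superset) (use fx in auto)
    have ca: "cyclic_on f (insert a ?A)"
      using f cls[of a] by (auto simp: rotations_def)
    have x: "x \<in> insert_positions D vx a"
    proof (cases "?A = {}")
      case True
      then have "f a = a" using ca by (auto simp: cyclic_on_iff_minimal)
      then have "x = a" using fx injD[OF permutes_inj[OF p], of x a] by simp
      then show ?thesis unfolding insert_positions_def if_P[OF True] by simp
    next
      case False
      then have "x \<in> ?A"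
        using cyclic_on_remove(1)[OF ca permutes_inj[OF p] False _ fx] a by auto
      then show ?thesis unfolding insert_positions_def if_not_P[OF False] .
    qed
    have "cyclic_on ?\<rho> {e \<in> D. vx e = vx d}" if d: "d \<in> D" for d
    proof (cases "vx d = vx a")
      case True
      then have "?A \<noteq> {}" using d by auto
      then have "cyclic_on ?\<rho> ?A"
        using cyclic_on_remove(2)[OF ca permutes_inj[OF p] _ _ fx] a by auto
      then show ?thesis using True by simp
    next
      case False
      then have "cyclic_on f {e \<in> D. vx e = vx d}" using f d cls[of d] by (auto simp: rotations_def)
      moreover have "?\<rho> e = f e" if "e \<in> {e \<in> D. vx e = vx d}" for e
      proof -
        have "e \<noteq> a" using that a by auto
        moreover have "e \<noteq> x" using x that False a by (auto simp: insert_positions_def split: if_splits)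
        ultimately show ?thesis by simp
      qed
      ultimately show ?thesis using cyclic_cong by blast
    qed
    then have "?\<rho> \<in> rotations D vx" using \<rho> by (simp add: rotations_def)
    then show "(\<lambda>f. (f \<circ> Transposition.transpose (inv f a) a, inv f a)) f \<in> rotations D vx \<times> insert_positions D vx a"
      using x by (simp add: x_def)
  qed
qed

text \<open>Darts are inserted one after the other, and an insertion position always exists. This
  makes \<open>pmf_of_set\<close> meaningful on embeddings.\<close>

lemma rotations_nonempty: "finite D \<Longrightarrow> rotations D vx \<noteq> {}"
proof (induction D rule: finite_induct)
  case empty
  have "id \<in> rotations {} vx" by (simp add: rotations_def permutes_id)
  then show ?case by blast
next
  case (insert a D)
  have "insert_positions D vx a \<noteq> {}" by (auto simp: insert_positions_def)
  then have "rotations D vx \<times> insert_positions D vx a \<noteq> {}" using insert.IH by blast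
  then show ?case
    using bij_betw_imp_surj_on[OF bij_betw_rotations_insert[OF insert.hyps(2), of vx]] by blast
qed

text \<open>No vertex has darts in both \<open>A\<close> and \<open>B\<close>, so every cycle of a
  rotation stays in one of them and restriction inverts composition.\<close>

lemma bij_betw_rotations_Un:
  assumes fin: "finite A" "finite B" and disj: "A \<inter> B = {}" and vx: "vx ` A \<inter> vx ` B = {}"
  shows "bij_betw (\<lambda>(\<sigma>, \<tau>). \<sigma> \<circ> \<tau>) (rotations A vx \<times> rotations B vx) (rotations (A \<union> B) vx)"
proof (rule bij_betw_byWitness[where f'="\<lambda>f. (perm_restrict f A, perm_restrict f B)"])
  have classA: "{e \<in> A \<union> B. vx e = vx d} = {e \<in> A. vx e = vx d}" if "d \<in> A" for d
    using vx that by (auto simp: disjoint_iff)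
  have classB: "{e \<in> A \<union> B. vx e = vx d} = {e \<in> B. vx e = vx d}" if "d \<in> B" for d
    using vx that by (auto simp: disjoint_iff)
  have comp: "(\<sigma> \<circ> \<tau>) d = (if d \<in> A then \<sigma> d else if d \<in> B then \<tau> d else d)"
    if "\<sigma> permutes A" "\<tau> permutes B" for \<sigma> \<tau> d
    using that disj permutes_not_in[of \<tau> B d] permutes_not_in[of \<sigma> A "\<tau> d"] permutes_in_image[of \<tau> B d]
    by (auto simp: disjoint_iff)
  have restrictA: "perm_restrict f A \<in> rotations A vx" if f: "f \<in> rotations (A \<union> B) vx"
    and finA: "finite A" and cls: "\<And>d. d \<in> A \<Longrightarrow> {e \<in> A \<union> B. vx e = vx d} = {e \<in> A. vx e = vx d}" for f A B
  proof -
    have p: "f permutes A \<union> B" using f by (rule rotations_permutes)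
    have cyc: "cyclic_on f {e \<in> A. vx e = vx d}" if "d \<in> A" for d
      using f cls[OF that] that unfolding rotations_def by (metis (no_types, lifting) UnI1 mem_Collect_eq)
    have "f d \<in> A" if "d \<in> A" for d
      using cyclic_on_inI[OF cyc[OF that], of d] that by auto
    \<comment> \<open>Being a union of cycles, \<open>A\<close> is mapped into itself; injectivity
      and finiteness give surjectivity.\<close>
    then have "f ` A = A"
      using finA inj_on_subset[OF permutes_inj[OF p]] by (intro endo_inj_surj) auto
    then have "bij_betw (perm_restrict f A) A A"
      using inj_on_subset[OF permutes_inj[OF p], of A]
      by (auto simp: bij_betw_def perm_restrict_def inj_on_def cong: image_cong_simp)
    then have "perm_restrict f A permutes A"
      by (rule bij_imp_permutes) (simp add: perm_restrict_def)
    moreover have "cyclic_on (perm_restrict f A) {e \<in> A. vx e = vx d}" if "d \<in> A" for d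
      using cyc[OF that] cyclic_cong[of "{e \<in> A. vx e = vx d}" f "perm_restrict f A"]
      by (auto simp: perm_restrict_def)
    ultimately show ?thesis by (simp add: rotations_def)
  qed
  show "\<forall>p\<in>rotations A vx \<times> rotations B vx.
      (\<lambda>f. (perm_restrict f A, perm_restrict f B)) ((\<lambda>(\<sigma>, \<tau>). \<sigma> \<circ> \<tau>) p) = p"
  proof (rule ballI)
    fix q assume "q \<in> rotations A vx \<times> rotations B vx"
    then obtain \<sigma> \<tau> where q: "q = (\<sigma>, \<tau>)" and "\<sigma> \<in> rotations A vx" "\<tau> \<in> rotations B vx" by auto
    then have p: "\<sigma> permutes A" "\<tau> permutes B" by (auto intro: rotations_permutes)
    have "perm_restrict (\<sigma> \<circ> \<tau>) A = \<sigma>"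
      using p(1) by (auto simp: perm_restrict_def comp[OF p] fun_eq_iff permutes_not_in simp del: comp_apply)
    moreover have "perm_restrict (\<sigma> \<circ> \<tau>) B = \<tau>"
      using p(2) disj by (auto simp: perm_restrict_def comp[OF p] fun_eq_iff permutes_not_in simp del: comp_apply)
    ultimately show "(\<lambda>f. (perm_restrict f A, perm_restrict f B)) ((\<lambda>(\<sigma>, \<tau>). \<sigma> \<circ> \<tau>) q) = q"
      by (simp add: q)
  qed
  have rA: "perm_restrict f A \<in> rotations A vx" and rB: "perm_restrict f B \<in> rotations B vx"
    if "f \<in> rotations (A \<union> B) vx" for f
    using restrictA[of f A B, OF that fin(1) classA] restrictA[of f B A, OF _ fin(2)] that classB
    by (auto simp: Un_commute)
  show "(\<lambda>f. (perm_restrict f A, perm_restrict f B)) ` rotations (A \<union> B) vx \<subseteq> rotations A vx \<times> rotations B vx"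
    using rA rB by auto
  show "\<forall>f\<in>rotations (A \<union> B) vx. (\<lambda>(\<sigma>, \<tau>). \<sigma> \<circ> \<tau>) (perm_restrict f A, perm_restrict f B) = f"
  proof
    fix f assume f: "f \<in> rotations (A \<union> B) vx"
    have p: "f permutes A \<union> B" using f by (rule rotations_permutes)
    show "(\<lambda>(\<sigma>, \<tau>). \<sigma> \<circ> \<tau>) (perm_restrict f A, perm_restrict f B) = f"
      using permutes_not_in[OF p] comp[OF rotations_permutes[OF rA[OF f]] rotations_permutes[OF rB[OF f]]]
      by (auto simp: fun_eq_iff perm_restrict_def)
  qed
  show "(\<lambda>(\<sigma>, \<tau>). \<sigma> \<circ> \<tau>) ` (rotations A vx \<times> rotations B vx) \<subseteq> rotations (A \<union> B) vx"
  proof (rule image_subsetI)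
    fix q assume "q \<in> rotations A vx \<times> rotations B vx"
    then obtain \<sigma> \<tau> where q: "q = (\<sigma>, \<tau>)" and st: "\<sigma> \<in> rotations A vx" "\<tau> \<in> rotations B vx"
      by auto
    then have p: "\<sigma> permutes A" "\<tau> permutes B" by (auto intro: rotations_permutes)
    have "\<sigma> \<circ> \<tau> permutes A \<union> B"
      using p by (intro permutes_compose) (auto intro: permutes_subset)
    moreover have "cyclic_on (\<sigma> \<circ> \<tau>) {e \<in> A. vx e = vx d}" if "d \<in> A" for d
      using st(1) that cyclic_cong[of "{e \<in> A. vx e = vx d}" \<sigma> "\<sigma> \<circ> \<tau>"] comp[OF p]
      by (auto simp: rotations_def simp del: comp_apply)
    moreover have "cyclic_on (\<sigma> \<circ> \<tau>) {e \<in> B. vx e = vx d}" if "d \<in> B" for d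
    proof -
      have "(\<sigma> \<circ> \<tau>) e = \<tau> e" if "e \<in> B" for e
        using comp[OF p, of e] that disj by auto
      then have "cyclic_on \<tau> {e \<in> B. vx e = vx d} = cyclic_on (\<sigma> \<circ> \<tau>) {e \<in> B. vx e = vx d}"
        by (intro cyclic_cong) auto
      then show ?thesis using st(2) that by (simp add: rotations_def)
    qed
    ultimately show "(\<lambda>(\<sigma>, \<tau>). \<sigma> \<circ> \<tau>) q \<in> rotations (A \<union> B) vx"
      using classA classB unfolding q rotations_def prod.case by auto
  qed
qed

section \<open>The distribution of the number of faces\<close>

definition twists :: "bool \<Rightarrow> 'd set \<Rightarrow> ('d \<Rightarrow> 'd) \<Rightarrow> 'd set set set" where
  "twists \<epsilon> D \<theta> = (if \<epsilon> then Pow (dart_edges D \<theta>) else {{}})"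

text \<open>The flag \<open>\<epsilon>\<close> selects general embeddings (all twists allowed) or orientable ones (no twists).\<close>

definition face_law :: "bool \<Rightarrow> 'd set \<Rightarrow> ('d \<Rightarrow> 'v) \<Rightarrow> ('d \<Rightarrow> 'd) \<Rightarrow> real pmf" where
  "face_law \<epsilon> D vx \<theta> = map_pmf (\<lambda>(\<rho>, t). real (face_count D \<theta> \<rho> t)) (pmf_of_set (rotations D vx \<times> twists \<epsilon> D \<theta>))"

lemma twists_subset: "t \<in> twists \<epsilon> D \<theta> \<Longrightarrow> t \<subseteq> dart_edges D \<theta>"
  by (auto simp: twists_def split: if_splits)

lemma finite_twists: "finite D \<Longrightarrow> finite (twists \<epsilon> D \<theta>)"
  by (simp add: twists_def dart_edges_def)

lemma twists_nonempty: "twists \<epsilon> D \<theta> \<noteq> {}"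
  by (auto simp: twists_def)

lemma pmf_of_set_Times:
  assumes "finite A" "A \<noteq> {}" "finite B" "B \<noteq> {}"
  shows "pmf_of_set (A \<times> B) = pair_pmf (pmf_of_set A) (pmf_of_set B)"
proof (rule pmf_eqI)
  fix z :: "'a \<times> 'b"
  show "pmf (pmf_of_set (A \<times> B)) z = pmf (pair_pmf (pmf_of_set A) (pmf_of_set B)) z"
    using assms by (cases z) (simp add: pmf_pair card_cartesian_product indicator_def)
qed

text \<open>Edges are nonempty subsets of their own dart set, so the three edge sets are disjoint
  and a set of twists splits uniquely. Without twists all three factors are trivial.\<close>

lemma bij_betw_twists_Un:
  assumes disj: "A \<inter> B = {}" "A \<inter> C = {}" "B \<inter> C = {}"
    and inv: "fpf_involution_on A \<theta>" "fpf_involution_on B \<theta>" "fpf_involution_on C \<theta>"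
  shows "bij_betw (\<lambda>(t1, t2, t3). t1 \<union> t2 \<union> t3)
    (twists \<epsilon> A \<theta> \<times> twists \<epsilon> B \<theta> \<times> twists \<epsilon> C \<theta>) (twists \<epsilon> (A \<union> B \<union> C) \<theta>)"
proof (cases \<epsilon>)
  case True
  let ?E = "\<lambda>D. dart_edges D \<theta>"
  have E: "X \<subseteq> D \<and> X \<noteq> {}" if "X \<in> ?E D" "fpf_involution_on D \<theta>" for X D
    using that by (auto simp: dart_edges_def fpf_involution_on_def)
  have d: "?E A \<inter> ?E B = {}" "?E A \<inter> ?E C = {}" "?E B \<inter> ?E C = {}"
    using E[OF _ inv(1)] E[OF _ inv(2)] E[OF _ inv(3)] disj by blast+
  have U: "?E (A \<union> B \<union> C) = ?E A \<union> ?E B \<union> ?E C"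
    by (simp add: dart_edges_def image_Un)
  show ?thesis
    unfolding twists_def if_P[OF True] U
    by (rule bij_betw_byWitness[where f'="\<lambda>t. (t \<inter> ?E A, t \<inter> ?E B, t \<inter> ?E C)"]) (use d in auto)
next
  case False
  then show ?thesis by (simp add: twists_def)
qed

text \<open>An embedding of the joined graph amounts to a pair of embeddings together with a corner
  at each end and a twist of the bar, and the face count ignores the additional data. The conditions
  \<open>isolated\<close> exclude a half-edge attached to a vertex without darts beside a nonempty
  dart set: such a half-edge would form a component of its own.\<close>

lemma face_law_join:
  fixes D1 D2 :: "'d set"
  assumes fin: "finite D1" "finite D2" and disj: "insert a D1 \<inter> insert b D2 = {}"
    and ab: "a \<notin> D1" "b \<notin> D2"
    and \<theta>: "fpf_involution_on D1 \<theta>" "fpf_involution_on D2 \<theta>" "\<theta> a = b" "\<theta> b = a"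
    and vx: "vx ` insert a D1 \<inter> vx ` insert b D2 = {}"
    and isolated: "D1 \<noteq> {} \<Longrightarrow> \<exists>d\<in>D1. vx d = vx a" "D2 \<noteq> {} \<Longrightarrow> \<exists>d\<in>D2. vx d = vx b"
  shows "face_law \<epsilon> (insert a D1 \<union> insert b D2) vx \<theta> =
    map_pmf (\<lambda>(m, n). m + n - 1) (pair_pmf (face_law \<epsilon> D1 vx \<theta>) (face_law \<epsilon> D2 vx \<theta>))"
proof -
  let ?D = "insert a D1 \<union> insert b D2"
  let ?P1 = "insert_positions D1 vx a" and ?P2 = "insert_positions D2 vx b"
  let ?R1 = "rotations D1 vx" and ?R2 = "rotations D2 vx"
  let ?T1 = "twists \<epsilon> D1 \<theta>" and ?T2 = "twists \<epsilon> D2 \<theta>" and ?T3 = "twists \<epsilon> {a, b} \<theta>"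
  let ?f1 = "\<lambda>(\<rho>, x). \<rho> \<circ> Transposition.transpose x a" and ?f2 = "\<lambda>(\<rho>, x). \<rho> \<circ> Transposition.transpose x b"
  \<comment> \<open>The data are grouped so that \<open>fst\<close> forgets the corners and the
    twist of the bar, leaving the pair of embeddings.\<close>
  define \<beta> :: "((('d \<Rightarrow> 'd) \<times> 'd set set) \<times> (('d \<Rightarrow> 'd) \<times> 'd set set)) \<times> ('d \<times> 'd \<times> 'd set set) \<Rightarrow> _"
    where "\<beta> = (\<lambda>(((\<rho>1, t1), (\<rho>2, t2)), (x, y, t3)).
     ((\<rho>1 \<circ> Transposition.transpose x a) \<circ> (\<rho>2 \<circ> Transposition.transpose y b), t1 \<union> t2 \<union> t3))"
  let ?Q = "((?R1 \<times> ?T1) \<times> (?R2 \<times> ?T2)) \<times> (?P1 \<times> ?P2 \<times> ?T3)"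
  have b1: "bij_betw ?f1 (?R1 \<times> ?P1) (rotations (insert a D1) vx)"
    by (rule bij_betw_rotations_insert[OF ab(1)])
  have b2: "bij_betw ?f2 (?R2 \<times> ?P2) (rotations (insert b D2) vx)"
    by (rule bij_betw_rotations_insert[OF ab(2)])
  have b3: "bij_betw (\<lambda>(\<sigma>, \<tau>). \<sigma> \<circ> \<tau>)
      (rotations (insert a D1) vx \<times> rotations (insert b D2) vx) (rotations ?D vx)"
    using fin by (intro bij_betw_rotations_Un disj vx) auto
  have "a \<noteq> b" using disj by auto
  then have inv3: "fpf_involution_on {a, b} \<theta>" using \<theta>(3,4) by (auto simp: fpf_involution_on_def)
  have D: "?D = D1 \<union> D2 \<union> {a, b}" by auto
  have b4: "bij_betw (\<lambda>(t1, t2, t3). t1 \<union> t2 \<union> t3) (?T1 \<times> ?T2 \<times> ?T3) (twists \<epsilon> ?D \<theta>)"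
    unfolding D by (rule bij_betw_twists_Un) (use disj ab \<theta> inv3 in auto)
  have bij: "bij_betw \<beta> ?Q (rotations ?D vx \<times> twists \<epsilon> ?D \<theta>)"
  proof (rule bij_betw_imageI)
    show "inj_on \<beta> ?Q"
    proof (rule inj_onI)
      fix p q assume p: "p \<in> ?Q" and q: "q \<in> ?Q" and eq: "\<beta> p = \<beta> q"
      obtain \<rho>1 t1 \<rho>2 t2 x y t3 where p': "p = (((\<rho>1, t1), (\<rho>2, t2)), (x, y, t3))" by (metis surj_pair)
      obtain \<rho>1' t1' \<rho>2' t2' x' y' t3' where q': "q = (((\<rho>1', t1'), (\<rho>2', t2')), (x', y', t3'))" by (metis surj_pair)
      have pin: "(\<rho>1, x) \<in> ?R1 \<times> ?P1" "(\<rho>2, y) \<in> ?R2 \<times> ?P2" "(t1, t2, t3) \<in> ?T1 \<times> ?T2 \<times> ?T3"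
        and qin: "(\<rho>1', x') \<in> ?R1 \<times> ?P1" "(\<rho>2', y') \<in> ?R2 \<times> ?P2" "(t1', t2', t3') \<in> ?T1 \<times> ?T2 \<times> ?T3"
        using p q by (auto simp: p' q')
      have "(\<lambda>(\<sigma>, \<tau>). \<sigma> \<circ> \<tau>) (?f1 (\<rho>1, x), ?f2 (\<rho>2, y)) = (\<lambda>(\<sigma>, \<tau>). \<sigma> \<circ> \<tau>) (?f1 (\<rho>1', x'), ?f2 (\<rho>2', y'))"
        and t: "(\<lambda>(t1, t2, t3). t1 \<union> t2 \<union> t3) (t1, t2, t3) = (\<lambda>(t1, t2, t3). t1 \<union> t2 \<union> t3) (t1', t2', t3')"
        using eq unfolding \<beta>_def p' q' by simp_all
      then have "(?f1 (\<rho>1, x), ?f2 (\<rho>2, y)) = (?f1 (\<rho>1', x'), ?f2 (\<rho>2', y'))"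
        by (intro inj_onD[OF bij_betw_imp_inj_on[OF b3]])
           (use bij_betw_apply[OF b1] bij_betw_apply[OF b2] pin qin in blast)+
      then have "(\<rho>1, x) = (\<rho>1', x')" "(\<rho>2, y) = (\<rho>2', y')"
        using inj_onD[OF bij_betw_imp_inj_on[OF b1] _ pin(1) qin(1)]
          inj_onD[OF bij_betw_imp_inj_on[OF b2] _ pin(2) qin(2)] by blast+
      moreover have "(t1, t2, t3) = (t1', t2', t3')"
        by (rule inj_onD[OF bij_betw_imp_inj_on[OF b4] t pin(3) qin(3)])
      ultimately show "p = q" by (simp add: p' q')
    qed
    show "\<beta> ` ?Q = rotations ?D vx \<times> twists \<epsilon> ?D \<theta>"
    proof
      show "\<beta> ` ?Q \<subseteq> rotations ?D vx \<times> twists \<epsilon> ?D \<theta>"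
      proof (rule image_subsetI)
        fix p assume p: "p \<in> ?Q"
        obtain \<rho>1 t1 \<rho>2 t2 x y t3 where p': "p = (((\<rho>1, t1), (\<rho>2, t2)), (x, y, t3))" by (metis surj_pair)
        have pin: "(\<rho>1, x) \<in> ?R1 \<times> ?P1" "(\<rho>2, y) \<in> ?R2 \<times> ?P2" "(t1, t2, t3) \<in> ?T1 \<times> ?T2 \<times> ?T3"
          using p by (auto simp: p')
        have "(\<lambda>(\<sigma>, \<tau>). \<sigma> \<circ> \<tau>) (?f1 (\<rho>1, x), ?f2 (\<rho>2, y)) \<in> rotations ?D vx"
          by (intro bij_betw_apply[OF b3] SigmaI bij_betw_apply[OF b1] bij_betw_apply[OF b2]) (use pin in auto)
        moreover have "(\<lambda>(t1, t2, t3). t1 \<union> t2 \<union> t3) (t1, t2, t3) \<in> twists \<epsilon> ?D \<theta>"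
          by (rule bij_betw_apply[OF b4 pin(3)])
        ultimately show "\<beta> p \<in> rotations ?D vx \<times> twists \<epsilon> ?D \<theta>" by (simp add: \<beta>_def p')
      qed
      show "rotations ?D vx \<times> twists \<epsilon> ?D \<theta> \<subseteq> \<beta> ` ?Q"
      proof (rule subsetI)
        fix z assume "z \<in> rotations ?D vx \<times> twists \<epsilon> ?D \<theta>"
        then obtain \<rho> t where z: "z = (\<rho>, t)" "\<rho> \<in> rotations ?D vx" "t \<in> twists \<epsilon> ?D \<theta>" by auto
        obtain \<sigma> \<tau> where st: "\<sigma> \<in> rotations (insert a D1) vx" "\<tau> \<in> rotations (insert b D2) vx" "\<rho> = \<sigma> \<circ> \<tau>"
          using z(2) unfolding bij_betw_imp_surj_on[OF b3, symmetric] by auto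
        obtain \<rho>1 x where 1: "\<rho>1 \<in> ?R1" "x \<in> ?P1" "\<sigma> = \<rho>1 \<circ> Transposition.transpose x a"
          using st(1) unfolding bij_betw_imp_surj_on[OF b1, symmetric] by auto
        obtain \<rho>2 y where 2: "\<rho>2 \<in> ?R2" "y \<in> ?P2" "\<tau> = \<rho>2 \<circ> Transposition.transpose y b"
          using st(2) unfolding bij_betw_imp_surj_on[OF b2, symmetric] by auto
        obtain t1 t2 t3 where 3: "t1 \<in> ?T1" "t2 \<in> ?T2" "t3 \<in> ?T3" "t = t1 \<union> t2 \<union> t3"
          using z(3) unfolding bij_betw_imp_surj_on[OF b4, symmetric] by auto
        have "z = \<beta> (((\<rho>1, t1), (\<rho>2, t2)), (x, y, t3))"
          by (simp add: \<beta>_def z st 1 2 3)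
        then show "z \<in> \<beta> ` ?Q" using 1 2 3 by (intro image_eqI) auto
      qed
    qed
  qed
  have finP: "finite ?P1" "finite ?P2" "?P1 \<noteq> {}" "?P2 \<noteq> {}"
    using fin by (auto simp: insert_positions_def)
  have fin1: "finite (?R1 \<times> ?T1)" "?R1 \<times> ?T1 \<noteq> {}"
    by (simp_all add: rotations_nonempty finite_rotations finite_twists twists_nonempty fin)
  have fin2: "finite (?R2 \<times> ?T2)" "?R2 \<times> ?T2 \<noteq> {}"
    by (simp_all add: rotations_nonempty finite_rotations finite_twists twists_nonempty fin)
  have fin3: "finite (?P1 \<times> ?P2 \<times> ?T3)" "?P1 \<times> ?P2 \<times> ?T3 \<noteq> {}"
    using finP by (simp_all add: finite_twists twists_nonempty)
  let ?F = "\<lambda>(\<rho>, t). real (face_count ?D \<theta> \<rho> t)"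
  let ?F1 = "\<lambda>(\<rho>, t). real (face_count D1 \<theta> \<rho> t)" and ?F2 = "\<lambda>(\<rho>, t). real (face_count D2 \<theta> \<rho> t)"
  have count: "?F (\<beta> p) = ?F1 (fst (fst p)) + ?F2 (snd (fst p)) - 1" if p: "p \<in> ?Q" for p
  proof -
    obtain \<rho>1 t1 \<rho>2 t2 x y t3 where p': "p = (((\<rho>1, t1), (\<rho>2, t2)), (x, y, t3))" by (metis surj_pair)
    have "face_count ?D \<theta> ((\<rho>1 \<circ> Transposition.transpose x a) \<circ> (\<rho>2 \<circ> Transposition.transpose y b))
        (t1 \<union> t2 \<union> t3) + 1 = face_count D1 \<theta> \<rho>1 t1 + face_count D2 \<theta> \<rho>2 t2"
    proof (rule face_count_join[OF fin disj ab])
      show "\<rho>1 permutes D1" "\<rho>2 permutes D2" using p by (auto simp: p' rotations_permutes)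
      show "if D1 = {} then x = a else x \<in> D1" "if D2 = {} then y = b else y \<in> D2"
        using p isolated by (auto simp: p' insert_positions_def split: if_splits)
      show "t1 \<subseteq> dart_edges D1 \<theta>" "t2 \<subseteq> dart_edges D2 \<theta>"
        using p by (auto simp: p' dest!: twists_subset)
      have "t3 \<in> twists \<epsilon> {a, b} \<theta>" using p by (simp add: p')
      then have "t3 \<subseteq> dart_edges {a, b} \<theta>" by (rule twists_subset)
      then show "t3 \<subseteq> {{a, b}}" using \<theta>(3,4) by (simp add: dart_edges_def insert_commute)
    qed (rule \<theta>)+
    then show ?thesis by (simp add: \<beta>_def p' del: of_nat_add flip: of_nat_add)
  qed
  have "face_law \<epsilon> ?D vx \<theta> = map_pmf ?F (map_pmf \<beta> (pmf_of_set ?Q))"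
    unfolding face_law_def using fin1 fin2 fin3 by (subst map_pmf_of_set_bij_betw[OF bij]) auto
  also have "\<dots> = map_pmf (\<lambda>p. ?F (\<beta> p)) (pmf_of_set ?Q)"
    by (simp only: pmf.map_comp o_def)
  also have "\<dots> = map_pmf (\<lambda>p. ?F1 (fst (fst p)) + ?F2 (snd (fst p)) - 1) (pmf_of_set ?Q)"
    by (intro map_pmf_cong refl count) (use fin1 fin2 fin3 in auto)
  \<comment> \<open>The face count no longer mentions the bar, so only the first marginal of the
    uniform law on the product remains; it is again uniform.\<close>
  also have "\<dots> = map_pmf (\<lambda>p. ?F1 (fst p) + ?F2 (snd p) - 1) (map_pmf fst (pmf_of_set ?Q))"
    by (simp only: pmf.map_comp o_def)
  also have "map_pmf fst (pmf_of_set ?Q) = pmf_of_set ((?R1 \<times> ?T1) \<times> (?R2 \<times> ?T2))"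
    using fin1 fin2 fin3 by (subst pmf_of_set_Times) (auto simp: map_fst_pair_pmf)
  also have "\<dots> = pair_pmf (pmf_of_set (?R1 \<times> ?T1)) (pmf_of_set (?R2 \<times> ?T2))"
    using fin1 fin2 by (intro pmf_of_set_Times)
  also have "map_pmf (\<lambda>p. ?F1 (fst p) + ?F2 (snd p) - 1) \<dots>
     = map_pmf (\<lambda>(m, n). m + n - 1) (pair_pmf (face_law \<epsilon> D1 vx \<theta>) (face_law \<epsilon> D2 vx \<theta>))"
    unfolding face_law_def map_pair[symmetric] pmf.map_comp by (rule map_pmf_cong) (auto simp: o_def)
  finally show ?thesis .
qed

section \<open>Invariance of the face distribution under relabelling of darts\<close>

definition push :: "('a \<Rightarrow> 'b) \<Rightarrow> 'a set \<Rightarrow> ('a \<Rightarrow> 'a) \<Rightarrow> 'b \<Rightarrow> 'b" where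
  "push h D \<rho> = (\<lambda>y. if y \<in> h ` D then h (\<rho> (inv_into D h y)) else y)"

lemma push_image: "inj_on h D \<Longrightarrow> d \<in> D \<Longrightarrow> push h D \<rho> (h d) = h (\<rho> d)"
  by (simp add: push_def)

lemma push_in_rotations:
  assumes inj: "inj_on h D" and \<rho>: "\<rho> \<in> rotations D vx"
    and vx: "\<And>d e. d \<in> D \<Longrightarrow> e \<in> D \<Longrightarrow> vx' (h d) = vx' (h e) \<longleftrightarrow> vx d = vx e"
  shows "push h D \<rho> \<in> rotations (h ` D) vx'"
proof -
  have p: "\<rho> permutes D" using \<rho> by (rule rotations_permutes)
  have "push h D \<rho> permutes h ` D"
    unfolding push_def by (rule permutes_bij_inv_into[OF p]) (use inj in \<open>simp add: bij_betw_def\<close>)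
  moreover have "cyclic_on (push h D \<rho>) {e \<in> h ` D. vx' e = vx' (h d)}" if d: "d \<in> D" for d
  proof -
    have "cyclic_on \<rho> {e \<in> D. vx e = vx d}" using \<rho> d by (auto simp: rotations_def)
    then have "cyclic_on (push h D \<rho>) (h ` {e \<in> D. vx e = vx d})"
      by (rule cyclic_on_image) (use push_image[OF inj] in auto)
    moreover have "h ` {e \<in> D. vx e = vx d} = {e \<in> h ` D. vx' e = vx' (h d)}"
      using vx d by auto
    ultimately show ?thesis by simp
  qed
  ultimately show ?thesis by (auto simp: rotations_def)
qed

lemma push_push:
  assumes "inj_on h D" "\<rho> permutes D"
  shows "push (inv_into D h) (h ` D) (push h D \<rho>) = \<rho>"
proof
  fix x
  have i: "inj_on (inv_into D h) (h ` D)" by (simp add: inj_on_inv_into)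
  have im: "inv_into D h ` h ` D = D" using assms(1) by simp
  show "push (inv_into D h) (h ` D) (push h D \<rho>) x = \<rho> x"
  proof (cases "x \<in> D")
    case True
    then have "push (inv_into D h) (h ` D) (push h D \<rho>) (inv_into D h (h x)) = inv_into D h (push h D \<rho> (h x))"
      by (intro push_image[OF i]) auto
    then show ?thesis using True assms permutes_in_image[OF assms(2), of x] by (simp add: push_image)
  next
    case False
    then show ?thesis using im assms(2) by (simp add: push_def[of "inv_into D h"] permutes_not_in)
  qed
qed

lemma bij_betw_push:
  assumes inj: "inj_on h D"
    and vx: "\<And>d e. d \<in> D \<Longrightarrow> e \<in> D \<Longrightarrow> vx' (h d) = vx' (h e) \<longleftrightarrow> vx d = vx e"
  shows "bij_betw (push h D) (rotations D vx) (rotations (h ` D) vx')"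
proof (rule bij_betw_byWitness[where f'="push (inv_into D h) (h ` D)"])
  let ?g = "inv_into D h"
  have i: "inj_on ?g (h ` D)" by (simp add: inj_on_inv_into)
  have im: "?g ` h ` D = D" using inj by simp
  have inv: "inv_into (h ` D) ?g d = h d" if "d \<in> D" for d
    using that inj by (intro inv_into_f_eq[OF i]) auto
  show "\<forall>\<rho>\<in>rotations D vx. push ?g (h ` D) (push h D \<rho>) = \<rho>"
    using push_push[OF inj] rotations_permutes by blast
  show "\<forall>\<sigma>\<in>rotations (h ` D) vx'. push h D (push ?g (h ` D) \<sigma>) = \<sigma>"
  proof
    fix \<sigma> assume "\<sigma> \<in> rotations (h ` D) vx'"
    then have p: "\<sigma> permutes h ` D" by (rule rotations_permutes)
    show "push h D (push ?g (h ` D) \<sigma>) = \<sigma>"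
    proof
      fix y
      show "push h D (push ?g (h ` D) \<sigma>) y = \<sigma> y"
      proof (cases "y \<in> h ` D")
        case True
        then have "push ?g (h ` D) \<sigma> (?g y) = ?g (\<sigma> y)" by (rule push_image[OF i])
        then show ?thesis
          using True permutes_in_image[OF p, of y] by (simp add: push_def[of h] f_inv_into_f)
      next
        case False
        then show ?thesis using p by (simp add: push_def[of h] permutes_not_in)
      qed
    qed
  qed
  show "push h D ` rotations D vx \<subseteq> rotations (h ` D) vx'"
    by (rule image_subsetI) (rule push_in_rotations[where vx=vx and vx'=vx', OF inj _ vx])
  have "push ?g (h ` D) \<sigma> \<in> rotations (?g ` h ` D) vx" if "\<sigma> \<in> rotations (h ` D) vx'" for \<sigma>
    by (rule push_in_rotations[OF i that]) (use vx inj in auto)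
  then show "push ?g (h ` D) ` rotations (h ` D) vx' \<subseteq> rotations D vx"
    unfolding im by blast
qed

lemma face_count_push:
  assumes inj: "inj_on h D" and \<rho>: "\<rho> permutes D" and \<theta>: "fpf_involution_on D \<theta>"
    and \<theta>': "\<And>d. d \<in> D \<Longrightarrow> \<theta>' (h d) = h (\<theta> d)" and t: "t \<subseteq> Pow D"
  shows "face_count (h ` D) \<theta>' (push h D \<rho>) (image h ` t) = face_count D \<theta> \<rho> t"
proof -
  let ?R = "corners D \<rho> \<union> bands D \<theta> t"
  let ?R' = "corners (h ` D) (push h D \<rho>) \<union> bands (h ` D) \<theta>' (image h ` t)"
  let ?f = "map_prod h id" and ?g = "map_prod (inv_into D h) id"
  have \<theta>D: "\<theta> d \<in> D" if "d \<in> D" for d using \<theta> that by (simp add: fpf_involution_on_def)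
  \<comment> \<open>Since \<open>h\<close> is injective on \<open>D\<close> only, taking images is
    injective on subsets of \<open>D\<close> only; this is the place of the assumption
    \<open>t \<subseteq> Pow D\<close>.\<close>
  have mem: "{h d, \<theta>' (h d)} \<in> image h ` t \<longleftrightarrow> {d, \<theta> d} \<in> t" if "d \<in> D" for d
  proof -
    have "{h d, \<theta>' (h d)} = h ` {d, \<theta> d}" using \<theta>'[OF that] by simp
    then show ?thesis
      using inj_on_image_mem_iff[OF inj_on_image_Pow[OF inj], of "{d, \<theta> d}" t] that \<theta>D[OF that] t by auto
  qed
  have step: "(?f z, ?f w) \<in> ?R'" if "(z, w) \<in> ?R" for z w
  proof (cases z)
    case z: (Pair d s)
    have d: "d \<in> D" using that by (auto simp: z mem_corners_iff mem_bands_iff)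
    have eqs: "push h D \<rho> (h d) = h (\<rho> d)" "\<theta>' (h d) = h (\<theta> d)"
      "{h d, h (\<theta> d)} \<in> image h ` t \<longleftrightarrow> {d, \<theta> d} \<in> t"
      using push_image[OF inj d] \<theta>'[OF d] mem[OF d] by simp_all
    have "s \<and> w = (\<rho> d, False) \<or> w = (\<theta> d, if {d, \<theta> d} \<in> t then s else \<not> s)"
      using that unfolding z Un_iff mem_corners_iff mem_bands_iff by blast
    then have "s \<and> ?f w = (h (\<rho> d), False) \<or> ?f w = (h (\<theta> d), if {d, \<theta> d} \<in> t then s else \<not> s)"
      by (elim disjE conjE) simp_all
    then show ?thesis
      using d unfolding z map_prod_simp id_apply Un_iff mem_corners_iff mem_bands_iff eqs by blast
  qed
  have step': "(?g z, ?g w) \<in> ?R" if "(z, w) \<in> ?R'" for z w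
  proof -
    obtain e s where z: "z = (e, s)" by (cases z)
    have "e \<in> h ` D" using that by (auto simp: z mem_corners_iff mem_bands_iff)
    then obtain d where d: "d \<in> D" "e = h d" by auto
    have eqs: "push h D \<rho> (h d) = h (\<rho> d)" "\<theta>' (h d) = h (\<theta> d)"
        "{h d, h (\<theta> d)} \<in> image h ` t \<longleftrightarrow> {d, \<theta> d} \<in> t"
      using push_image[OF inj d(1)] \<theta>'[OF d(1)] mem[OF d(1)] by simp_all
    have inv: "inv_into D h (h (\<rho> d)) = \<rho> d" "inv_into D h (h (\<theta> d)) = \<theta> d" "inv_into D h (h d) = d"
      using permutes_in_image[OF \<rho>, of d] \<theta>D[OF d(1)] d(1) inj by simp_all
    have "s \<and> w = (h (\<rho> d), False) \<or> w = (h (\<theta> d), if {d, \<theta> d} \<in> t then s else \<not> s)"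
      using that unfolding z d(2) Un_iff mem_corners_iff mem_bands_iff eqs by blast
    then have "s \<and> ?g w = (\<rho> d, False) \<or> ?g w = (\<theta> d, if {d, \<theta> d} \<in> t then s else \<not> s)"
      by (elim disjE conjE) (simp_all add: inv)
    then show ?thesis
      using d(1) unfolding z d(2) map_prod_simp id_apply Un_iff mem_corners_iff mem_bands_iff inv by blast
  qed
  have "card ((D \<times> UNIV) // conn ?R) = card ((h ` D \<times> UNIV) // conn ?R')"
  proof (rule card_quotient_transfer[where f="?f"])
    fix x y :: "'a \<times> bool" assume xy: "x \<in> D \<times> UNIV" "y \<in> D \<times> UNIV"
    have gf: "?g (?f x) = x" "?g (?f y) = y" using xy inj by auto
    show "(x, y) \<in> conn ?R \<longleftrightarrow> (?f x, ?f y) \<in> conn ?R'"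
    proof
      assume "(x, y) \<in> conn ?R"
      then show "(?f x, ?f y) \<in> conn ?R'" by (rule conn_map) (intro conn_step step)
    next
      assume "(?f x, ?f y) \<in> conn ?R'"
      then have "(?g (?f x), ?g (?f y)) \<in> conn ?R" by (rule conn_map) (intro conn_step step')
      then show "(x, y) \<in> conn ?R" by (simp only: gf)
    qed
  next
    show "?f ` (D \<times> UNIV) \<subseteq> h ` D \<times> UNIV" by auto
    fix y :: "'b \<times> bool" assume "y \<in> h ` D \<times> UNIV"
    then obtain d s where "d \<in> D" "y = ?f (d, s)" by auto
    then show "\<exists>x\<in>D \<times> UNIV. (?f x, y) \<in> conn ?R'"
      by (intro bexI[of _ "(d, s)"]) simp_all
  qed
  then show ?thesis by (simp add: face_count_def)
qed

text \<open>Vertex maps enter only through the partition of darts that they induce, so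
  \<open>vx\<close> and \<open>vx'\<close> may have different codomains. This serves isomorphisms as
  well as the two copies inside a bar-amalgamation.\<close>

lemma face_law_image:
  assumes fin: "finite D" and inj: "inj_on h D" and \<theta>: "fpf_involution_on D \<theta>"
    and \<theta>': "\<And>d. d \<in> D \<Longrightarrow> \<theta>' (h d) = h (\<theta> d)"
    and vx: "\<And>d e. d \<in> D \<Longrightarrow> e \<in> D \<Longrightarrow> vx' (h d) = vx' (h e) \<longleftrightarrow> vx d = vx e"
  shows "face_law \<epsilon> (h ` D) vx' \<theta>' = face_law \<epsilon> D vx \<theta>"
proof -
  have \<theta>D: "\<theta> d \<in> D" if "d \<in> D" for d using \<theta> that by (simp add: fpf_involution_on_def)
  have sub: "dart_edges D \<theta> \<subseteq> Pow D" using \<theta>D by (auto simp: dart_edges_def)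
  have E: "dart_edges (h ` D) \<theta>' = image h ` dart_edges D \<theta>"
    unfolding dart_edges_def image_image by (rule image_cong) (simp_all add: \<theta>')
  have "bij_betw (image h) (dart_edges D \<theta>) (dart_edges (h ` D) \<theta>')"
    unfolding E using inj_on_subset[OF inj_on_image_Pow[OF inj] sub] by (simp add: bij_betw_def)
  then have T: "bij_betw (image (image h)) (twists \<epsilon> D \<theta>) (twists \<epsilon> (h ` D) \<theta>')"
    by (cases \<epsilon>) (simp_all add: twists_def bij_betw_Pow)
  have bij: "bij_betw (map_prod (push h D) (image (image h)))
      (rotations D vx \<times> twists \<epsilon> D \<theta>) (rotations (h ` D) vx' \<times> twists \<epsilon> (h ` D) \<theta>')"
    by (rule bij_betw_map_prod[OF bij_betw_push[where vx=vx and vx'=vx', OF inj vx] T])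
  have ne: "rotations D vx \<times> twists \<epsilon> D \<theta> \<noteq> {}" "finite (rotations D vx \<times> twists \<epsilon> D \<theta>)"
    by (simp_all add: rotations_nonempty finite_rotations finite_twists twists_nonempty fin)
  have "face_law \<epsilon> (h ` D) vx' \<theta>' = map_pmf (\<lambda>p. (\<lambda>(\<rho>, t). real (face_count (h ` D) \<theta>' \<rho> t))
      (map_prod (push h D) (image (image h)) p)) (pmf_of_set (rotations D vx \<times> twists \<epsilon> D \<theta>))"
    unfolding face_law_def map_pmf_of_set_bij_betw[OF bij ne, symmetric] pmf.map_comp o_def ..
  also have "\<dots> = face_law \<epsilon> D vx \<theta>"
    unfolding face_law_def
  proof (rule map_pmf_cong[OF refl])
    fix p assume "p \<in> set_pmf (pmf_of_set (rotations D vx \<times> twists \<epsilon> D \<theta>))"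
    then have "p \<in> rotations D vx \<times> twists \<epsilon> D \<theta>" using ne by simp
    then obtain \<rho> t where p: "p = (\<rho>, t)" "\<rho> permutes D" "t \<in> twists \<epsilon> D \<theta>"
      by (auto simp: rotations_permutes)
    have "t \<subseteq> Pow D" using twists_subset[OF p(3)] sub by blast
    then show "(\<lambda>(\<rho>, t). real (face_count (h ` D) \<theta>' \<rho> t)) (map_prod (push h D) (image (image h)) p)
        = (\<lambda>(\<rho>, t). real (face_count D \<theta> \<rho> t)) p"
      using face_count_push[OF inj p(2) \<theta> \<theta>'] by (simp add: p(1))
  qed
  finally show ?thesis .
qed

section \<open>A central limit theorem for convolutions\<close>

definition conv_pmf :: "real pmf \<Rightarrow> real pmf \<Rightarrow> real pmf" where
  "conv_pmf p q = map_pmf (\<lambda>(x, y). x + y) (pair_pmf p q)"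

abbreviation mean :: "real pmf \<Rightarrow> real" where
  "mean p \<equiv> measure_pmf.expectation p (\<lambda>x. x)"

abbreviation var :: "real pmf \<Rightarrow> real" where
  "var p \<equiv> measure_pmf.variance p (\<lambda>x. x)"

text \<open>Centring removes the linear term of the expansion at 0, so this function can be compared
  directly with \<open>exp (- (u\<^sup>2 * var p / 2))\<close>.\<close>

definition centered_char :: "real pmf \<Rightarrow> real \<Rightarrow> complex" where
  "centered_char p u = measure_pmf.expectation p (\<lambda>x. iexp (u * (x - mean p)))"

lemma finite_set_conv_pmf:
  "finite (set_pmf p) \<Longrightarrow> finite (set_pmf q) \<Longrightarrow> finite (set_pmf (conv_pmf p q))"
  by (simp add: conv_pmf_def)

lemma expectation_pair_pmf_mult:
  fixes f :: "'a \<Rightarrow> complex" and g :: "'b \<Rightarrow> complex"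
  assumes "finite (set_pmf p)" "finite (set_pmf q)"
  shows "measure_pmf.expectation (pair_pmf p q) (\<lambda>z. f (fst z) * g (snd z)) =
         measure_pmf.expectation p f * measure_pmf.expectation q g"
proof -
  have "measure_pmf.expectation (pair_pmf p q) (\<lambda>z. f (fst z) * g (snd z)) =
        (\<Sum>z\<in>set_pmf p \<times> set_pmf q. pmf (pair_pmf p q) z *\<^sub>R (f (fst z) * g (snd z)))"
    using assms by (intro integral_measure_pmf) auto
  also have "\<dots> = (\<Sum>x\<in>set_pmf p. \<Sum>y\<in>set_pmf q. (pmf p x *\<^sub>R f x) * (pmf q y *\<^sub>R g y))"
    unfolding sum.cartesian_product by (rule sum.cong) (auto simp: pmf_pair)
  also have "\<dots> = (\<Sum>x\<in>set_pmf p. pmf p x *\<^sub>R f x) * (\<Sum>y\<in>set_pmf q. pmf q y *\<^sub>R g y)"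
    by (simp add: sum_product)
  also have "\<dots> = measure_pmf.expectation p f * measure_pmf.expectation q g"
    using assms by (simp add: integral_measure_pmf[where A="set_pmf p"] integral_measure_pmf[where A="set_pmf q"])
  finally show ?thesis .
qed

lemma mean_conv_pmf:
  assumes "finite (set_pmf p)" "finite (set_pmf q)"
  shows "mean (conv_pmf p q) = mean p + mean q"
proof -
  have "mean (conv_pmf p q) =
      measure_pmf.expectation (pair_pmf p q) (\<lambda>z. fst z + snd z)"
    by (simp add: conv_pmf_def case_prod_beta)
  also have "\<dots> = measure_pmf.expectation (pair_pmf p q) fst + measure_pmf.expectation (pair_pmf p q) snd"
    using assms by (intro Bochner_Integration.integral_add integrable_measure_pmf_finite) auto
  finally show ?thesis
    using expectation_pair_pmf_fst[of p q "\<lambda>x. x"] expectation_pair_pmf_snd[of p q "\<lambda>x. x"] by simp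
qed

lemma centered_char_conv_pmf:
  assumes "finite (set_pmf p)" "finite (set_pmf q)"
  shows "centered_char (conv_pmf p q) u = centered_char p u * centered_char q u"
proof -
  have "centered_char (conv_pmf p q) u =
      measure_pmf.expectation (pair_pmf p q)
        (\<lambda>z. iexp (u * (fst z - mean p)) * iexp (u * (snd z - mean q)))"
    unfolding centered_char_def mean_conv_pmf[OF assms]
    by (simp add: conv_pmf_def case_prod_beta exp_add[symmetric] algebra_simps)
  then show ?thesis
    using expectation_pair_pmf_mult[OF assms, of "\<lambda>x. iexp (u * (x - mean p))" "\<lambda>x. iexp (u * (x - mean q))"]
    by (simp add: centered_char_def)
qed

lemma mean_deviation:
  assumes "finite (set_pmf p)"
  shows "measure_pmf.expectation p (\<lambda>x. x - mean p) = 0"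
  using assms by (simp add: integrable_measure_pmf_finite)

lemma var_conv_pmf:
  assumes "finite (set_pmf p)" "finite (set_pmf q)"
  shows "var (conv_pmf p q) = var p + var q"
proof -
  have int: "integrable (measure_pmf (pair_pmf p q)) f" for f :: "_ \<Rightarrow> real"
    using assms by (intro integrable_measure_pmf_finite) auto
  have "var (conv_pmf p q) = measure_pmf.expectation (pair_pmf p q)
      (\<lambda>z. (fst z - mean p)\<^sup>2 + (snd z - mean q)\<^sup>2 + 2 * ((fst z - mean p) * (snd z - mean q)))"
    unfolding mean_conv_pmf[OF assms]
    by (simp add: conv_pmf_def case_prod_beta power2_eq_square algebra_simps)
  also have "\<dots> = measure_pmf.expectation (pair_pmf p q) (\<lambda>z. (fst z - mean p)\<^sup>2)
      + measure_pmf.expectation (pair_pmf p q) (\<lambda>z. (snd z - mean q)\<^sup>2)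
      + 2 * measure_pmf.expectation (pair_pmf p q) (\<lambda>z. (fst z - mean p) * (snd z - mean q))"
    using int by simp
  also have "measure_pmf.expectation (pair_pmf p q) (\<lambda>z. (fst z - mean p) * (snd z - mean q)) = 0"
  proof -
    \<comment> \<open>The cross term is moved to the complex numbers to reuse the product formula
      proved for characteristic functions.\<close>
    have "complex_of_real (measure_pmf.expectation (pair_pmf p q) (\<lambda>z. (fst z - mean p) * (snd z - mean q)))
      = measure_pmf.expectation (pair_pmf p q)
         (\<lambda>z. complex_of_real (fst z - mean p) * complex_of_real (snd z - mean q))"
      by (metis (no_types, lifting) Bochner_Integration.integral_cong integral_complex_of_real of_real_mult)
    also have "\<dots> = complex_of_real (measure_pmf.expectation p (\<lambda>x. x - mean p))
       * complex_of_real (measure_pmf.expectation q (\<lambda>x. x - mean q))"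
      using expectation_pair_pmf_mult[OF assms, of "\<lambda>x. complex_of_real (x - mean p)" "\<lambda>x. complex_of_real (x - mean q)"]
      by (simp only: integral_complex_of_real)
    finally show ?thesis
      using mean_deviation[OF assms(1)] by (simp del: Bochner_Integration.integral_diff)
  qed
  finally show ?thesis
    using expectation_pair_pmf_fst[of p q "\<lambda>x. (x - mean p)\<^sup>2"]
      expectation_pair_pmf_snd[of p q "\<lambda>x. (x - mean q)\<^sup>2"] by simp
qed

lemma norm_centered_char_le_1: "norm (centered_char p u) \<le> 1"
  unfolding centered_char_def
  by (rule order_trans[OF integral_norm_bound]) simp

section \<open>Gaussian approximation with an error proportional to the variance\<close>

text \<open>The upper bound inverts the quadratic Taylor bound for \<open>exp y\<close>: the product
  of \<open>1 - y + y\<^sup>2 / 2\<close> and \<open>1 + y + y\<^sup>2 / 2\<close> is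
  \<open>1 + (y\<^sup>2 / 2)\<^sup>2\<close>, which is at least 1.\<close>

lemma exp_minus_approx:
  fixes y :: real
  assumes "0 \<le> y"
  shows "\<bar>exp (- y) - (1 - y)\<bar> \<le> y\<^sup>2 / 2"
proof -
  have "1 + y + y\<^sup>2 / 2 \<le> exp y"
    using assms by (rule exp_lower_Taylor_quadratic)
  moreover have pos: "0 < 1 + y + y\<^sup>2 / 2"
    using assms by (simp add: add_pos_nonneg)
  ultimately have "exp (- y) \<le> 1 / (1 + y + y\<^sup>2 / 2)"
    by (simp add: exp_minus divide_simps)
  also have "\<dots> \<le> 1 - y + y\<^sup>2 / 2"
  proof -
    have "(1 - y + y\<^sup>2 / 2) * (1 + y + y\<^sup>2 / 2) = 1 + (y\<^sup>2 / 2)\<^sup>2"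
      by (simp add: power2_eq_square algebra_simps)
    then show ?thesis using pos by (simp add: pos_divide_le_eq)
  qed
  finally show ?thesis
    using exp_ge_add_one_self[of "- y"] by simp
qed

text \<open>Both functions are compared with \<open>1 - u\<^sup>2 * var p / 2\<close>. The Taylor
  remainder of \<open>iexp\<close> is at most a sixth of the cubed argument; one factor
  \<open>\<bar>x - mean p\<bar>\<close> is bounded by \<open>B\<close> and the other two average to
  the variance. The remainder of the Gaussian is \<open>u ^ 4 * (var p)\<^sup>2 / 8\<close>, where
  one factor \<open>var p\<close> is bounded by \<open>B\<^sup>2\<close>. Keeping one factor
  \<open>var p\<close> in both terms lets the errors of the summands add up to the total
  variance.\<close>

lemma centered_char_approx:
  assumes fin: "finite (set_pmf p)" and B: "\<And>x. x \<in> set_pmf p \<Longrightarrow> \<bar>x - mean p\<bar> \<le> B"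
  shows "norm (centered_char p u - exp (- (u\<^sup>2 * var p / 2)))
           \<le> var p * (\<bar>u\<bar> ^ 3 * B / 6 + u ^ 4 * B\<^sup>2 / 8)"
proof -
  let ?E = "measure_pmf.expectation p" and ?m = "mean p"
  have int: "integrable (measure_pmf p) f" for f :: "real \<Rightarrow> 'b :: {banach, second_countable_topology}"
    using fin by (intro integrable_measure_pmf_finite)
  have B0: "0 \<le> B" using B set_pmf_not_empty[of p] by (meson abs_ge_zero ex_in_conv order_trans)
  have var0: "0 \<le> var p" by simp
  have varB: "var p \<le> B\<^sup>2"
  proof -
    have "var p \<le> ?E (\<lambda>_. B\<^sup>2)"
      using B B0 by (intro integral_mono_AE int) (auto simp: AE_measure_pmf_iff abs_le_square_iff[symmetric])
    then show ?thesis by simp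
  qed
  have "norm (centered_char p u - (1 - u\<^sup>2 * var p / 2)) \<le> \<bar>u\<bar> ^ 3 * B / 6 * var p"
  proof -
    have c2: "?E (\<lambda>x. complex_of_real (u\<^sup>2 / 2 * (x - ?m)\<^sup>2)) = complex_of_real (u\<^sup>2 * var p / 2)"
      by (simp only: integral_complex_of_real) simp
    have c1: "?E (\<lambda>x. \<i> * complex_of_real (u * (x - ?m))) = 0"
      using mean_deviation[OF fin]
      by (simp only: integral_mult_right_zero integral_complex_of_real) simp
    have "centered_char p u - (1 - u\<^sup>2 * var p / 2) =
       ?E (\<lambda>x. iexp (u * (x - ?m))) - (?E (\<lambda>x. 1) + ?E (\<lambda>x. \<i> * complex_of_real (u * (x - ?m)))
         - ?E (\<lambda>x. complex_of_real (u\<^sup>2 / 2 * (x - ?m)\<^sup>2)))"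
      unfolding c1 c2 centered_char_def by simp
    also have "\<dots> = ?E (\<lambda>x. iexp (u * (x - ?m)) - (1 + \<i> * complex_of_real (u * (x - ?m))
         - complex_of_real (u\<^sup>2 / 2 * (x - ?m)\<^sup>2)))"
      by (simp only: Bochner_Integration.integral_diff[OF int int] Bochner_Integration.integral_add[OF int int])
    finally have eq: "centered_char p u - (1 - u\<^sup>2 * var p / 2) =
       ?E (\<lambda>x. iexp (u * (x - ?m)) - (1 + \<i> * complex_of_real (u * (x - ?m))
         - complex_of_real (u\<^sup>2 / 2 * (x - ?m)\<^sup>2)))" .
    have "norm (centered_char p u - (1 - u\<^sup>2 * var p / 2)) \<le> ?E (\<lambda>x. norm (iexp (u * (x - ?m)) - (1 + \<i> * complex_of_real (u * (x - ?m))
         - complex_of_real (u\<^sup>2 / 2 * (x - ?m)\<^sup>2))))"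
      unfolding eq by (rule integral_norm_bound)
    also have "\<dots> \<le> ?E (\<lambda>x. \<bar>u\<bar> ^ 3 * B / 6 * (x - ?m)\<^sup>2)"
    proof (rule integral_mono_AE[OF int int], unfold AE_measure_pmf_iff, rule ballI)
      fix x assume x: "x \<in> set_pmf p"
      let ?y = "u * (x - ?m)"
      have "(\<Sum>k \<le> 2. (\<i> * complex_of_real ?y)^k / fact k)
          = 1 + \<i> * complex_of_real ?y + (\<i> * complex_of_real ?y)\<^sup>2 / 2"
        by (simp add: numeral_2_eq_2 del: power_Suc)
      also have "(\<i> * complex_of_real ?y)\<^sup>2 / 2 = - complex_of_real (u\<^sup>2 / 2 * (x - ?m)\<^sup>2)"
        by (simp add: power_mult_distrib)
      finally have "norm (iexp ?y - (1 + \<i> * complex_of_real ?y - complex_of_real (u\<^sup>2 / 2 * (x - ?m)\<^sup>2)))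
          = norm (iexp ?y - (\<Sum>k \<le> 2. (\<i> * ?y)^k / fact k))"
        by (simp only: add_uminus_conv_diff)
      also have "\<dots> \<le> \<bar>?y\<bar> ^ 3 / 6"
        using iexp_approx1[of ?y 2] by (simp add: numeral_3_eq_3 fact_numeral)
      also have "\<dots> = \<bar>u\<bar> ^ 3 / 6 * (x - ?m)\<^sup>2 * \<bar>x - ?m\<bar>"
      proof -
        have "(x - ?m)\<^sup>2 = \<bar>x - ?m\<bar> * \<bar>x - ?m\<bar>" by (simp add: power2_eq_square)
        then show ?thesis
          by (simp add: abs_mult power_mult_distrib power3_eq_cube[of "\<bar>x - ?m\<bar>"] del: abs_mult_self_eq)
      qed
      also have "\<dots> \<le> \<bar>u\<bar> ^ 3 / 6 * (x - ?m)\<^sup>2 * B"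
        using B[OF x] by (intro mult_left_mono) auto
      also have "\<dots> = \<bar>u\<bar> ^ 3 * B / 6 * (x - ?m)\<^sup>2" by simp
      finally show "norm (iexp ?y - (1 + \<i> * complex_of_real ?y - complex_of_real (u\<^sup>2 / 2 * (x - ?m)\<^sup>2)))
         \<le> \<bar>u\<bar> ^ 3 * B / 6 * (x - ?m)\<^sup>2" .
    qed
    finally show ?thesis by simp
  qed
  moreover have "norm (complex_of_real (1 - u\<^sup>2 * var p / 2) - exp (- (u\<^sup>2 * var p / 2))) \<le> u ^ 4 * B\<^sup>2 / 8 * var p"
  proof -
    have "norm (complex_of_real (1 - u\<^sup>2 * var p / 2) - exp (- (u\<^sup>2 * var p / 2))) =
       \<bar>exp (- (u\<^sup>2 * var p / 2)) - (1 - u\<^sup>2 * var p / 2)\<bar>"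
      unfolding of_real_diff[symmetric] norm_of_real by (rule abs_minus_commute)
    also have "\<dots> \<le> (u\<^sup>2 * var p / 2)\<^sup>2 / 2"
      by (rule exp_minus_approx) (use var0 in simp)
    also have "\<dots> = u ^ 4 / 8 * var p * var p"
      by (simp add: power2_eq_square power4_eq_xxxx)
    also have "\<dots> \<le> u ^ 4 / 8 * var p * B\<^sup>2"
      using varB var0 by (intro mult_left_mono) auto
    finally show ?thesis by (simp add: mult_ac)
  qed
  ultimately have "norm (centered_char p u - exp (- (u\<^sup>2 * var p / 2)))
     \<le> \<bar>u\<bar> ^ 3 * B / 6 * var p + u ^ 4 * B\<^sup>2 / 8 * var p"
    by (rule norm_diff_triangle_le)
  then show ?thesis by (simp add: algebra_simps)
qed

text \<open>Centred characteristic functions multiply, the errors of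
  \<open>centered_char_approx\<close> add, and rescaling by \<open>sqrt (V n)\<close> turns the
  total into \<open>\<bar>t\<bar> ^ 3 * B / 6 / sqrt (V n) + t ^ 4 * B\<^sup>2 / 8 / V n\<close>.
  This vanishes because infinitely many summands have variance at least \<open>c\<close>; Levy
  continuity finishes.\<close>

theorem asymptotically_normal_conv_pmf:
  fixes p q :: "nat \<Rightarrow> real pmf"
  assumes base: "p 1 = q 1"
    and step: "\<And>n. n \<ge> 1 \<Longrightarrow> p (Suc n) = conv_pmf (p n) (q (Suc n))"
    and fin: "\<And>n. n \<ge> 1 \<Longrightarrow> finite (set_pmf (q n))"
    and B: "\<And>n x. n \<ge> 1 \<Longrightarrow> x \<in> set_pmf (q n) \<Longrightarrow> \<bar>x - mean (q n)\<bar> \<le> B"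
    and c: "0 < c" and inf: "\<exists>\<^sub>\<infinity>n. c \<le> var (q n)"
  shows "asymptotically_normal p"
proof -
  define V where "V n = var (p n)" for n
  have finp: "finite (set_pmf (p n))" if "n \<ge> 1" for n
    using that
  proof (induction n rule: dec_induct)
    case (step n)
    then show ?case using assms(2)[of n] fin[of "Suc n"] by (simp add: finite_set_conv_pmf)
  qed (simp add: base[unfolded One_nat_def] fin)
  have V0: "0 \<le> V n" for n by (simp add: V_def)
  have V_Suc: "V (Suc n) = V n + var (q (Suc n))" if "n \<ge> 1" for n
    unfolding V_def step[OF that] using that by (intro var_conv_pmf finp fin) auto
  have V_sum: "V n = (\<Sum>k=1..n. var (q k))" if "n \<ge> 1" for n
    using that by (induction n rule: dec_induct) (simp_all add: V_Suc, simp add: V_def base[unfolded One_nat_def])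
  have V_top: "filterlim V at_top sequentially"
    unfolding filterlim_at_top
  proof
    fix Z :: real
    \<comment> \<open>Index 0 is discarded because the variances are summed from 1. Then
      \<open>Z / c\<close> many indices suffice, each contributing at least
      \<open>c\<close>.\<close>
    have "infinite ({n. c \<le> var (q n)} - {0})"
      using inf by (simp add: frequently_cofinite)
    then obtain S where S: "S \<subseteq> {n. c \<le> var (q n)} - {0}" "finite S" "card S = nat \<lceil>Z / c\<rceil>"
      using infinite_arbitrarily_large by blast
    have "Z \<le> V n" if n: "n \<ge> Suc (Max (insert 0 S))" for n
    proof -
      have "S \<subseteq> {1..n}"
      proof
        fix k assume "k \<in> S"
        then have "k \<le> Max (insert 0 S)" "k \<noteq> 0" using S by auto
        then show "k \<in> {1..n}" using n by auto
      qed
      have "Z / c \<le> real (card S)" using S by linarith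
      then have "Z \<le> real (card S) * c" using c by (simp add: divide_le_eq)
      also have "\<dots> \<le> (\<Sum>k\<in>S. var (q k))" using S by (intro sum_bounded_below) auto
      also have "\<dots> \<le> (\<Sum>k=1..n. var (q k))"
        using \<open>S \<subseteq> {1..n}\<close> by (intro sum_mono2) auto
      also have "\<dots> = V n" using n by (intro V_sum[symmetric]) simp
      finally show ?thesis .
    qed
    then show "\<forall>\<^sub>F n in sequentially. Z \<le> V n"
      unfolding eventually_sequentially by blast
  qed
  have approx: "norm (centered_char (p n) u - exp (- (u\<^sup>2 * V n / 2)))
      \<le> V n * (\<bar>u\<bar> ^ 3 * B / 6 + u ^ 4 * B\<^sup>2 / 8)" if "n \<ge> 1" for n u
    using that
  proof (induction n rule: dec_induct)
    case base
    then show ?case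
      using centered_char_approx[OF fin B, of 1] by (simp add: V_def assms(1)[unfolded One_nat_def])
  next
    case (step n)
    let ?a = "centered_char (p n) u" and ?b = "centered_char (q (Suc n)) u"
    let ?a' = "complex_of_real (exp (- (u\<^sup>2 * V n / 2)))"
    let ?b' = "complex_of_real (exp (- (u\<^sup>2 * var (q (Suc n)) / 2)))"
    have "exp (- (u\<^sup>2 * V (Suc n) / 2)) = exp (- (u\<^sup>2 * V n / 2)) * exp (- (u\<^sup>2 * var (q (Suc n)) / 2))"
      unfolding mult_exp_exp V_Suc[OF step.hyps(1)] by (rule arg_cong[of _ _ exp]) (simp add: field_simps)
    then have "centered_char (p (Suc n)) u - exp (- (u\<^sup>2 * V (Suc n) / 2)) = ?a * ?b - ?a' * ?b'"
      using step.hyps by (simp only: assms(2) centered_char_conv_pmf finp fin of_real_mult le_SucI)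
    \<comment> \<open>The outer factors \<open>?a\<close> and \<open>?b'\<close> have norm at most
      1, so the error of a product is at most the sum of the errors of its factors.\<close>
    also have "\<dots> = ?a * (?b - ?b') + ?b' * (?a - ?a')"
      by (simp add: algebra_simps)
    also have "norm \<dots> \<le> norm (?b - ?b') + norm (?a - ?a')"
    proof (intro norm_triangle_le add_mono)
      show "norm (?a * (?b - ?b')) \<le> norm (?b - ?b')"
        unfolding norm_mult by (rule mult_left_le_one_le) (auto intro: norm_centered_char_le_1)
      show "norm (?b' * (?a - ?a')) \<le> norm (?a - ?a')"
        unfolding norm_mult by (rule mult_left_le_one_le) auto
    qed
    also have "\<dots> \<le> var (q (Suc n)) * (\<bar>u\<bar> ^ 3 * B / 6 + u ^ 4 * B\<^sup>2 / 8)
        + V n * (\<bar>u\<bar> ^ 3 * B / 6 + u ^ 4 * B\<^sup>2 / 8)"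
      using step.IH by (intro add_mono centered_char_approx fin B) auto
    finally show ?case by (simp add: V_Suc[OF step.hyps(1)] algebra_simps)
  qed
  show ?thesis
    unfolding asymptotically_normal_def
  proof (rule levy_continuity)
    show "real_distribution (standardized (p n))" for n
      unfolding standardized_def by (intro prob_space.real_distribution_distr[OF measure_pmf.prob_space_axioms]) simp
    show "real_distribution std_normal_distribution"
      by (rule real_dist_normal_dist)
    fix t :: real
    have char: "char (standardized (p n)) t = centered_char (p n) (t / sqrt (V n))" for n
      by (simp add: char_def standardized_def integral_distr centered_char_def V_def)
    have sqrt_top: "filterlim (\<lambda>n. sqrt (V n)) at_top sequentially"
      by (rule filterlim_compose[OF sqrt_at_top V_top])
    have bound: "norm (char (standardized (p n)) t - exp (- (t\<^sup>2 / 2)))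
       \<le> \<bar>t\<bar> ^ 3 * B / 6 / sqrt (V n) + t ^ 4 * B\<^sup>2 / 8 / V n" if "n \<ge> 1" "V n > 0" for n
    proof -
      have V4: "sqrt (V n) ^ 4 = V n * V n"
        using that by (metis power2_eq_square power_mult real_sqrt_pow2 less_imp_le numeral_Bit0 power_add)
      have V3: "sqrt (V n) ^ 3 = V n * sqrt (V n)"
        using that by (simp add: power3_eq_cube)
      show ?thesis
        using approx[OF that(1), of "t / sqrt (V n)"] that
        by (simp add: char power_divide V4 V3 distrib_left)
    qed
    have "\<forall>\<^sub>F n in sequentially. 0 < V n"
      using V_top by (simp add: filterlim_at_top_dense)
    with eventually_ge_at_top[of 1] have "\<forall>\<^sub>F n in sequentially.
       norm (char (standardized (p n)) t - exp (- (t\<^sup>2 / 2)))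
       \<le> \<bar>t\<bar> ^ 3 * B / 6 / sqrt (V n) + t ^ 4 * B\<^sup>2 / 8 / V n"
      by eventually_elim (rule bound)
    moreover have "(\<lambda>n. \<bar>t\<bar> ^ 3 * B / 6 / sqrt (V n) + t ^ 4 * B\<^sup>2 / 8 / V n) \<longlonglongrightarrow> 0 + 0"
      by (intro tendsto_add tendsto_divide_0[OF tendsto_const] filterlim_at_top_imp_at_infinity
          sqrt_top V_top)
    ultimately have "(\<lambda>n. char (standardized (p n)) t - exp (- (t\<^sup>2 / 2))) \<longlonglongrightarrow> 0"
      using Lim_null_comparison by fastforce
    then show "(\<lambda>n. char (standardized (p n)) t) \<longlonglongrightarrow> char std_normal_distribution t"
      by (simp add: char_std_normal_distribution LIM_zero_iff)
  qed
qed

section \<open>Laws of multigraphs\<close>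

text \<open>These properties carry the counting of embeddings, and they pass through
  bar-amalgamations and isomorphisms by direct computation.\<close>

definition finite_multigraph :: "('v, 'd) multigraph \<Rightarrow> bool" where
  "finite_multigraph G \<longleftrightarrow> finite (vertices G) \<and> finite (darts G) \<and>
     tail (dgraph G) ` darts G \<subseteq> vertices G \<and> fpf_involution_on (darts G) (opp G)"

text \<open>With \<open>\<epsilon>\<close> true, all signed rotation systems are equally likely and
  no spanning tree occurs; with \<open>\<epsilon>\<close> false, this is the law of twice the
  genus.\<close>

definition euler_law :: "bool \<Rightarrow> ('v, 'd) multigraph \<Rightarrow> real pmf" where
  "euler_law \<epsilon> G = map_pmf (euler_genus G) (pmf_of_set (rotation_systems G \<times> twists \<epsilon> (darts G) (opp G)))"

lemma connected_multigraph_imp_finite: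
  assumes "connected_multigraph G"
  shows "finite_multigraph G"
proof -
  interpret fin_digraph "dgraph G" using assms by (simp add: connected_multigraph_def)
  interpret bidirected_digraph "dgraph G" "opp G" using assms by (simp add: connected_multigraph_def)
  show ?thesis
    by (auto simp: finite_multigraph_def fpf_involution_on_def arev_neq)
qed

lemma connected_closed_set:
  assumes "Digraph_Component.connected K" "u \<in> verts K" "v \<in> verts K" "u \<in> X"
    and closed: "\<And>e. e \<in> arcs K \<Longrightarrow> tail K e \<in> X \<longleftrightarrow> head K e \<in> X"
  shows "v \<in> X"
proof -
  have "u \<rightarrow>\<^sup>*\<^bsub>mk_symmetric K\<^esub> v"
    using assms(1-3) by (auto simp: Digraph_Component.connected_def strongly_connected_def mk_symmetric_def)
  then have "(u, v) \<in> (arcs_ends (with_proj (mk_symmetric K)))\<^sup>*"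
    by (rule reachable_rtranclI)
  then show ?thesis
    by (induction rule: rtrancl_induct)
       (use assms(4) closed in \<open>auto simp: mk_symmetric_def arcs_ends_conv\<close>)
qed

text \<open>Otherwise \<open>{u}\<close> would be closed under adjacency, and connectedness would
  place the tail of every dart in it. This supplies the conditions \<open>isolated\<close> of
  \<open>face_law_join\<close>.\<close>

lemma connected_multigraph_dart_at:
  assumes c: "connected_multigraph G" and u: "u \<in> vertices G" and ne: "darts G \<noteq> {}"
  shows "\<exists>d\<in>darts G. tail (dgraph G) d = u"
proof (rule ccontr)
  interpret fin_digraph "dgraph G" using c by (simp add: connected_multigraph_def)
  interpret bidirected_digraph "dgraph G" "opp G" using c by (simp add: connected_multigraph_def)
  assume no: "\<not> (\<exists>d\<in>darts G. tail (dgraph G) d = u)"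
  then have no': "head (dgraph G) d \<noteq> u" if "d \<in> darts G" for d
    using no arev_in_arcs[OF that] by (simp flip: tail_arev[OF that])
  obtain d where d: "d \<in> darts G" using ne by auto
  have "tail (dgraph G) d \<in> {u}"
    by (rule connected_closed_set[of "dgraph G" u]) (use c u d no no' in \<open>auto simp: connected_multigraph_def\<close>)
  then show False using no d by auto
qed

lemma edges_eq_dart_edges: "edges G = dart_edges (darts G) (opp G)"
  by (simp add: edges_def dart_edges_def dart_edge_def)

text \<open>All terms of the Euler-genus except the face count are constant on a given graph; the
  number of edges is half the number of darts.\<close>

lemma euler_law_eq:
  assumes "finite_multigraph G"
  shows "euler_law \<epsilon> G = map_pmf (\<lambda>n. 2 - real (card (vertices G)) + real (card (darts G)) / 2 - n)
    (face_law \<epsilon> (darts G) (tail (dgraph G)) (opp G))"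
proof -
  have "rotation_systems G = rotations (darts G) (tail (dgraph G))"
    using assms by (intro rotation_systems_eq_rotations) (auto simp: finite_multigraph_def)
  moreover have "real (card (edges G)) = real (card (darts G)) / 2"
    using card_dart_edges[of "darts G" "opp G"] assms unfolding finite_multigraph_def edges_eq_dart_edges by linarith
  ultimately show ?thesis
    unfolding euler_law_def face_law_def pmf.map_comp
    by (intro map_pmf_cong) (auto simp: euler_genus_def num_faces_eq_face_count)
qed

lemma multigraph_isoE:
  assumes "multigraph_iso G H" "finite_multigraph G"
  obtains h k where "inj_on h (darts G)" "darts H = h ` darts G"
    "inj_on k (vertices G)" "vertices H = k ` vertices G"
    "\<And>d. d \<in> darts G \<Longrightarrow> tail (dgraph H) (h d) = k (tail (dgraph G) d)"
    "\<And>d. d \<in> darts G \<Longrightarrow> opp H (h d) = h (opp G d)"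
proof -
  obtain h where h: "pre_digraph.digraph_isomorphism (dgraph G) h" "dgraph H = app_iso h (dgraph G)"
    "\<forall>d\<in>darts G. opp H (iso_arcs h d) = iso_arcs h (opp G d)"
    using assms(1) by (auto simp: multigraph_iso_def)
  show thesis
    by (rule that[of "iso_arcs h" "iso_verts h"])
       (use h in \<open>auto simp: pre_digraph.digraph_isomorphism_def\<close>)
qed

lemma fpf_involution_on_image:
  assumes "fpf_involution_on D \<theta>" "inj_on h D" "\<And>d. d \<in> D \<Longrightarrow> \<theta>' (h d) = h (\<theta> d)"
  shows "fpf_involution_on (h ` D) \<theta>'"
  using assms by (auto simp: fpf_involution_on_def inj_on_eq_iff)

lemma multigraph_iso_finite:
  assumes "multigraph_iso G H" "finite_multigraph G"
  shows "finite_multigraph H"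
  using assms
proof (rule multigraph_isoE)
  fix h k assume *: "inj_on h (darts G)" "darts H = h ` darts G"
    "inj_on k (vertices G)" "vertices H = k ` vertices G"
    "\<And>d. d \<in> darts G \<Longrightarrow> tail (dgraph H) (h d) = k (tail (dgraph G) d)"
    "\<And>d. d \<in> darts G \<Longrightarrow> opp H (h d) = h (opp G d)"
  have "fpf_involution_on (darts H) (opp H)"
    unfolding *(2) using assms(2) * by (intro fpf_involution_on_image[where \<theta>="opp G"]) (auto simp: finite_multigraph_def)
  then show ?thesis using assms(2) * by (auto simp: finite_multigraph_def)
qed

lemma euler_law_iso:
  assumes "multigraph_iso G H" "finite_multigraph G"
  shows "euler_law \<epsilon> H = euler_law \<epsilon> G"
  using assms
proof (rule multigraph_isoE)
  fix h k assume *: "inj_on h (darts G)" "darts H = h ` darts G"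
    "inj_on k (vertices G)" "vertices H = k ` vertices G"
    "\<And>d. d \<in> darts G \<Longrightarrow> tail (dgraph H) (h d) = k (tail (dgraph G) d)"
    "\<And>d. d \<in> darts G \<Longrightarrow> opp H (h d) = h (opp G d)"
  have "face_law \<epsilon> (darts H) (tail (dgraph H)) (opp H) = face_law \<epsilon> (darts G) (tail (dgraph G)) (opp G)"
    unfolding *(2)
  proof (rule face_law_image[OF _ *(1)])
    show "finite (darts G)" "fpf_involution_on (darts G) (opp G)" using assms(2) by (auto simp: finite_multigraph_def)
    show "opp H (h d) = h (opp G d)" if "d \<in> darts G" for d using *(6) that .
    fix d e assume de: "d \<in> darts G" "e \<in> darts G"
    then have "tail (dgraph G) d \<in> vertices G" "tail (dgraph G) e \<in> vertices G"
      using assms(2) by (auto simp: finite_multigraph_def)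
    then show "tail (dgraph H) (h d) = tail (dgraph H) (h e) \<longleftrightarrow> tail (dgraph G) d = tail (dgraph G) e"
      using *(5)[OF de(1)] *(5)[OF de(2)] inj_on_eq_iff[OF *(3)] by simp
  qed
  then show ?thesis
    unfolding euler_law_eq[OF assms(2)] euler_law_eq[OF multigraph_iso_finite[OF assms]]
    using * by (simp add: card_image)
qed

section \<open>Additivity of the Euler-genus law\<close>

lemma bar_amalgamation_darts:
  "darts (bar_amalgamation G u H v) =
     insert (Inr False) ((Inl \<circ> Inl) ` darts G) \<union> insert (Inr True) ((Inl \<circ> Inr) ` darts H)"
  by (auto simp: bar_amalgamation_def UNIV_bool Plus_def)

lemma bar_amalgamation_finite:
  assumes "finite_multigraph G" "finite_multigraph H" "u \<in> vertices G" "v \<in> vertices H"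
  shows "finite_multigraph (bar_amalgamation G u H v)"
  using assms by (auto simp: finite_multigraph_def bar_amalgamation_def fpf_involution_on_def)

text \<open>Vertices add, edges add with one more for the bar, and faces add with one fewer. The two
  units of difference supply the second constant 2 in the sum of the two Euler-genera.\<close>

lemma euler_law_bar_amalgamation:
  assumes G: "finite_multigraph G" "darts G \<noteq> {} \<Longrightarrow> \<exists>d\<in>darts G. tail (dgraph G) d = u"
    and H: "finite_multigraph H" "darts H \<noteq> {} \<Longrightarrow> \<exists>d\<in>darts H. tail (dgraph H) d = v"
    and uv: "u \<in> vertices G" "v \<in> vertices H"
  shows "euler_law \<epsilon> (bar_amalgamation G u H v) = conv_pmf (euler_law \<epsilon> G) (euler_law \<epsilon> H)"
proof -
  let ?B = "bar_amalgamation G u H v"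
  let ?h1 = "Inl \<circ> Inl :: 'b \<Rightarrow> ('b + 'd) + bool" and ?h2 = "Inl \<circ> Inr :: 'd \<Rightarrow> ('b + 'd) + bool"
  let ?D1 = "?h1 ` darts G" and ?D2 = "?h2 ` darts H"
  have fin: "finite (vertices G)" "finite (vertices H)" "finite (darts G)" "finite (darts H)"
    and inv: "fpf_involution_on (darts G) (opp G)" "fpf_involution_on (darts H) (opp H)"
    using G(1) H(1) by (auto simp: finite_multigraph_def)
  have inj: "inj_on ?h1 (darts G)" "inj_on ?h2 (darts H)" by (auto simp: inj_on_def)
  have opp: "opp ?B (?h1 d) = ?h1 (opp G d)" "opp ?B (?h2 e) = ?h2 (opp H e)" for d e
    by (simp_all add: bar_amalgamation_def)
  have tl: "tail (dgraph ?B) (?h1 d) = Inl (tail (dgraph G) d)" "tail (dgraph ?B) (?h2 e) = Inr (tail (dgraph H) e)"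
    "tail (dgraph ?B) (Inr False) = Inl u" "tail (dgraph ?B) (Inr True) = Inr v" for d e
    by (simp_all add: bar_amalgamation_def)
  have "face_law \<epsilon> (darts ?B) (tail (dgraph ?B)) (opp ?B) =
     map_pmf (\<lambda>(m, n). m + n - 1) (pair_pmf (face_law \<epsilon> ?D1 (tail (dgraph ?B)) (opp ?B))
        (face_law \<epsilon> ?D2 (tail (dgraph ?B)) (opp ?B)))"
    unfolding bar_amalgamation_darts
  proof (rule face_law_join)
    show "fpf_involution_on ?D1 (opp ?B)" "fpf_involution_on ?D2 (opp ?B)"
      by (rule fpf_involution_on_image[OF inv(1) inj(1) opp(1)] fpf_involution_on_image[OF inv(2) inj(2) opp(2)])+
    show "opp ?B (Inr False) = Inr True" "opp ?B (Inr True) = Inr False"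
      by (simp_all add: bar_amalgamation_def)
    have "tail (dgraph ?B) ` insert (Inr False) ?D1 \<inter> tail (dgraph ?B) ` insert (Inr True) ?D2
        \<subseteq> range Inl \<inter> range Inr"
      by (intro Int_mono) (use tl in auto)
    also have "\<dots> = {}" by auto
    finally show "tail (dgraph ?B) ` insert (Inr False) ?D1 \<inter> tail (dgraph ?B) ` insert (Inr True) ?D2 = {}"
      by (rule subset_empty[THEN iffD1])
    show "\<exists>d\<in>?D1. tail (dgraph ?B) d = tail (dgraph ?B) (Inr False)" if ne: "?D1 \<noteq> {}"
    proof -
      obtain d where "d \<in> darts G" "tail (dgraph G) d = u" using G(2) ne by blast
      then show ?thesis by (intro bexI[of _ "?h1 d"]) (simp_all only: tl image_eqI)
    qed
    show "\<exists>d\<in>?D2. tail (dgraph ?B) d = tail (dgraph ?B) (Inr True)" if ne: "?D2 \<noteq> {}"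
    proof -
      obtain d where "d \<in> darts H" "tail (dgraph H) d = v" using H(2) ne by blast
      then show ?thesis by (intro bexI[of _ "?h2 d"]) (simp_all only: tl image_eqI)
    qed
  qed (use fin in auto)
  \<comment> \<open>\<open>face_law_join\<close> leaves both halves as dart sets inside the
    amalgamation; relabelling identifies them with the original graphs.\<close>
  also have "face_law \<epsilon> ?D1 (tail (dgraph ?B)) (opp ?B) = face_law \<epsilon> (darts G) (tail (dgraph G)) (opp G)"
    by (rule face_law_image[OF fin(3) inj(1) inv(1) opp(1)]) (simp only: tl sum.inject)
  also have "face_law \<epsilon> ?D2 (tail (dgraph ?B)) (opp ?B) = face_law \<epsilon> (darts H) (tail (dgraph H)) (opp H)"
    by (rule face_law_image[OF fin(4) inj(2) inv(2) opp(2)]) (simp only: tl sum.inject)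
  finally have law: "face_law \<epsilon> (darts ?B) (tail (dgraph ?B)) (opp ?B) = map_pmf (\<lambda>(m, n). m + n - 1)
     (pair_pmf (face_law \<epsilon> (darts G) (tail (dgraph G)) (opp G)) (face_law \<epsilon> (darts H) (tail (dgraph H)) (opp H)))" .
  have cV: "card (vertices ?B) = card (vertices G) + card (vertices H)"
    using fin by (simp add: bar_amalgamation_def card_Plus)
  have cD: "card (darts ?B) = card (darts G) + card (darts H) + 2"
    using fin by (simp add: bar_amalgamation_def card_Plus)
  show ?thesis
    unfolding euler_law_eq[OF bar_amalgamation_finite[OF G(1) H(1) uv]] euler_law_eq[OF G(1)] euler_law_eq[OF H(1)]
      law conv_pmf_def map_pair[symmetric] pmf.map_comp cV cD
    by (rule map_pmf_cong) (auto simp: o_def add_divide_distrib)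
qed

lemma genus_law_eq:
  fixes G :: "('v, 'd) multigraph"
  assumes "finite_multigraph G"
  shows "genus_law G = map_pmf (\<lambda>x. x / 2) (euler_law False G)"
proof -
  have R: "rotation_systems G = rotations (darts G) (tail (dgraph G))"
    using assms by (intro rotation_systems_eq_rotations) (auto simp: finite_multigraph_def)
  let ?f = "\<lambda>\<rho>. (\<rho>, {} :: 'd set set)"
  have bij: "bij_betw ?f (rotation_systems G) (rotation_systems G \<times> twists False (darts G) (opp G))"
    by (auto simp: bij_betw_def inj_on_def twists_def)
  have "pmf_of_set (rotation_systems G \<times> twists False (darts G) (opp G)) = map_pmf ?f (pmf_of_set (rotation_systems G))"
    using assms
    by (intro map_pmf_of_set_bij_betw[OF bij, symmetric])
       (simp_all add: R rotations_nonempty finite_rotations finite_multigraph_def)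
  then show ?thesis
    unfolding genus_law_def euler_law_def pmf.map_comp
    by (simp only: pmf.map_comp o_def genus_def [abs_def])
qed

section \<open>Reversing local orientations\<close>

definition flip_rotation :: "('d \<Rightarrow> 'v) \<Rightarrow> 'v set \<Rightarrow> ('d \<Rightarrow> 'd) \<Rightarrow> 'd \<Rightarrow> 'd" where
  "flip_rotation vx W \<rho> d = (if vx d \<in> W then inv \<rho> d else \<rho> d)"

text \<open>These are the edges whose twist changes when the vertices in \<open>W\<close> are
  reversed: an edge with both ends in \<open>W\<close>, in particular a loop, is toggled twice and
  keeps its twist.\<close>

definition cut_edges :: "'d set \<Rightarrow> ('d \<Rightarrow> 'v) \<Rightarrow> ('d \<Rightarrow> 'd) \<Rightarrow> 'v set \<Rightarrow> 'd set set" where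
  "cut_edges D vx \<theta> W = {{d, \<theta> d} | d. d \<in> D \<and> vx d \<in> W \<and> vx (\<theta> d) \<notin> W}"

lemma mem_cut_edges:
  assumes "fpf_involution_on D \<theta>" "d \<in> D"
  shows "{d, \<theta> d} \<in> cut_edges D vx \<theta> W \<longleftrightarrow> (vx d \<in> W) \<noteq> (vx (\<theta> d) \<in> W)"
proof
  assume "{d, \<theta> d} \<in> cut_edges D vx \<theta> W"
  then obtain e where e: "e \<in> D" "vx e \<in> W" "vx (\<theta> e) \<notin> W" "{d, \<theta> d} = {e, \<theta> e}"
    by (auto simp: cut_edges_def)
  then have "d = e \<and> \<theta> d = \<theta> e \<or> d = \<theta> e \<and> \<theta> d = e" by (simp add: doubleton_eq_iff)
  then show "(vx d \<in> W) \<noteq> (vx (\<theta> d) \<in> W)" using e by auto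
next
  assume ne: "(vx d \<in> W) \<noteq> (vx (\<theta> d) \<in> W)"
  have \<theta>: "\<theta> d \<in> D" "\<theta> (\<theta> d) = d" using assms by (auto simp: fpf_involution_on_def)
  show "{d, \<theta> d} \<in> cut_edges D vx \<theta> W"
  proof (cases "vx d \<in> W")
    case True
    then show ?thesis using ne assms(2) by (auto simp: cut_edges_def)
  next
    case False
    then have "vx (\<theta> d) \<in> W" "vx (\<theta> (\<theta> d)) \<notin> W" "{d, \<theta> d} = {\<theta> d, \<theta> (\<theta> d)}" using ne \<theta> by auto
    then show ?thesis using \<theta>(1) unfolding cut_edges_def mem_Collect_eq by blast
  qed
qed

lemma cut_edges_subset: "cut_edges D vx \<theta> W \<subseteq> dart_edges D \<theta>"
  by (auto simp: cut_edges_def dart_edges_def)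

lemma rotations_vx:
  assumes "\<rho> \<in> rotations D vx"
  shows "vx (\<rho> d) = vx d" "vx (inv \<rho> d) = vx d"
proof -
  have p: "\<rho> permutes D" using assms by (rule rotations_permutes)
  show *: "vx (\<rho> d) = vx d" for d
  proof (cases "d \<in> D")
    case True
    then have "cyclic_on \<rho> {e \<in> D. vx e = vx d}" using assms by (auto simp: rotations_def)
    from cyclic_on_inI[OF this, of d] True show ?thesis by simp
  qed (use p in \<open>simp add: permutes_not_in\<close>)
  show "vx (inv \<rho> d) = vx d"
    using *[of "inv \<rho> d"] permutes_inverses(1)[OF p] by simp
qed

lemma flip_rotation_in_rotations:
  assumes fin: "finite D" and \<rho>: "\<rho> \<in> rotations D vx"
  shows "flip_rotation vx W \<rho> \<in> rotations D vx"
proof -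
  have p: "\<rho> permutes D" using \<rho> by (rule rotations_permutes)
  let ?g = "\<lambda>d. if vx d \<in> W then \<rho> d else inv \<rho> d"
  have "bij (flip_rotation vx W \<rho>)"
    by (rule o_bij[where g="?g"])
       (auto simp: fun_eq_iff flip_rotation_def rotations_vx[OF \<rho>] permutes_inverses[OF p])
  then have "flip_rotation vx W \<rho> permutes D"
    using permutes_not_in[OF p] permutes_not_in[OF permutes_inv[OF p]]
    by (auto simp: permutes_def bij_iff flip_rotation_def)
  moreover have "cyclic_on (flip_rotation vx W \<rho>) {e \<in> D. vx e = vx d}" if d: "d \<in> D" for d
  proof -
    have c: "cyclic_on \<rho> {e \<in> D. vx e = vx d}" using \<rho> d by (auto simp: rotations_def)
    have "permutation \<rho>" using p fin by (auto simp: permutation_permutes)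
    then have "cyclic_on (inv \<rho>) {e \<in> D. vx e = vx d}"
      using c by (simp add: cyclic_on_alldef orbit_inv_eq)
    moreover have "cyclic_on (flip_rotation vx W \<rho>) {e \<in> D. vx e = vx d} =
       cyclic_on (if vx d \<in> W then inv \<rho> else \<rho>) {e \<in> D. vx e = vx d}"
      by (rule cyclic_cong) (auto simp: flip_rotation_def)
    ultimately show ?thesis using c by simp
  qed
  ultimately show ?thesis by (simp add: rotations_def)
qed

lemma flip_rotation_flip_rotation:
  assumes fin: "finite D" and \<rho>: "\<rho> \<in> rotations D vx"
  shows "flip_rotation vx W (flip_rotation vx W \<rho>) = \<rho>"
proof
  fix d
  have p: "\<rho> permutes D" using \<rho> by (rule rotations_permutes)
  have p': "flip_rotation vx W \<rho> permutes D"
    by (rule rotations_permutes[OF flip_rotation_in_rotations[OF fin \<rho>]])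
  show "flip_rotation vx W (flip_rotation vx W \<rho>) d = \<rho> d"
  proof (cases "vx d \<in> W")
    case True
    have "flip_rotation vx W \<rho> (\<rho> d) = d"
      using True by (simp add: flip_rotation_def rotations_vx[OF \<rho>] permutes_inverses[OF p])
    then have "inv (flip_rotation vx W \<rho>) d = \<rho> d"
      by (rule inv_f_eq[OF permutes_inj[OF p']])
    then show ?thesis using True by (subst flip_rotation_def) simp
  qed (simp add: flip_rotation_def)
qed

text \<open>Reversing the local orientation at the vertices in \<open>W\<close> exchanges the two sides of the darts there.\<close>

definition flip_side :: "('d \<Rightarrow> 'v) \<Rightarrow> 'v set \<Rightarrow> 'd \<times> bool \<Rightarrow> 'd \<times> bool" where
  "flip_side vx W = (\<lambda>(d, s). (d, s \<noteq> (vx d \<in> W)))"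

text \<open>At a vertex of \<open>W\<close>, exchanging sides turns the corner from
  \<open>(d, True)\<close> to \<open>(\<rho> d, False)\<close> into the pair of
  \<open>(d, False)\<close> and \<open>(\<rho> d, True)\<close>, which is the corner of the inverse
  rotation at \<open>\<rho> d\<close> read backwards. Along a band, exchanging the sides at exactly
  one end amounts to toggling the twist.\<close>

lemma flip_sides_connected:
  fixes vx :: "'d \<Rightarrow> 'v" and \<rho> \<theta> :: "'d \<Rightarrow> 'd"
  assumes \<rho>: "\<rho> \<in> rotations D vx" and \<theta>: "fpf_involution_on D \<theta>"
    and zw: "(z, w) \<in> conn (corners D \<rho> \<union> bands D \<theta> t)"
  shows "(flip_side vx W z, flip_side vx W w)
    \<in> conn (corners D (flip_rotation vx W \<rho>) \<union> bands D \<theta> (sym_diff t (cut_edges D vx \<theta> W)))"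
    (is "_ \<in> conn (?C \<union> ?B)")
  using zw
proof (rule conn_map)
  fix z w assume step: "(z, w) \<in> corners D \<rho> \<union> bands D \<theta> t"
  have p: "\<rho> permutes D" using \<rho> by (rule rotations_permutes)
  obtain d s where z: "z = (d, s)" by (cases z)
  from step consider (corner) "d \<in> D" "s" "w = (\<rho> d, False)"
    | (band) "d \<in> D" "w = (\<theta> d, if {d, \<theta> d} \<in> t then s else \<not> s)"
    unfolding z Un_iff mem_corners_iff mem_bands_iff by blast
  then show "(flip_side vx W z, flip_side vx W w) \<in> conn (?C \<union> ?B)"
  proof cases
    case corner
    have v: "vx (\<rho> d) = vx d" by (rule rotations_vx[OF \<rho>])
    show ?thesis
    proof (cases "vx d \<in> W")
      case True
      have "((\<rho> d, True), (d, False)) \<in> ?C"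
        using corner(1) True permutes_in_image[OF p, of d]
        by (simp add: mem_corners_iff flip_rotation_def v permutes_inverses[OF p])
      then have "((\<rho> d, True), (d, False)) \<in> conn (?C \<union> ?B)" by (intro conn_step) simp
      moreover have "flip_side vx W z = (d, False)" "flip_side vx W w = (\<rho> d, True)" using True corner v by (simp_all add: flip_side_def z)
      ultimately show ?thesis using conn_sym by simp
    next
      case False
      then have "((d, True), (\<rho> d, False)) \<in> ?C"
        using corner(1) by (simp add: mem_corners_iff flip_rotation_def)
      moreover have "flip_side vx W z = (d, True)" "flip_side vx W w = (\<rho> d, False)" using False corner v by (simp_all add: flip_side_def z)
      ultimately show ?thesis by (intro conn_step) simp
    qed
  next
    case band
    have "{d, \<theta> d} \<in> sym_diff t (cut_edges D vx \<theta> W) \<longleftrightarrow>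
        ({d, \<theta> d} \<in> t) \<noteq> ((vx d \<in> W) \<noteq> (vx (\<theta> d) \<in> W))"
      unfolding Un_iff Diff_iff mem_cut_edges[OF \<theta> band(1)] by blast
    then have "(flip_side vx W z, flip_side vx W w) \<in> ?B"
      using band(1) unfolding flip_side_def z band(2) prod.case mem_bands_iff
      by (simp only: prod.inject simp_thms) (cases "{d, \<theta> d} \<in> t"; simp; blast)
    then show ?thesis by (intro conn_step) simp
  qed
qed

text \<open>Reversal is an involution on rotations, twists and sides alike, so
  \<open>flip_sides_connected\<close> applied to the reversed data yields the converse
  direction.\<close>

lemma face_count_flip:
  fixes vx :: "'d \<Rightarrow> 'v"
  assumes fin: "finite D" and \<rho>: "\<rho> \<in> rotations D vx" and \<theta>: "fpf_involution_on D \<theta>"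
  shows "face_count D \<theta> (flip_rotation vx W \<rho>) (sym_diff t (cut_edges D vx \<theta> W)) = face_count D \<theta> \<rho> t"
proof -
  let ?\<phi> = "flip_side vx W"
  let ?\<rho> = "flip_rotation vx W \<rho>" and ?t = "sym_diff t (cut_edges D vx \<theta> W)"
  let ?R = "corners D \<rho> \<union> bands D \<theta> t" and ?R' = "corners D ?\<rho> \<union> bands D \<theta> ?t"
  have \<phi>\<phi>: "?\<phi> (?\<phi> z) = z" for z by (cases z) (auto simp: flip_side_def)
  have tt: "sym_diff ?t (cut_edges D vx \<theta> W) = t" by blast
  have fwd: "(?\<phi> z, ?\<phi> w) \<in> conn ?R'" if "(z, w) \<in> conn ?R" for z w
    by (rule flip_sides_connected[OF \<rho> \<theta> that])
  have bwd: "(?\<phi> z, ?\<phi> w) \<in> conn ?R" if "(z, w) \<in> conn ?R'" for z w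
    using flip_sides_connected[OF flip_rotation_in_rotations[OF fin \<rho>] \<theta> that, of W]
    unfolding flip_rotation_flip_rotation[OF fin \<rho>] tt .
  have "card ((D \<times> UNIV) // conn ?R) = card ((D \<times> UNIV) // conn ?R')"
  proof (rule card_quotient_transfer[where f="?\<phi>"])
    show "(x, y) \<in> conn ?R \<longleftrightarrow> (?\<phi> x, ?\<phi> y) \<in> conn ?R'" for x y
      using fwd[of x y] bwd[of "?\<phi> x" "?\<phi> y"] unfolding \<phi>\<phi> by blast
    show "?\<phi> ` (D \<times> UNIV) \<subseteq> D \<times> UNIV" by (auto simp: flip_side_def)
    show "\<exists>x\<in>D \<times> UNIV. (?\<phi> x, y) \<in> conn ?R'" if "y \<in> D \<times> UNIV" for y
    proof (rule bexI)
      show "(?\<phi> (?\<phi> y), y) \<in> conn ?R'" unfolding \<phi>\<phi> by (rule conn_refl)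
      show "?\<phi> y \<in> D \<times> UNIV" using that by (auto simp: flip_side_def)
    qed
  qed
  then show ?thesis by (simp add: face_count_def)
qed

section \<open>Normalising twists along a spanning tree\<close>

text \<open>The cut on the tree determines along each tree edge whether its ends agree about
  membership in \<open>W\<close>, and the value at \<open>r\<close> is fixed; connectedness of the
  tree gives injectivity. Surjectivity follows by counting, because \<open>card T\<close> equals the
  number of vertices other than \<open>r\<close>.\<close>

lemma bij_betw_spanning_tree_cuts:
  assumes G: "finite_multigraph G" and head: "\<And>d. d \<in> darts G \<Longrightarrow> tail (dgraph G) (opp G d) = head (dgraph G) d"
    and T: "is_spanning_tree G T" and r: "r \<in> vertices G"
  shows "bij_betw (\<lambda>W. cut_edges (darts G) (tail (dgraph G)) (opp G) W \<inter> T) (Pow (vertices G - {r})) (Pow T)"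
proof -
  let ?cut = "cut_edges (darts G) (tail (dgraph G)) (opp G)"
  let ?K = "(dgraph G)\<lparr>arcs := \<Union>T\<rparr>"
  have fin: "finite (vertices G)" "finite (darts G)" and \<theta>: "fpf_involution_on (darts G) (opp G)"
    using G by (auto simp: finite_multigraph_def)
  have TE: "T \<subseteq> edges G" and conn: "Digraph_Component.connected ?K" and cT: "card T + 1 = card (vertices G)"
    using T by (auto simp: is_spanning_tree_def)
  have finT: "finite T" by (rule finite_subset[OF TE]) (use fin in \<open>simp add: edges_def\<close>)
  have arc: "e \<in> darts G \<and> {e, opp G e} \<in> T" if e: "e \<in> \<Union>T" for e
  proof -
    obtain X where X: "e \<in> X" "X \<in> T" using e by auto
    then obtain d where d: "d \<in> darts G" "X = {d, opp G d}" using TE by (auto simp: edges_def dart_edge_def)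
    then have o: "opp G d \<in> darts G" "opp G (opp G d) = d" using \<theta> by (auto simp: fpf_involution_on_def)
    show ?thesis
    proof (cases "e = d")
      case True
      then show ?thesis using X d by simp
    next
      case False
      then have "e = opp G d" using X d by simp
      then show ?thesis using X d o by (simp add: insert_commute)
    qed
  qed
  have inj: "inj_on (\<lambda>W. ?cut W \<inter> T) (Pow (vertices G - {r}))"
  proof (rule inj_onI)
    fix W W' assume W: "W \<in> Pow (vertices G - {r})" "W' \<in> Pow (vertices G - {r})" and eq: "?cut W \<inter> T = ?cut W' \<inter> T"
    \<comment> \<open>The vertices at which \<open>W\<close> and \<open>W'\<close> agree contain
      \<open>r\<close> and are closed along tree arcs.\<close>
    have "v \<in> {v. v \<in> W \<longleftrightarrow> v \<in> W'}" if v: "v \<in> vertices G" for v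
    proof (rule connected_closed_set[OF conn])
      show "r \<in> verts ?K" "v \<in> verts ?K" using r v by simp_all
      show "r \<in> {v. v \<in> W \<longleftrightarrow> v \<in> W'}" using W by auto
      fix e assume "e \<in> arcs ?K"
      then have e: "e \<in> darts G" "{e, opp G e} \<in> T" using arc by auto
      then have "{e, opp G e} \<in> ?cut W \<longleftrightarrow> {e, opp G e} \<in> ?cut W'" using eq by blast
      then show "tail ?K e \<in> {v. v \<in> W \<longleftrightarrow> v \<in> W'} \<longleftrightarrow> head ?K e \<in> {v. v \<in> W \<longleftrightarrow> v \<in> W'}"
        unfolding mem_cut_edges[OF \<theta> e(1)] head[OF e(1)] by auto
    qed
    then show "W = W'" using W by blast
  qed
  have "(\<lambda>W. ?cut W \<inter> T) ` Pow (vertices G - {r}) = Pow T"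
  proof (rule card_subset_eq)
    show "finite (Pow T)" using finT by simp
    have "card ((\<lambda>W. ?cut W \<inter> T) ` Pow (vertices G - {r})) = 2 ^ card (vertices G - {r})"
      using inj fin by (simp add: card_image card_Pow)
    also have "card (vertices G - {r}) = card T" using cT r by simp
    finally show "card ((\<lambda>W. ?cut W \<inter> T) ` Pow (vertices G - {r})) = card (Pow T)"
      using finT by (simp add: card_Pow)
  qed auto
  with inj show ?thesis by (simp add: bij_betw_def)
qed

lemma euler_genus_law_eq_euler_law:
  fixes G :: "('v, 'd) multigraph"
  assumes conn: "connected_multigraph G" and T: "is_spanning_tree G T"
  shows "euler_genus_law G T = euler_law True G"
proof -
  interpret bidirected_digraph "dgraph G" "opp G" using conn by (simp add: connected_multigraph_def)
  let ?D = "darts G" and ?\<theta> = "opp G" and ?vx = "tail (dgraph G)"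
  let ?cut = "cut_edges ?D ?vx ?\<theta>"
  let ?GE = "general_embeddings G T" and ?S = "rotation_systems G \<times> twists True ?D ?\<theta>"
  have G: "finite_multigraph G" by (rule connected_multigraph_imp_finite[OF conn])
  then have fin: "finite (vertices G)" "finite ?D" and \<theta>: "fpf_involution_on ?D ?\<theta>"
    by (auto simp: finite_multigraph_def)
  have R: "rotation_systems G = rotations ?D ?vx"
    using G by (intro rotation_systems_eq_rotations) (auto simp: finite_multigraph_def)
  have tw: "twists True ?D ?\<theta> = Pow (edges G)" by (simp add: twists_def edges_eq_dart_edges)
  have GE: "(\<rho>, t) \<in> ?GE \<longleftrightarrow> \<rho> \<in> rotations ?D ?vx \<and> t \<subseteq> edges G \<and> t \<inter> T = {}" for \<rho> t
    by (auto simp: general_embeddings_def signed_rotation_systems_def R)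
  have cutE: "?cut W \<subseteq> edges G" for W unfolding edges_eq_dart_edges by (rule cut_edges_subset)
  obtain r where r: "r \<in> vertices G"
    using conn by (auto simp: connected_multigraph_def Digraph_Component.connected_def strongly_connected_def mk_symmetric_def)
  let ?P = "Pow (vertices G - {r})"
  have cuts: "bij_betw (\<lambda>W. ?cut W \<inter> T) ?P (Pow T)"
    by (rule bij_betw_spanning_tree_cuts[OF G _ T r]) simp
  define B :: "(('d \<Rightarrow> 'd) \<times> 'd set set) \<times> 'v set \<Rightarrow> _"
    where "B = (\<lambda>((\<rho>, t), W). (flip_rotation ?vx W \<rho>, sym_diff t (?cut W)))"
  have flip: "flip_rotation ?vx W \<rho> \<in> rotations ?D ?vx" "flip_rotation ?vx W (flip_rotation ?vx W \<rho>) = \<rho>"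
    if "\<rho> \<in> rotations ?D ?vx" for \<rho> W
    using that flip_rotation_in_rotations flip_rotation_flip_rotation fin by blast+
  have dd: "sym_diff (sym_diff t c) c = t" for t c :: "'d set set" by blast
  have bij: "bij_betw B (?GE \<times> ?P) ?S"
  proof (rule bij_betw_imageI)
    show "inj_on B (?GE \<times> ?P)"
    proof (rule inj_onI)
      fix p q assume p: "p \<in> ?GE \<times> ?P" and q: "q \<in> ?GE \<times> ?P" and eq: "B p = B q"
      obtain \<rho> t W where p': "p = ((\<rho>, t), W)" by (metis surj_pair)
      obtain \<rho>' t' W' where q': "q = ((\<rho>', t'), W')" by (metis surj_pair)
      have 1: "\<rho> \<in> rotations ?D ?vx" "t \<inter> T = {}" "W \<in> ?P" using p by (simp_all add: p' GE)
      have 2: "\<rho>' \<in> rotations ?D ?vx" "t' \<inter> T = {}" "W' \<in> ?P" using q by (simp_all add: q' GE)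
      have e: "flip_rotation ?vx W \<rho> = flip_rotation ?vx W' \<rho>'" "sym_diff t (?cut W) = sym_diff t' (?cut W')"
        using eq by (simp_all add: B_def p' q')
      \<comment> \<open>Since \<open>t\<close> avoids the tree, the reversed system shows nothing
        but the cut on tree edges, and this determines \<open>W\<close>.\<close>
      have "sym_diff t (?cut W) \<inter> T = ?cut W \<inter> T" "sym_diff t' (?cut W') \<inter> T = ?cut W' \<inter> T"
        using 1(2) 2(2) by blast+
      then have "?cut W \<inter> T = ?cut W' \<inter> T" using e(2) by simp
      then have W: "W = W'" using inj_onD[OF bij_betw_imp_inj_on[OF cuts]] 1(3) 2(3) by blast
      moreover have "\<rho> = \<rho>'"
        using flip(2)[OF 1(1), of W] flip(2)[OF 2(1), of W'] e(1) unfolding W by metis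
      moreover have "t = t'"
        using arg_cong[OF e(2), of "\<lambda>s. sym_diff s (?cut W')"] unfolding W dd .
      ultimately show "p = q" by (simp add: p' q')
    qed
    show "B ` (?GE \<times> ?P) = ?S"
    proof
      show "B ` (?GE \<times> ?P) \<subseteq> ?S"
      proof (rule image_subsetI)
        fix p assume p: "p \<in> ?GE \<times> ?P"
        obtain \<rho> t W where p': "p = ((\<rho>, t), W)" by (metis surj_pair)
        have "\<rho> \<in> rotations ?D ?vx" "t \<subseteq> edges G" using p by (simp_all add: p' GE)
        moreover from this have "sym_diff t (?cut W) \<subseteq> edges G" using cutE[of W] by blast
        ultimately show "B p \<in> ?S" using flip(1) by (simp add: p' B_def R tw)
      qed
      show "?S \<subseteq> B ` (?GE \<times> ?P)"
      proof (rule subsetI)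
        fix z assume "z \<in> ?S"
        then obtain \<rho> t where z: "z = (\<rho>, t)" "\<rho> \<in> rotations ?D ?vx" "t \<subseteq> edges G" by (auto simp: R tw)
        have "t \<inter> T \<in> Pow T" by simp
        then obtain W where W: "W \<in> ?P" "t \<inter> T = ?cut W \<inter> T"
          unfolding bij_betw_imp_surj_on[OF cuts, symmetric] by auto
        let ?p = "((flip_rotation ?vx W \<rho>, sym_diff t (?cut W)), W)"
        have "sym_diff t (?cut W) \<subseteq> edges G" using cutE[of W] z(3) by blast
        moreover have "sym_diff t (?cut W) \<inter> T = {}" using W(2) by blast
        ultimately have "?p \<in> ?GE \<times> ?P" using W(1) flip(1)[OF z(2)] by (simp add: GE)
        moreover have "B ?p = z" using flip(2)[OF z(2)] dd by (simp add: B_def z(1))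
        ultimately show "z \<in> B ` (?GE \<times> ?P)" by (metis image_eqI)
      qed
    qed
  qed
  have finS: "finite ?S" "?S \<noteq> {}"
    by (simp_all add: R rotations_nonempty finite_rotations finite_twists twists_nonempty fin)
  have finGP: "finite (?GE \<times> ?P)" "?GE \<times> ?P \<noteq> {}"
    using bij_betw_finite[OF bij] bij finS by (auto simp: bij_betw_def)
  have "?GE \<subseteq> ?S" by (auto simp: general_embeddings_def signed_rotation_systems_def tw)
  then have finGE: "finite ?GE" using finS(1) by (rule finite_subset)
  have neGE: "?GE \<noteq> {}" using finGP(2) by auto
  have inv: "euler_genus G (B p) = euler_genus G (fst p)" if p: "p \<in> ?GE \<times> ?P" for p
  proof -
    obtain \<rho> t W where p': "p = ((\<rho>, t), W)" by (metis surj_pair)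
    have "\<rho> \<in> rotations ?D ?vx" using p by (simp add: p' GE)
    then show ?thesis
      using face_count_flip[OF fin(2) _ \<theta>, of \<rho> ?vx W t]
      by (simp add: p' B_def euler_genus_def num_faces_eq_face_count)
  qed
  have "euler_law True G = map_pmf (euler_genus G) (map_pmf B (pmf_of_set (?GE \<times> ?P)))"
    unfolding euler_law_def map_pmf_of_set_bij_betw[OF bij finGP(2,1)] ..
  also have "\<dots> = map_pmf (\<lambda>p. euler_genus G (fst p)) (pmf_of_set (?GE \<times> ?P))"
    unfolding pmf.map_comp by (rule map_pmf_cong[OF refl]) (use inv finGP in simp)
  also have "\<dots> = map_pmf (euler_genus G) (map_pmf fst (pmf_of_set (?GE \<times> ?P)))"
    by (simp only: pmf.map_comp o_def)
  also have "pmf_of_set (?GE \<times> ?P) = pair_pmf (pmf_of_set ?GE) (pmf_of_set ?P)"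
    using fin(1) by (intro pmf_of_set_Times finGE neGE) auto
  finally show ?thesis by (simp add: map_fst_pair_pmf euler_genus_law_def)
qed

section \<open>Graphs of bounded size\<close>

lemma deviation_from_mean_le:
  assumes fin: "finite (set_pmf p)" and x: "\<And>y. y \<in> set_pmf p \<Longrightarrow> \<bar>x - y\<bar> \<le> B"
  shows "\<bar>x - mean p\<bar> \<le> B"
proof -
  have int: "integrable (measure_pmf p) f" for f :: "real \<Rightarrow> real"
    using fin by (intro integrable_measure_pmf_finite)
  have "x - mean p = measure_pmf.expectation p (\<lambda>y. x - y)"
    by (subst Bochner_Integration.integral_diff[OF int int]) simp
  also have "\<bar>\<dots>\<bar> \<le> measure_pmf.expectation p (\<lambda>y. \<bar>x - y\<bar>)"
    by (rule integral_abs_bound)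
  also have "\<dots> \<le> measure_pmf.expectation p (\<lambda>_. B)"
    using x by (intro integral_mono_AE int) (simp add: AE_measure_pmf_iff)
  finally show ?thesis by simp
qed

text \<open>The mean is at distance at least \<open>\<delta> / 2\<close> from one of the two atoms,
  and the single term of that atom in the variance is already large enough.\<close>

lemma var_ge:
  assumes fin: "finite (set_pmf p)" and xy: "\<delta> \<le> \<bar>x - y\<bar>" "0 \<le> \<delta>" and c: "c \<le> pmf p x" "c \<le> pmf p y" "0 \<le> c"
  shows "c * (\<delta>\<^sup>2 / 4) \<le> var p"
proof -
  have pt: "pmf p z * (z - mean p)\<^sup>2 \<le> var p" for z
  proof (cases "z \<in> set_pmf p")
    case True
    have "var p = (\<Sum>a\<in>set_pmf p. pmf p a *\<^sub>R (a - mean p)\<^sup>2)"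
      by (rule integral_measure_pmf[OF fin]) auto
    also have "\<dots> \<ge> pmf p z *\<^sub>R (z - mean p)\<^sup>2"
      by (rule member_le_sum[OF True _ fin]) simp
    finally show ?thesis by simp
  next
    case False
    then show ?thesis by (simp add: set_pmf_iff)
  qed
  have "\<delta> / 2 \<le> \<bar>x - mean p\<bar> \<or> \<delta> / 2 \<le> \<bar>y - mean p\<bar>" using xy by linarith
  then obtain z where z: "\<delta> / 2 \<le> \<bar>z - mean p\<bar>" "c \<le> pmf p z" using c by blast
  have "\<delta>\<^sup>2 / 4 = (\<delta> / 2)\<^sup>2" by (simp add: power_divide)
  also have "\<dots> \<le> \<bar>z - mean p\<bar>\<^sup>2" using z(1) xy(2) by (intro power_mono) auto
  finally have "c * (\<delta>\<^sup>2 / 4) \<le> pmf p z * (z - mean p)\<^sup>2"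
    using z(2) c(3) by (intro mult_mono) auto
  then show ?thesis using pt[of z] by linarith
qed

lemma conv_pmf_scale:
  "map_pmf (\<lambda>x. x / c) (conv_pmf p q) = conv_pmf (map_pmf (\<lambda>x. x / c) p) (map_pmf (\<lambda>x. x / c) q)"
  unfolding conv_pmf_def map_pair[symmetric] pmf.map_comp
  by (rule map_pmf_cong) (auto simp: add_divide_distrib)

text \<open>There are two sides per dart; the additional 1 covers the default value for an empty
  dart set.\<close>

lemma face_count_le: "finite D \<Longrightarrow> face_count D \<theta> \<rho> t \<le> 2 * card D + 1"
proof -
  assume fin: "finite D"
  have "card ((D \<times> UNIV) // conn (corners D \<rho> \<union> bands D \<theta> t)) \<le> card (D \<times> (UNIV :: bool set))"
    unfolding quotient_eq_image using fin by (intro card_image_le) simp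
  then show ?thesis using fin by (simp add: face_count_def card_cartesian_product)
qed

lemma finite_embeddings:
  assumes "finite_multigraph G"
  shows "finite (rotation_systems G \<times> twists \<epsilon> (darts G) (opp G))"
    "rotation_systems G \<times> twists \<epsilon> (darts G) (opp G) \<noteq> {}"
proof -
  have "rotation_systems G = rotations (darts G) (tail (dgraph G))"
    using assms by (intro rotation_systems_eq_rotations) (auto simp: finite_multigraph_def)
  then show "finite (rotation_systems G \<times> twists \<epsilon> (darts G) (opp G))"
    "rotation_systems G \<times> twists \<epsilon> (darts G) (opp G) \<noteq> {}"
    using assms by (simp_all add: finite_multigraph_def rotations_nonempty finite_rotations finite_twists twists_nonempty)
qed

lemma set_euler_law:
  assumes "finite_multigraph G"
  shows "set_pmf (euler_law \<epsilon> G) = euler_genus G ` (rotation_systems G \<times> twists \<epsilon> (darts G) (opp G))"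
  using finite_embeddings[OF assms, of \<epsilon>] by (simp add: euler_law_def)

text \<open>A crude bound suffices: rotations are permutations of at most \<open>2 * M\<close>
  darts, and twists form a subset of at most \<open>M\<close> edges.\<close>

lemma card_embeddings_le:
  assumes G: "finite_multigraph G" and M: "card (edges G) \<le> M"
  shows "card (rotation_systems G \<times> twists \<epsilon> (darts G) (opp G)) \<le> fact (2 * M) * 2 ^ M"
proof -
  have fin: "finite (darts G)" using G by (simp add: finite_multigraph_def)
  have D: "card (darts G) = 2 * card (edges G)"
    using card_dart_edges[of "darts G" "opp G"] G by (simp add: finite_multigraph_def edges_eq_dart_edges)
  have finE: "finite (edges G)" using fin by (simp add: edges_def)
  have "card (rotation_systems G) \<le> card {\<rho>. \<rho> permutes darts G}"
    by (rule card_mono) (use fin in \<open>auto simp: rotation_systems_def finite_permutations\<close>)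
  also have "\<dots> = fact (card (darts G))" by (rule card_permutations[OF refl fin])
  also have "\<dots> \<le> fact (2 * M)" using D M by (intro fact_mono) simp
  finally have "card (rotation_systems G) \<le> fact (2 * M)" .
  moreover have "card (twists \<epsilon> (darts G) (opp G)) \<le> 2 ^ M"
  proof -
    have "card (twists \<epsilon> (darts G) (opp G)) \<le> card (Pow (edges G))"
      by (rule card_mono) (use finE in \<open>auto simp: twists_def edges_eq_dart_edges\<close>)
    also have "\<dots> \<le> 2 ^ M" using finE M by (simp add: card_Pow)
    finally show ?thesis .
  qed
  ultimately show ?thesis by (simp add: card_cartesian_product mult_mono)
qed

lemma euler_law_range:
  assumes G: "finite_multigraph G" and M: "card (edges G) \<le> M"
    and x: "x \<in> set_pmf (euler_law \<epsilon> G)" and y: "y \<in> set_pmf (euler_law \<epsilon> G)"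
  shows "\<bar>x - y\<bar> \<le> 4 * real M + 1"
proof -
  have fin: "finite (darts G)" using G by (simp add: finite_multigraph_def)
  have D: "card (darts G) = 2 * card (edges G)"
    using card_dart_edges[of "darts G" "opp G"] G by (simp add: finite_multigraph_def edges_eq_dart_edges)
  obtain \<rho> t \<rho>' t' where "x = euler_genus G (\<rho>, t)" "y = euler_genus G (\<rho>', t')"
    using x y unfolding set_euler_law[OF G] by auto
  then have "x - y = real (num_faces G \<rho>' t') - real (num_faces G \<rho> t)"
    by (simp add: euler_genus_def)
  moreover have "num_faces G \<rho>' t' \<le> 4 * M + 1" "num_faces G \<rho> t \<le> 4 * M + 1"
    using face_count_le[OF fin, of "opp G" \<rho>' t'] face_count_le[OF fin, of "opp G" \<rho> t] D M
    by (simp_all add: num_faces_eq_face_count)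
  ultimately show ?thesis by linarith
qed

text \<open>A value that occurs at all is attained by at least one of boundedly many equally likely
  embeddings.\<close>

lemma pmf_euler_law_ge:
  assumes G: "finite_multigraph G" and M: "card (edges G) \<le> M"
    and x: "x \<in> set_pmf (euler_law \<epsilon> G)"
  shows "1 / (fact (2 * M) * 2 ^ M) \<le> pmf (euler_law \<epsilon> G) x"
proof -
  let ?A = "rotation_systems G \<times> twists \<epsilon> (darts G) (opp G)"
  note A = finite_embeddings[OF G, of \<epsilon>]
  obtain a where a: "a \<in> ?A" "x = euler_genus G a" using x unfolding set_euler_law[OF G] by auto
  have "real (card ?A) \<le> real (fact (2 * M) * 2 ^ M)"
    using card_embeddings_le[OF G M, of \<epsilon>] by (rule of_nat_mono)
  moreover have "0 < card ?A" using A by (simp add: card_gt_0_iff)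
  ultimately have "1 / (fact (2 * M) * 2 ^ M) \<le> 1 / real (card ?A)"
    by (intro divide_left_mono) auto
  also have "\<dots> = measure (pmf_of_set ?A) {a}"
    using A a(1) by (simp add: measure_pmf_single)
  also have "\<dots> \<le> measure (pmf_of_set ?A) (euler_genus G -` {x})"
    using a(2) by (intro measure_pmf.finite_measure_mono) auto
  also have "\<dots> = pmf (euler_law \<epsilon> G) x"
    by (simp add: euler_law_def pmf_map)
  finally show ?thesis .
qed

text \<open>On one graph, values of the Euler-genus differ by integers. Distinct values are
  therefore at least 1 apart, and \<open>var_ge\<close> with \<open>\<delta> = 1\<close> gives the
  factor \<open>1 / 4\<close>.\<close>

lemma var_euler_law_ge:
  assumes G: "finite_multigraph G" and M: "card (edges G) \<le> M"
    and x: "x \<in> set_pmf (euler_law \<epsilon> G)" and y: "y \<in> set_pmf (euler_law \<epsilon> G)" and "x \<noteq> y"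
  shows "1 / (fact (2 * M) * 2 ^ M) * (1 / 4) \<le> var (euler_law \<epsilon> G)"
proof -
  obtain \<rho> t \<rho>' t' where xy: "x = euler_genus G (\<rho>, t)" "y = euler_genus G (\<rho>', t')"
    using x y unfolding set_euler_law[OF G] by auto
  then have "x - y = real_of_int (int (num_faces G \<rho>' t') - int (num_faces G \<rho> t))"
    by (simp add: euler_genus_def)
  moreover from this have "int (num_faces G \<rho>' t') - int (num_faces G \<rho> t) \<noteq> 0"
    using \<open>x \<noteq> y\<close> by auto
  ultimately have "1 \<le> \<bar>x - y\<bar>" by linarith
  moreover have "finite (set_pmf (euler_law \<epsilon> G))"
    unfolding set_euler_law[OF G] by (rule finite_imageI[OF finite_embeddings(1)[OF G]])
  ultimately show ?thesis
    using var_ge[of "euler_law \<epsilon> G" 1 x y "1 / (fact (2 * M) * 2 ^ M)"]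
      pmf_euler_law_ge[OF G M x] pmf_euler_law_ge[OF G M y] by simp
qed

text \<open>The scale \<open>s\<close> treats both laws at once: \<open>s = 2\<close> turns the
  orientable Euler-genus into the genus, and \<open>s = 1\<close> leaves the general Euler-genus as
  it is.\<close>

lemma asymptotically_normal_bounded_graphs:
  fixes H :: "nat \<Rightarrow> ('w, 'e) multigraph" and G :: "nat \<Rightarrow> ('v, 'd) multigraph"
  assumes H: "\<And>n. n \<ge> 1 \<Longrightarrow> connected_multigraph (H n)"
    and M: "\<And>n. n \<ge> 1 \<Longrightarrow> card (edges (H n)) \<le> M"
    and G: "\<And>n. n \<ge> 1 \<Longrightarrow> connected_multigraph (G n)"
    and tree: "tree_like_from H G"
    and inf: "\<exists>\<^sub>\<infinity>n. n \<ge> 1 \<and> (\<exists>x\<in>set_pmf (euler_law \<epsilon> (H n)). \<exists>y\<in>set_pmf (euler_law \<epsilon> (H n)). x \<noteq> y)"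
    and s: "0 < s"
    and p: "\<And>n. n \<ge> 1 \<Longrightarrow> p n = map_pmf (\<lambda>x. x / s) (euler_law \<epsilon> (G n))"
  shows "asymptotically_normal p"
proof -
  define q where "q n = map_pmf (\<lambda>x. x / s) (euler_law \<epsilon> (H n))" for n
  have finH: "finite_multigraph (H n)" and finG: "finite_multigraph (G n)" if "n \<ge> 1" for n
    using connected_multigraph_imp_finite H[OF that] G[OF that] by auto
  have finq: "finite (set_pmf (euler_law \<epsilon> (H n)))" if "n \<ge> 1" for n
    unfolding set_euler_law[OF finH[OF that]] by (rule finite_imageI[OF finite_embeddings(1)[OF finH[OF that]]])
  have mean_q: "mean (q n) = mean (euler_law \<epsilon> (H n)) / s" for n
    by (simp add: q_def)
  have var_q: "var (q n) = var (euler_law \<epsilon> (H n)) / s\<^sup>2" for n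
    unfolding mean_q by (simp add: q_def power_divide flip: diff_divide_distrib)
  let ?c = "1 / (fact (2 * M) * 2 ^ M) * (1 / 4) / s\<^sup>2 :: real"
  show ?thesis
  proof (rule asymptotically_normal_conv_pmf[where q=q and c="?c"])
    have "multigraph_iso (H 1) (G 1)" using tree by (simp add: tree_like_from_def)
    from euler_law_iso[OF this finH] show "p 1 = q 1" by (simp add: p q_def)
    show "finite (set_pmf (q n))" if "n \<ge> 1" for n using finq[OF that] by (simp add: q_def)
    show "p (Suc n) = conv_pmf (p n) (q (Suc n))" if n: "n \<ge> 1" for n
    proof -
      have n1: "Suc n \<ge> 1" by simp
      have "1 < Suc n" using n by simp
      then obtain u v where uv: "u \<in> vertices (G n)" "v \<in> vertices (H (Suc n))"
        and iso: "multigraph_iso (bar_amalgamation (G n) u (H (Suc n)) v) (G (Suc n))"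
        using tree unfolding tree_like_from_def by (metis diff_Suc_1)
      have "euler_law \<epsilon> (G (Suc n)) = euler_law \<epsilon> (bar_amalgamation (G n) u (H (Suc n)) v)"
        by (rule euler_law_iso[OF iso bar_amalgamation_finite[OF finG[OF n] finH[OF n1] uv]])
      also have "\<dots> = conv_pmf (euler_law \<epsilon> (G n)) (euler_law \<epsilon> (H (Suc n)))"
        by (rule euler_law_bar_amalgamation[OF finG[OF n] connected_multigraph_dart_at[OF G[OF n] uv(1)]
              finH[OF n1] connected_multigraph_dart_at[OF H[OF n1] uv(2)] uv])
      finally show ?thesis unfolding p[OF n] p[OF n1] q_def by (simp add: conv_pmf_scale)
    qed
    show "\<bar>x - mean (q n)\<bar> \<le> (4 * real M + 1) / s" if n: "n \<ge> 1" and x: "x \<in> set_pmf (q n)" for n x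
    proof -
      obtain z where z: "z \<in> set_pmf (euler_law \<epsilon> (H n))" "x = z / s" using x by (auto simp: q_def)
      have "\<bar>z - mean (euler_law \<epsilon> (H n))\<bar> \<le> 4 * real M + 1"
        by (rule deviation_from_mean_le[OF finq[OF n] euler_law_range[OF finH[OF n] M[OF n] z(1)]])
      moreover have "x - mean (q n) = (z - mean (euler_law \<epsilon> (H n))) / s"
        by (simp add: mean_q z(2) diff_divide_distrib)
      ultimately show ?thesis using s by (simp add: divide_right_mono)
    qed
    show "0 < ?c" using s by simp
    from inf show "\<exists>\<^sub>\<infinity>n. ?c \<le> var (q n)"
    proof (rule frequently_elim1)
      fix n assume "n \<ge> 1 \<and> (\<exists>x\<in>set_pmf (euler_law \<epsilon> (H n)). \<exists>y\<in>set_pmf (euler_law \<epsilon> (H n)). x \<noteq> y)"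
      then obtain x y where n: "n \<ge> 1" and "x \<in> set_pmf (euler_law \<epsilon> (H n))" "y \<in> set_pmf (euler_law \<epsilon> (H n))" "x \<noteq> y"
        by blast
      from var_euler_law_ge[OF finH[OF n] M[OF n] this(2-4)] show "?c \<le> var (q n)"
        unfolding var_q by (rule divide_right_mono) simp
    qed
  qed
qed

lemma Max_image_gt_Min_imageE:
  fixes f :: "'a \<Rightarrow> real"
  assumes "finite A" "A \<noteq> {}" "Max (f ` A) > Min (f ` A)"
  obtains x y where "x \<in> A" "y \<in> A" "f x \<noteq> f y"
proof -
  have "Max (f ` A) \<in> f ` A" "Min (f ` A) \<in> f ` A" using assms(1,2) by (simp_all add: Max_in Min_in)
  then obtain x y where "x \<in> A" "y \<in> A" "Max (f ` A) = f x" "Min (f ` A) = f y" by auto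
  then show thesis using assms(3) that[of x y] by simp
qed

theorem theorem3p4:
  fixes M :: nat
    and H :: "nat \<Rightarrow> ('w, 'e) multigraph"
    and G :: "nat \<Rightarrow> ('v, 'd) multigraph"
  assumes "\<And>n. n \<ge> 1 \<Longrightarrow> connected_multigraph (H n)"
    and "\<And>n. n \<ge> 1 \<Longrightarrow> card (edges (H n)) \<le> M"
    and "\<And>n. n \<ge> 1 \<Longrightarrow> connected_multigraph (G n)"
    and "tree_like_from H G"
  shows "((\<exists>\<^sub>\<infinity>n. genus_max (H n) > genus_min (H n)) \<longrightarrow>
            asymptotically_normal (\<lambda>n. genus_law (G n))) \<and>
         ((\<exists>\<^sub>\<infinity>n. euler_genus_max (H n) > euler_genus_min (H n)) \<longrightarrow>
            (\<forall>T. (\<forall>n\<ge>1. is_spanning_tree (G n) (T n)) \<longrightarrow>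
               asymptotically_normal (\<lambda>n. euler_genus_law (G n) (T n))))"
proof (intro conjI impI allI)
  have finH: "finite_multigraph (H n)" and finG: "finite_multigraph (G n)" if "n \<ge> 1" for n
    using connected_multigraph_imp_finite assms(1,3) that by auto
  \<comment> \<open>The entry at index 0 satisfies no hypothesis; deleting it does not affect
    infinitely many occurrences.\<close>
  have inf_ge1: "\<exists>\<^sub>\<infinity>n. n \<ge> 1 \<and> Q n" if "\<exists>\<^sub>\<infinity>n. P n" "\<And>n. n \<ge> 1 \<Longrightarrow> P n \<Longrightarrow> Q n" for P Q :: "nat \<Rightarrow> bool"
    using that(1)
  proof (rule frequently_rev_mp)
    show "\<forall>\<^sub>\<infinity>n. P n \<longrightarrow> n \<ge> 1 \<and> Q n" using that(2) unfolding MOST_nat_le by blast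
  qed
  {
    assume "\<exists>\<^sub>\<infinity>n. genus_max (H n) > genus_min (H n)"
    then have inf: "\<exists>\<^sub>\<infinity>n. n \<ge> 1 \<and> (\<exists>x\<in>set_pmf (euler_law False (H n)). \<exists>y\<in>set_pmf (euler_law False (H n)). x \<noteq> y)"
    proof (rule inf_ge1)
      fix n assume n: "n \<ge> 1" and gt: "genus_max (H n) > genus_min (H n)"
      have "rotation_systems (H n) = fst ` (rotation_systems (H n) \<times> twists False (darts (H n)) (opp (H n)))"
        by (simp add: twists_def)
      then have "finite (rotation_systems (H n))" "rotation_systems (H n) \<noteq> {}"
        using finite_embeddings[OF finH[OF n], of False] by (metis finite_imageI, simp)
      from this gt[unfolded genus_max_def genus_min_def]
      obtain \<rho> \<rho>' where \<rho>: "\<rho> \<in> rotation_systems (H n)" "\<rho>' \<in> rotation_systems (H n)" "genus (H n) \<rho> \<noteq> genus (H n) \<rho>'"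
        by (rule Max_image_gt_Min_imageE)
      then have "euler_genus (H n) (\<rho>, {}) \<noteq> euler_genus (H n) (\<rho>', {})" by (simp add: genus_def)
      moreover have "euler_genus (H n) (\<sigma>, {}) \<in> set_pmf (euler_law False (H n))" if "\<sigma> \<in> rotation_systems (H n)" for \<sigma>
        unfolding set_euler_law[OF finH[OF n]] using that by (intro imageI) (simp add: twists_def)
      ultimately show "\<exists>x\<in>set_pmf (euler_law False (H n)). \<exists>y\<in>set_pmf (euler_law False (H n)). x \<noteq> y"
        using \<rho>(1,2) by blast
    qed
    show "asymptotically_normal (\<lambda>n. genus_law (G n))"
      by (rule asymptotically_normal_bounded_graphs[OF assms inf, of 2]) (simp_all add: genus_law_eq finG)
  }
  {
    fix T
    assume "\<exists>\<^sub>\<infinity>n. euler_genus_max (H n) > euler_genus_min (H n)" and T: "\<forall>n\<ge>1. is_spanning_tree (G n) (T n)"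
    from this(1) have inf: "\<exists>\<^sub>\<infinity>n. n \<ge> 1 \<and> (\<exists>x\<in>set_pmf (euler_law True (H n)). \<exists>y\<in>set_pmf (euler_law True (H n)). x \<noteq> y)"
    proof (rule inf_ge1)
      fix n assume n: "n \<ge> 1" and gt: "euler_genus_max (H n) > euler_genus_min (H n)"
      have S: "signed_rotation_systems (H n) = rotation_systems (H n) \<times> twists True (darts (H n)) (opp (H n))"
        by (simp add: signed_rotation_systems_def twists_def edges_eq_dart_edges)
      from finite_embeddings[OF finH[OF n], of True] gt[unfolded euler_genus_max_def euler_genus_min_def S]
      show "\<exists>x\<in>set_pmf (euler_law True (H n)). \<exists>y\<in>set_pmf (euler_law True (H n)). x \<noteq> y"
        unfolding set_euler_law[OF finH[OF n]] by (rule Max_image_gt_Min_imageE) blast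
    qed
    show "asymptotically_normal (\<lambda>n. euler_genus_law (G n) (T n))"
      \<comment> \<open>The trees \<open>T n\<close> disappear here, since the Euler-genus law is
        the same for every spanning tree of \<open>G n\<close>.\<close>
      by (rule asymptotically_normal_bounded_graphs[OF assms inf, of 1])
         (use T in \<open>simp_all add: euler_genus_law_eq_euler_law assms(3)\<close>)
  }
qed

end
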